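(* Let $A$ be a braided bialgebra over a field $K$ with infinitesimal braided Lie algebra $(P,c_P,b_P)$, and let $\lambda:P\to A$ be the inclusion. Let $(V,c)$ be a braided vector space with a bracket $b$. Then every morphism of braided brackets $h:(V,c,b)\to(P,c_P,b_P)$ can be lifted to a morphism of braided bialgebras $\overline h:U(V,c,b)\to A$, i.e. such that $\overline h\circ i_U=\lambda\circ h$, where $i_U:V\to U(V,c,b)$ is the canonical map.
   Context: Fix a field $K$; all vector spaces, tensor products and maps are over $K$ ($K$-linear). An object also denotes its identity map. Braided vector space $(V,c)$: $c:V\otimes V\to V\otimes V$ linear with $(c\otimes V)(V\otimes c)(c\otimes V)=(V\otimes c)(c\otimes V)(V\otimes c)$; a morphism $f:(V,c_V)\to(W,c_W)$ is linear with $c_W(f\otimes f)=(f\otimes f)c_V$. Braided algebra $(A,m,u,c)$: an associative unital algebra and braided vector space with $c(m\otimes A)=(A\otimes m)(c\otimes A)(A\otimes c)$, $c(A\otimes m)=(m\otimes A)(A\otimes c)(c\otimes A)$, $c(u\otimes A)=A\otimes u$, $c(A\otimes u)=u\otimes A$. Braided coalgebra $(C,\Delta,\varepsilon,c)$: a coassociative counital coalgebra and braided vector space with $(\Delta\otimes C)c=(C\otimes c)(c\otimes C)(C\otimes\Delta)$, $(C\otimes\Delta)c=(c\otimes C)(C\otimes c)(\Delta\otimes C)$, $(\varepsilon\otimes C)c=C\otimes\varepsilon$, $(C\otimes\varepsilon)c=\varepsilon\otimes C$. Braided bialgebra $(B,m,u,\Delta,\varepsilon,c)$: a braided algebra and braided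 coalgebra with $\Delta m=(m\otimes m)(B\otimes c\otimes B)(\Delta\otimes\Delta)$, $\Delta(1)=1\otimes 1$, and $\varepsilon$ an algebra map. Morphisms of braided (bi)algebras are (bi)algebra maps that are morphisms of braided vector spaces. $P(B)=\{x\in B\mid \Delta(x)=x\otimes1+1\otimes x\}$. The braiding $c$ of $B$ satisfies $c(P(B)\otimes B)\subseteq B\otimes P(B)$ and $c(B\otimes P(B))\subseteq P(B)\otimes B$, so it restricts to a braiding $c_P$ on $P(B)$; $(P(B),c_P)$ is the infinitesimal part of $B$. A braided bialgebra map $f:B\to B'$ induces $P(f):P(B)\to P(B')$. Braided tensor algebra $T(V,c)$: the tensor algebra $T(V)$ with the unique braiding $c_T$ extending $c$ and making it a braided algebra, and with $\Delta_T$, $\varepsilon_T$ the algebra maps $\Delta_T:T(V)\to T(V)\otimes_c T(V)$, $\varepsilon_T:T(V)\to K$ such that $\Delta_T(v)=v\otimes1+1\otimes v$, $\varepsilon_T(v)=0$ for $v\in V$, where $T\otimes_cT$ has multiplication $(m_T\otimes m_T)(T\otimes c_T\otimes T)$. A bracket on a braided vector space $(V,c)$ is a family $b=(b^{[n]})_{n\in\mathbb N}$ of linear maps defined together with braided bialgebras $U^{[n]}=U_V^{[n]}$ and braided vector space morphisms $i^{[n]}=i_V^{[n]}:V\to P^{[n]}=P_V^{[n]}:=P(U^{[n]})$ as follows. $U^{[0]}=T(V,c)$ and $i^{[0]}$ is the inclusion. For each $n$, $b^{[n]}:P^{[n]}\to V$ is linear and, with $V^{[n]}:=i^{[n]}(V)$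 and $c$ the braiding of $U^{[n]}$, one has on $P^{[n]}\otimes V^{[n]}$ and $V^{[n]}\otimes P^{[n]}$ respectively $c(i^{[n]}b^{[n]}\otimes V^{[n]})=(V^{[n]}\otimes i^{[n]}b^{[n]})c$ and $c(V^{[n]}\otimes i^{[n]}b^{[n]})=(i^{[n]}b^{[n]}\otimes V^{[n]})c$ (these make sense as $c$ maps $P^{[n]}\otimes V^{[n]}$ into $V^{[n]}\otimes P^{[n]}$ and conversely). Then $U^{[n+1]}=U^{[n]}/\big((\mathrm{Id}-i^{[n]}b^{[n]})[P^{[n]}]\big)$ (quotient by the two-sided ideal generated) with the unique braided bialgebra structure making the projection $\pi_n^{n+1}:U^{[n]}\to U^{[n+1]}$ a braided bialgebra map, and $i^{[n+1]}=P(\pi_n^{n+1})i^{[n]}$. The universal enveloping algebra is the direct limit $U(V,c,b)=\varinjlim U^{[n]}$ (a braided bialgebra), with canonical map $i_U:V\to U(V,c,b)$. $(V,c,b)$ is a braided Lie algebra if $i_U$ is injective. Morphism of braided brackets $h:(V,c_V,b_V)\to(W,c_W,b_W)$: a morphism of braided vector spaces with $h\,b_V^{[n]}=b_W^{[n]}P_h^{[n]}$ for all $n$, where $U_h^{[0]}:T(V,c_V)\to T(W,c_W)$ is the braided bialgebra map extending $h$, $P_h^{[n]}:P_V^{[n]}\to P_W^{[n]}$ is induced by $U_h^{[n]}:U_V^{[n]}\to U_W^{[n]}$, and $U_h^{[n+1]}$ is the map induced by $U_h^{[n]}$ on the quotients (it exists once the equality holds for $n$). Infinitesimal braided Lie algebra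 $(P,c_P,b_P)$ of a braided bialgebra $A$: $(P,c_P)$ is the infinitesimal part, and $b_P=(b_P^{[n]})$ is the bracket on $(P,c_P)$ constructed recursively as follows. $\psi^{[0]}:U_P^{[0]}=T(P,c_P)\to A$ is the algebra map extending the inclusion $P\subseteq A$ (it is a braided bialgebra map). Given the braided bialgebra map $\psi^{[n]}:U_P^{[n]}\to A$, $b_P^{[n]}:P(U_P^{[n]})\to P$ is the map induced by $\psi^{[n]}$ on primitive elements, and $\psi^{[n+1]}:U_P^{[n+1]}\to A$ is the unique map such that its composite with the projection $U_P^{[n]}\to U_P^{[n+1]}$ is $\psi^{[n]}$. (This is a well-defined bracket and $(P,c_P,b_P)$ is a braided Lie algebra.) *)

theory Defs
  imports "HOL-Algebra.Module" "HOL-Algebra.QuotRing"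
begin

text \<open>
  Vector spaces over a field \<open>K\<close> are modules \<open>V\<close> with \<^prop>\<open>module K V\<close>; where \<open>V\<close> is merely a
  vector space, the ring fields \<open>mult\<close> and \<open>one\<close> of the record are ignored (as is usual in HOL-Algebra).
  All predicates below depend only on the behaviour of the operations on the carriers.
\<close>

section \<open>Tensor algebra and tensor powers\<close>

text \<open>
  \<open>T(V)\<close> is the free unital algebra on the set \<open>carrier V\<close> modulo the two-sided ideal generated by
  \<open>[u + v] - [u] - [v]\<close> and \<open>[a v] - a [v]\<close>. Its part of degree \<open>n\<close>, i.e. the free vector space on
  the words of length \<open>n\<close> modulo multilinearity, is the \<open>n\<close>-th tensor power of \<open>V\<close>. Thus all
  tensor powers of \<open>V\<close> live in one type and form a strict monoidal system, with
  \<open>x \<otimes> y\<close> the product in \<open>T(V)\<close>; the powers \<open>0\<close> and \<open>1\<close> stand for \<open>K\<close> and \<open>V\<close>.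
\<close>

type_synonym ('k, 'v) tensor = "('v list \<Rightarrow> 'k) set"

definition free_algebra ::
  "'k ring \<Rightarrow> ('k, 'v, 'm) module_scheme \<Rightarrow> ('k, 'v list \<Rightarrow> 'k) module" where
  "free_algebra K V = \<lparr>
     carrier = {x. (\<forall>w. x w \<in> carrier K) \<and> finite {w. x w \<noteq> \<zero>\<^bsub>K\<^esub>} \<and>
                   (\<forall>w. x w \<noteq> \<zero>\<^bsub>K\<^esub> \<longrightarrow> set w \<subseteq> carrier V)},
     mult = (\<lambda>x y w. \<Oplus>\<^bsub>K\<^esub>i\<in>{..length w}. x (take i w) \<otimes>\<^bsub>K\<^esub> y (drop i w)),
     one = (\<lambda>w. if w = [] then \<one>\<^bsub>K\<^esub> else \<zero>\<^bsub>K\<^esub>),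
     zero = (\<lambda>w. \<zero>\<^bsub>K\<^esub>),
     add = (\<lambda>x y w. x w \<oplus>\<^bsub>K\<^esub> y w),
     smult = (\<lambda>a x w. a \<otimes>\<^bsub>K\<^esub> x w)\<rparr>"

definition word :: "'k ring \<Rightarrow> 'v list \<Rightarrow> 'v list \<Rightarrow> 'k" where
  "word K w = (\<lambda>w'. if w' = w then \<one>\<^bsub>K\<^esub> else \<zero>\<^bsub>K\<^esub>)"

definition linearity_relations ::
  "'k ring \<Rightarrow> ('k, 'v, 'm) module_scheme \<Rightarrow> ('v list \<Rightarrow> 'k) set" where
  "linearity_relations K V =
     (let F = free_algebra K V in
      {word K [u \<oplus>\<^bsub>V\<^esub> v] \<ominus>\<^bsub>F\<^esub> (word K [u] \<oplus>\<^bsub>F\<^esub> word K [v]) | u v. u \<in> carrier V \<and> v \<in> carrier V}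
      \<union> {word K [a \<odot>\<^bsub>V\<^esub> v] \<ominus>\<^bsub>F\<^esub> (a \<odot>\<^bsub>F\<^esub> word K [v]) | a v. a \<in> carrier K \<and> v \<in> carrier V})"

definition tensor_ideal ::
  "'k ring \<Rightarrow> ('k, 'v, 'm) module_scheme \<Rightarrow> ('v list \<Rightarrow> 'k) set" where
  "tensor_ideal K V = Idl\<^bsub>free_algebra K V\<^esub> (linearity_relations K V)"

definition tensor_algebra ::
  "'k ring \<Rightarrow> ('k, 'v, 'm) module_scheme \<Rightarrow> ('k, ('k, 'v) tensor) module" where
  "tensor_algebra K V =
     (let F = free_algebra K V; I = tensor_ideal K V in
      ring.extend (F Quot I)
        (module.fields (\<lambda>a X. \<Union>x\<in>X. I +>\<^bsub>F\<^esub> (a \<odot>\<^bsub>F\<^esub> x))))"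

definition pure_tensor ::
  "'k ring \<Rightarrow> ('k, 'v, 'm) module_scheme \<Rightarrow> 'v list \<Rightarrow> ('k, 'v) tensor" where
  "pure_tensor K V w = tensor_ideal K V +>\<^bsub>free_algebra K V\<^esub> word K w"

definition tensor_power ::
  "'k ring \<Rightarrow> ('k, 'v, 'm) module_scheme \<Rightarrow> nat \<Rightarrow> ('k, ('k, 'v) tensor) module" where
  "tensor_power K V n = (tensor_algebra K V)\<lparr>carrier :=
     {tensor_ideal K V +>\<^bsub>free_algebra K V\<^esub> x | x.
        x \<in> carrier (free_algebra K V) \<and> (\<forall>w. x w \<noteq> \<zero>\<^bsub>K\<^esub> \<longrightarrow> length w = n)}\<rparr>"

definition linear_map ::
  "'k ring \<Rightarrow> ('k, 'v, 'm) module_scheme \<Rightarrow> ('k, 'w, 'n) module_scheme \<Rightarrow> ('v \<Rightarrow> 'w) \<Rightarrow> bool" where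
  "linear_map K V W f \<longleftrightarrow> f \<in> carrier V \<rightarrow> carrier W \<and>
     (\<forall>x\<in>carrier V. \<forall>y\<in>carrier V. f (x \<oplus>\<^bsub>V\<^esub> y) = f x \<oplus>\<^bsub>W\<^esub> f y) \<and>
     (\<forall>a\<in>carrier K. \<forall>x\<in>carrier V. f (a \<odot>\<^bsub>V\<^esub> x) = a \<odot>\<^bsub>W\<^esub> f x)"

text \<open>
  The linear map on the \<open>n\<close>-th tensor power of \<open>V\<close> with value \<open>\<phi> w\<close> on the pure tensor of a word
  \<open>w\<close> of length \<open>n\<close>, where \<open>\<phi>\<close> is multilinear in the letters of such \<open>w\<close>. (A representative of an
  element of degree \<open>n\<close> may have terms of other degrees; these belong to the ideal and are dropped.)
  In all uses below, \<open>\<phi>\<close> is multilinear provided that the structure maps are linear.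
\<close>

definition lin_ext ::
  "'k ring \<Rightarrow> ('k, 'v, 'm) module_scheme \<Rightarrow> ('k, 'w, 'n) module_scheme \<Rightarrow> nat \<Rightarrow>
   ('v list \<Rightarrow> ('k, 'w) tensor) \<Rightarrow> ('k, 'v) tensor \<Rightarrow> ('k, 'w) tensor" where
  "lin_ext K V W n \<phi> X =
     (let x = (SOME x. x \<in> X) in
      \<Oplus>\<^bsub>tensor_algebra K W\<^esub>w\<in>{w. x w \<noteq> \<zero>\<^bsub>K\<^esub> \<and> length w = n}.
        x w \<odot>\<^bsub>tensor_algebra K W\<^esub> \<phi> w)"

text \<open>\<open>f \<otimes> g\<close> where \<open>f\<close> and \<open>g\<close> are defined on the \<open>j\<close>-th and \<open>k\<close>-th tensor power of \<open>V\<close>.\<close>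

definition tens ::
  "'k ring \<Rightarrow> ('k, 'v, 'm) module_scheme \<Rightarrow> ('k, 'w, 'n) module_scheme \<Rightarrow> nat \<Rightarrow> nat \<Rightarrow>
   (('k, 'v) tensor \<Rightarrow> ('k, 'w) tensor) \<Rightarrow> (('k, 'v) tensor \<Rightarrow> ('k, 'w) tensor) \<Rightarrow>
   ('k, 'v) tensor \<Rightarrow> ('k, 'w) tensor" where
  "tens K V W j k f g = lin_ext K V W (j + k)
     (\<lambda>w. f (pure_tensor K V (take j w)) \<otimes>\<^bsub>tensor_algebra K W\<^esub> g (pure_tensor K V (drop j w)))"

text \<open>\<open>f \<otimes> \<dots> \<otimes> f\<close> on the \<open>n\<close>-th tensor power of \<open>V\<close>, for linear \<open>f : V \<rightarrow> W\<close>.\<close>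

definition tens_map ::
  "'k ring \<Rightarrow> ('k, 'v, 'm) module_scheme \<Rightarrow> ('k, 'w, 'n) module_scheme \<Rightarrow> nat \<Rightarrow> ('v \<Rightarrow> 'w) \<Rightarrow>
   ('k, 'v) tensor \<Rightarrow> ('k, 'w) tensor" where
  "tens_map K V W n f = lin_ext K V W n (\<lambda>w. pure_tensor K W (map f w))"


section \<open>Braided vector spaces, algebras, coalgebras and bialgebras\<close>

record ('k, 'v) braided_space = "('k, 'v) module" +
  braiding :: "('k, 'v) tensor \<Rightarrow> ('k, 'v) tensor"

record ('k, 'v) braided_bialg = "('k, 'v) braided_space" +
  comult :: "'v \<Rightarrow> ('k, 'v) tensor"
  counit :: "'v \<Rightarrow> 'k"

definition braided_vector_space ::
  "'k ring \<Rightarrow> ('k, 'v, 'm) braided_space_scheme \<Rightarrow> bool" where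
  "braided_vector_space K V \<longleftrightarrow>
     (let c = braiding V; c1 = tens K V V 2 1 c id; c2 = tens K V V 1 2 id c in
      module K V \<and>
      linear_map K (tensor_power K V 2) (tensor_power K V 2) c \<and>
      (\<forall>t\<in>carrier (tensor_power K V 3). c1 (c2 (c1 t)) = c2 (c1 (c2 t))))"

definition braided_morphism ::
  "'k ring \<Rightarrow> ('k, 'v, 'm) braided_space_scheme \<Rightarrow> ('k, 'w, 'n) braided_space_scheme \<Rightarrow>
   ('v \<Rightarrow> 'w) \<Rightarrow> bool" where
  "braided_morphism K V W f \<longleftrightarrow>
     linear_map K V W f \<and>
     (\<forall>t\<in>carrier (tensor_power K V 2).
        braiding W (tens_map K V W 2 f t) = tens_map K V W 2 f (braiding V t))"

text \<open>HOL-Algebra's locale \<open>algebra\<close> is restricted to commutative algebras.\<close>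

definition unital_algebra :: "'k ring \<Rightarrow> ('k, 'a, 'm) module_scheme \<Rightarrow> bool" where
  "unital_algebra K A \<longleftrightarrow> module K A \<and> ring A \<and>
     (\<forall>a\<in>carrier K. \<forall>x\<in>carrier A. \<forall>y\<in>carrier A.
        (a \<odot>\<^bsub>A\<^esub> x) \<otimes>\<^bsub>A\<^esub> y = a \<odot>\<^bsub>A\<^esub> (x \<otimes>\<^bsub>A\<^esub> y) \<and>
        x \<otimes>\<^bsub>A\<^esub> (a \<odot>\<^bsub>A\<^esub> y) = a \<odot>\<^bsub>A\<^esub> (x \<otimes>\<^bsub>A\<^esub> y))"

definition algebra_map ::
  "'k ring \<Rightarrow> ('k, 'a, 'm) module_scheme \<Rightarrow> ('k, 'b, 'n) module_scheme \<Rightarrow> ('a \<Rightarrow> 'b) \<Rightarrow> bool" where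
  "algebra_map K A B f \<longleftrightarrow> linear_map K A B f \<and> f \<in> ring_hom A B"

definition base_algebra :: "'k ring \<Rightarrow> ('k, 'k) module" where
  "base_algebra K = ring.extend K (module.fields (\<otimes>\<^bsub>K\<^esub>))"

text \<open>
  The structure maps \<open>m, u, \<Delta>, \<epsilon>\<close> as maps between tensor powers: \<open>m\<close> from degree 2 to 1,
  \<open>u\<close> from 0 to 1, \<open>\<Delta>\<close> from 1 to 2, and \<open>\<epsilon>\<close> from 1 to 0.
\<close>

definition mult_map ::
  "'k ring \<Rightarrow> ('k, 'a, 'm) module_scheme \<Rightarrow> ('k, 'a) tensor \<Rightarrow> ('k, 'a) tensor" where
  "mult_map K A = lin_ext K A A 2 (\<lambda>w. pure_tensor K A [w ! 0 \<otimes>\<^bsub>A\<^esub> w ! 1])"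

definition unit_map ::
  "'k ring \<Rightarrow> ('k, 'a, 'm) module_scheme \<Rightarrow> ('k, 'a) tensor \<Rightarrow> ('k, 'a) tensor" where
  "unit_map K A = lin_ext K A A 0 (\<lambda>w. pure_tensor K A [\<one>\<^bsub>A\<^esub>])"

definition comult_map ::
  "'k ring \<Rightarrow> ('k, 'a, 'm) braided_bialg_scheme \<Rightarrow> ('k, 'a) tensor \<Rightarrow> ('k, 'a) tensor" where
  "comult_map K C = lin_ext K C C 1 (\<lambda>w. comult C (w ! 0))"

definition counit_map ::
  "'k ring \<Rightarrow> ('k, 'a, 'm) braided_bialg_scheme \<Rightarrow> ('k, 'a) tensor \<Rightarrow> ('k, 'a) tensor" where
  "counit_map K C =
     lin_ext K C C 1 (\<lambda>w. counit C (w ! 0) \<odot>\<^bsub>tensor_algebra K C\<^esub> pure_tensor K C [])"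

definition braided_algebra :: "'k ring \<Rightarrow> ('k, 'a, 'm) braided_space_scheme \<Rightarrow> bool" where
  "braided_algebra K A \<longleftrightarrow>
     (let c = braiding A; m = mult_map K A; u = unit_map K A; T = tens K A A in
      unital_algebra K A \<and> braided_vector_space K A \<and>
      (\<forall>t\<in>carrier (tensor_power K A 3).
         c (T 2 1 m id t) = T 1 2 id m (T 2 1 c id (T 1 2 id c t)) \<and>
         c (T 1 2 id m t) = T 2 1 m id (T 1 2 id c (T 2 1 c id t))) \<and>
      (\<forall>t\<in>carrier (tensor_power K A 1).
         c (T 0 1 u id t) = T 1 0 id u t \<and>
         c (T 1 0 id u t) = T 0 1 u id t))"

definition braided_coalgebra :: "'k ring \<Rightarrow> ('k, 'a, 'm) braided_bialg_scheme \<Rightarrow> bool" where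
  "braided_coalgebra K C \<longleftrightarrow>
     (let c = braiding C; D = comult_map K C; e = counit_map K C; T = tens K C C in
      braided_vector_space K C \<and>
      linear_map K C (tensor_power K C 2) (comult C) \<and>
      linear_map K C (base_algebra K) (counit C) \<and>
      (\<forall>t\<in>carrier (tensor_power K C 1).
         T 1 1 D id (D t) = T 1 1 id D (D t) \<and>
         T 1 1 e id (D t) = t \<and> T 1 1 id e (D t) = t) \<and>
      (\<forall>t\<in>carrier (tensor_power K C 2).
         T 1 1 D id (c t) = T 1 2 id c (T 2 1 c id (T 1 1 id D t)) \<and>
         T 1 1 id D (c t) = T 2 1 c id (T 1 2 id c (T 1 1 D id t)) \<and>
         T 1 1 e id (c t) = T 1 1 id e t \<and>
         T 1 1 id e (c t) = T 1 1 e id t))"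

definition braided_bialgebra :: "'k ring \<Rightarrow> ('k, 'a, 'm) braided_bialg_scheme \<Rightarrow> bool" where
  "braided_bialgebra K B \<longleftrightarrow>
     (let c = braiding B; m = mult_map K B; D = comult_map K B; T = tens K B B in
      braided_algebra K B \<and> braided_coalgebra K B \<and>
      (\<forall>t\<in>carrier (tensor_power K B 2).
         D (m t) = T 2 2 m m (T 1 3 id (T 2 1 c id) (T 1 1 D D t))) \<and>
      comult B \<one>\<^bsub>B\<^esub> = pure_tensor K B [\<one>\<^bsub>B\<^esub>, \<one>\<^bsub>B\<^esub>] \<and>
      algebra_map K B (base_algebra K) (counit B))"

definition braided_bialgebra_map ::
  "'k ring \<Rightarrow> ('k, 'a, 'm) braided_bialg_scheme \<Rightarrow> ('k, 'b, 'n) braided_bialg_scheme \<Rightarrow>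
   ('a \<Rightarrow> 'b) \<Rightarrow> bool" where
  "braided_bialgebra_map K A B f \<longleftrightarrow>
     algebra_map K A B f \<and> braided_morphism K A B f \<and>
     (\<forall>x\<in>carrier A. comult B (f x) = tens_map K A B 2 f (comult A x) \<and> counit B (f x) = counit A x)"


section \<open>The infinitesimal part\<close>

definition primitives :: "'k ring \<Rightarrow> ('k, 'a, 'm) braided_bialg_scheme \<Rightarrow> 'a set" where
  "primitives K B = {x \<in> carrier B.
     comult B x = pure_tensor K B [x, \<one>\<^bsub>B\<^esub>] \<oplus>\<^bsub>tensor_algebra K B\<^esub> pure_tensor K B [\<one>\<^bsub>B\<^esub>, x]}"

definition primitive_module ::
  "'k ring \<Rightarrow> ('k, 'a, 'm) braided_bialg_scheme \<Rightarrow> ('k, 'a) module" where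
  "primitive_module K B = module.truncate (B\<lparr>carrier := primitives K B\<rparr>)"

text \<open>
  The tensor square of \<open>P(B)\<close> is not literally a subset of that of \<open>B\<close>; the restricted braiding is
  obtained by pulling back along the injection induced by the inclusion.
\<close>

definition infinitesimal_part ::
  "'k ring \<Rightarrow> ('k, 'a, 'm) braided_bialg_scheme \<Rightarrow> ('k, 'a) braided_space" where
  "infinitesimal_part K B =
     (let P = primitive_module K B; j = tens_map K P B 2 (\<lambda>x. x) in
      module.extend P (braided_space.fields
        (\<lambda>t. inv_into (carrier (tensor_power K P 2)) j (braiding B (j t)))))"


section \<open>The braided tensor algebra\<close>

text \<open>\<open>A \<otimes>\<^sub>c A\<close>\<close>

definition braided_square ::
  "'k ring \<Rightarrow> ('k, 'a, 'm) braided_space_scheme \<Rightarrow> ('k, ('k, 'a) tensor) module" where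
  "braided_square K A =
     (let m = mult_map K A; T = tens K A A in
      (tensor_power K A 2)\<lparr>
        mult := (\<lambda>s t. T 2 2 m m (T 1 3 id (T 2 1 (braiding A) id) (s \<otimes>\<^bsub>tensor_algebra K A\<^esub> t))),
        one := pure_tensor K A [\<one>\<^bsub>A\<^esub>, \<one>\<^bsub>A\<^esub>]\<rparr>)"

definition braided_tensor_algebra ::
  "'k ring \<Rightarrow> ('k, 'v, 'm) braided_space_scheme \<Rightarrow> ('k, ('k, 'v) tensor) braided_bialg \<Rightarrow> bool" where
  "braided_tensor_algebra K V T \<longleftrightarrow>
     module.truncate T = tensor_algebra K V \<and>
     braided_algebra K T \<and>
     braided_morphism K V T (\<lambda>v. pure_tensor K V [v]) \<and>
     algebra_map K T (braided_square K T) (comult T) \<and>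
     algebra_map K T (base_algebra K) (counit T) \<and>
     (\<forall>v\<in>carrier V.
        comult T (pure_tensor K V [v]) =
          pure_tensor K T [pure_tensor K V [v], \<one>\<^bsub>T\<^esub>] \<oplus>\<^bsub>tensor_algebra K T\<^esub>
          pure_tensor K T [\<one>\<^bsub>T\<^esub>, pure_tensor K V [v]] \<and>
        counit T (pure_tensor K V [v]) = \<zero>\<^bsub>K\<^esub>)"


section \<open>Quotients and direct limits of braided bialgebras\<close>

text \<open>
  In the iterated quotients below, the elements of \<open>B\<close> are themselves pairwise disjoint nonempty
  sets. A coset, being a set of such elements, is represented by the union of its members, so that
  all the quotients live in one type.
\<close>

definition quotient_proj :: "('k, 'x set, 'm) module_scheme \<Rightarrow> 'x set set \<Rightarrow> 'x set \<Rightarrow> 'x set" where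
  "quotient_proj B J x = \<Union>(J +>\<^bsub>B\<^esub> x)"

text \<open>As the projection is onto, the structure of \<open>Q\<close> is determined by that of \<open>B\<close>.\<close>

definition quotient_bialgebra ::
  "'k ring \<Rightarrow> ('k, 'x set) braided_bialg \<Rightarrow> 'x set set \<Rightarrow> ('k, 'x set) braided_bialg \<Rightarrow> bool" where
  "quotient_bialgebra K B J Q \<longleftrightarrow>
     carrier Q = quotient_proj B J ` carrier B \<and>
     braided_bialgebra K Q \<and>
     braided_bialgebra_map K B Q (quotient_proj B J)"

text \<open>
  The direct limit of \<open>X 0 \<rightarrow> X 1 \<rightarrow> \<dots>\<close> with transition maps \<open>p n : X n \<rightarrow> X (n + 1)\<close>: the disjoint
  union modulo eventual equality.
\<close>

primrec transition :: "(nat \<Rightarrow> 'a \<Rightarrow> 'a) \<Rightarrow> nat \<Rightarrow> nat \<Rightarrow> 'a \<Rightarrow> 'a" where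
  "transition p n 0 x = x"
| "transition p n (Suc d) x = p (n + d) (transition p n d x)"

definition limit_class ::
  "(nat \<Rightarrow> ('k, 'a) braided_bialg) \<Rightarrow> (nat \<Rightarrow> 'a \<Rightarrow> 'a) \<Rightarrow> nat \<Rightarrow> 'a \<Rightarrow> (nat \<times> 'a) set" where
  "limit_class X p n x = {(m, y). y \<in> carrier (X m) \<and>
     (\<exists>d e. n + d = m + e \<and> transition p n d x = transition p m e y)}"

definition direct_limit ::
  "'k ring \<Rightarrow> (nat \<Rightarrow> ('k, 'a) braided_bialg) \<Rightarrow> (nat \<Rightarrow> 'a \<Rightarrow> 'a) \<Rightarrow>
   ('k, (nat \<times> 'a) set) braided_bialg \<Rightarrow> bool" where
  "direct_limit K X p L \<longleftrightarrow>
     carrier L = (\<Union>n. limit_class X p n ` carrier (X n)) \<and>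
     braided_bialgebra K L \<and>
     (\<forall>n. braided_bialgebra_map K (X n) L (limit_class X p n))"


section \<open>Brackets\<close>

text \<open>
  A bracket consists of the maps \<open>b\<^sup>[\<^sup>n\<^sup>]\<close> together with the braided bialgebras \<open>U\<^sup>[\<^sup>n\<^sup>]\<close> and the maps
  \<open>i\<^sup>[\<^sup>n\<^sup>]\<close>. The latter two are determined by the former (on the carriers).
\<close>

record ('k, 'v) bracket =
  brk :: "nat \<Rightarrow> ('k, 'v) tensor \<Rightarrow> 'v"
  stage :: "nat \<Rightarrow> ('k, ('k, 'v) tensor) braided_bialg"
  incl :: "nat \<Rightarrow> 'v \<Rightarrow> ('k, 'v) tensor"

definition stage_ideal :: "'k ring \<Rightarrow> ('k, 'v) bracket \<Rightarrow> nat \<Rightarrow> ('k, 'v) tensor set" where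
  "stage_ideal K b n =
     (let U = stage b n in
      Idl\<^bsub>U\<^esub> ((\<lambda>x. x \<ominus>\<^bsub>U\<^esub> incl b n (brk b n x)) ` primitives K U))"

definition stage_proj ::
  "'k ring \<Rightarrow> ('k, 'v) bracket \<Rightarrow> nat \<Rightarrow> ('k, 'v) tensor \<Rightarrow> ('k, 'v) tensor" where
  "stage_proj K b n = quotient_proj (stage b n) (stage_ideal K b n)"

text \<open>
  The compatibility of \<open>f = i\<^sup>[\<^sup>n\<^sup>] b\<^sup>[\<^sup>n\<^sup>]\<close> with the braiding is required on the subspaces
  \<open>P\<^sup>[\<^sup>n\<^sup>] \<otimes> V\<^sup>[\<^sup>n\<^sup>]\<close> and \<open>V\<^sup>[\<^sup>n\<^sup>] \<otimes> P\<^sup>[\<^sup>n\<^sup>]\<close> of \<open>P\<^sup>[\<^sup>n\<^sup>] \<otimes> P\<^sup>[\<^sup>n\<^sup>]\<close>, which are spanned by the tensors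
  \<open>p \<otimes> i\<^sup>[\<^sup>n\<^sup>](v)\<close> and \<open>i\<^sup>[\<^sup>n\<^sup>](v) \<otimes> p\<close>.
\<close>

definition bracket_compatible ::
  "'k ring \<Rightarrow> ('k, 'v, 'm) braided_space_scheme \<Rightarrow> ('k, 'v) bracket \<Rightarrow> nat \<Rightarrow> bool" where
  "bracket_compatible K V b n \<longleftrightarrow>
     (let P = infinitesimal_part K (stage b n); c = braiding P; i = incl b n;
          f = (\<lambda>x. i (brk b n x)); F = tens_map K P P 1 f in
      \<forall>p\<in>carrier P. \<forall>v\<in>carrier V.
        c (tens K P P 1 1 F id (pure_tensor K P [p, i v])) =
          tens K P P 1 1 id F (c (pure_tensor K P [p, i v])) \<and>
        c (tens K P P 1 1 id F (pure_tensor K P [i v, p])) =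
          tens K P P 1 1 F id (c (pure_tensor K P [i v, p])))"

definition is_bracket ::
  "'k ring \<Rightarrow> ('k, 'v, 'm) braided_space_scheme \<Rightarrow> ('k, 'v) bracket \<Rightarrow> bool" where
  "is_bracket K V b \<longleftrightarrow>
     braided_tensor_algebra K V (stage b 0) \<and>
     (\<forall>v\<in>carrier V. incl b 0 v = pure_tensor K V [v]) \<and>
     (\<forall>n. braided_bialgebra K (stage b n) \<and>
          braided_morphism K V (infinitesimal_part K (stage b n)) (incl b n) \<and>
          linear_map K (infinitesimal_part K (stage b n)) V (brk b n) \<and>
          bracket_compatible K V b n \<and>
          quotient_bialgebra K (stage b n) (stage_ideal K b n) (stage b (Suc n)) \<and>
          (\<forall>v\<in>carrier V. incl b (Suc n) v = stage_proj K b n (incl b n v)))"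

text \<open>\<open>U(V, c, b)\<close> and \<open>i\<^sub>U\<close>\<close>

definition is_universal_enveloping ::
  "'k ring \<Rightarrow> ('k, 'v) bracket \<Rightarrow> ('k, (nat \<times> ('k, 'v) tensor) set) braided_bialg \<Rightarrow> bool" where
  "is_universal_enveloping K b U \<longleftrightarrow> direct_limit K (stage b) (stage_proj K b) U"

definition canonical_map ::
  "'k ring \<Rightarrow> ('k, 'v) bracket \<Rightarrow> 'v \<Rightarrow> (nat \<times> ('k, 'v) tensor) set" where
  "canonical_map K b v = limit_class (stage b) (stage_proj K b) 0 (incl b 0 v)"

definition bracket_morphism ::
  "'k ring \<Rightarrow> ('k, 'v, 'm) braided_space_scheme \<Rightarrow> ('k, 'v) bracket \<Rightarrow>
   ('k, 'w, 'n) braided_space_scheme \<Rightarrow> ('k, 'w) bracket \<Rightarrow> ('v \<Rightarrow> 'w) \<Rightarrow> bool" where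
  "bracket_morphism K V b W b' h \<longleftrightarrow>
     braided_morphism K V W h \<and>
     (\<exists>Uh. braided_bialgebra_map K (stage b 0) (stage b' 0) (Uh 0) \<and>
        (\<forall>v\<in>carrier V. Uh 0 (pure_tensor K V [v]) = pure_tensor K W [h v]) \<and>
        (\<forall>n. (\<forall>x\<in>primitives K (stage b n). h (brk b n x) = brk b' n (Uh n x)) \<and>
             (\<forall>x\<in>carrier (stage b n).
                Uh (Suc n) (stage_proj K b n x) = stage_proj K b' n (Uh n x))))"

definition is_infinitesimal_bracket ::
  "'k ring \<Rightarrow> ('k, 'a, 'm) braided_bialg_scheme \<Rightarrow> ('k, 'a) bracket \<Rightarrow> bool" where
  "is_infinitesimal_bracket K A b \<longleftrightarrow>
     (let P = infinitesimal_part K A in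
      is_bracket K P b \<and>
      (\<exists>\<psi>. algebra_map K (stage b 0) A (\<psi> 0) \<and>
         (\<forall>x\<in>carrier P. \<psi> 0 (pure_tensor K P [x]) = x) \<and>
         (\<forall>n. (\<forall>x\<in>primitives K (stage b n). brk b n x = \<psi> n x) \<and>
              (\<forall>x\<in>carrier (stage b n). \<psi> (Suc n) (stage_proj K b n x) = \<psi> n x))))"

end

theory Submission
  imports Defs
begin

text \<open>
  Composing the maps \<open>\<psi>\<^sup>[\<^sup>n\<^sup>]\<close> of the infinitesimal bracket of \<open>A\<close> with the maps induced by \<open>h\<close> gives
  a compatible family of maps from the stages of \<open>U(V, c, b)\<close> to \<open>A\<close>. Since the projections between
  the stages and the maps to the direct limit are jointly surjective morphisms of braided
  bialgebras, it suffices that \<open>\<psi>\<^sup>[\<^sup>0\<^sup>] : T(P, c\<^sub>P) \<rightarrow> A\<close> is one. An algebra map between braided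
  bialgebras is a morphism as soon as it is compatible with the structure on generators, provided
  that the braiding keeps the span of the generators on the correct side of the tensor product. On
  the generators \<open>P = P(A)\<close> this amounts to \<open>c(P \<otimes> P) \<subseteq> P \<otimes> P\<close>, which follows from the
  compatibility of \<open>c\<close> with \<open>\<Delta>\<close>: the map \<open>x \<mapsto> \<Delta>(x) - x \<otimes> 1 - 1 \<otimes> x\<close> with kernel \<open>P\<close> vanishes on
  the relevant tensor factor of \<open>c(P \<otimes> A)\<close> and of \<open>c(A \<otimes> P)\<close>, and over a field it has a generalised
  inverse.
\<close>

section \<open>The tensor algebra of a vector space\<close>

text \<open>Two features of the definitions decide where the work lies. \<open>lin_ext\<close>
  evaluates a map at an arbitrary representative of a class modulo an ideal that is given only by
  generators, so before anything can be computed, multilinear maps must be shown to vanish on that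
  ideal. And the braiding of \<open>infinitesimal_part\<close> is an \<open>inv_into\<close> along
  the map from P \<otimes> P to A \<otimes> A; it means something only once c(P \<otimes> P) is
  known to lie in the image of that map, which is why a linear projection of A onto P is
  constructed. The compatibility statements for T(P) then share one pattern: the elements that
  satisfy the statement form a subspace that contains 1 and is closed under left multiplication by
  generators. The braiding needs two rounds of this, one per argument, and they are not symmetric.
  The axiom for c(x \<otimes> yy') braids x past y first, and what comes out on the right must again
  be a generator; once the second argument is arbitrary, the round for the first argument meets no
  such condition.\<close>

locale linear_space = module K V for K :: "'k ring" and V :: "('k, 'v, 'm) module_scheme"
begin

abbreviation "F \<equiv> free_algebra K V"
abbreviation "J \<equiv> tensor_ideal K V"
abbreviation "T \<equiv> tensor_algebra K V"
abbreviation "tp \<equiv> tensor_power K V"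
abbreviation "pt \<equiv> pure_tensor K V"
abbreviation "cl x \<equiv> tensor_ideal K V +>\<^bsub>free_algebra K V\<^esub> x"
abbreviation "W \<equiv> lists (carrier V)"

lemma free_algebra_sel [simp]:
  "mult F x y = (\<lambda>w. \<Oplus>\<^bsub>K\<^esub>i\<in>{..length w}. x (take i w) \<otimes>\<^bsub>K\<^esub> y (drop i w))"
  "one F = word K []"
  "zero F = (\<lambda>w. \<zero>\<^bsub>K\<^esub>)"
  "add F x y = (\<lambda>w. x w \<oplus>\<^bsub>K\<^esub> y w)"
  "smult F a x = (\<lambda>w. a \<otimes>\<^bsub>K\<^esub> x w)"
  by (auto simp: free_algebra_def word_def)

lemma carrier_F_iff: "x \<in> carrier F \<longleftrightarrow> (\<forall>w. x w \<in> carrier K) \<and> finite {w. x w \<noteq> \<zero>\<^bsub>K\<^esub>} \<and>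
                   {w. x w \<noteq> \<zero>\<^bsub>K\<^esub>} \<subseteq> W"
  by (auto simp: free_algebra_def)

lemma F_coeff [simp]: "x \<in> carrier F \<Longrightarrow> x w \<in> carrier K"
  by (simp add: carrier_F_iff)

lemma F_add: assumes "x \<in> carrier F" "y \<in> carrier F" shows "add F x y \<in> carrier F"
proof -
  have "{w. x w \<oplus>\<^bsub>K\<^esub> y w \<noteq> \<zero>\<^bsub>K\<^esub>} \<subseteq> {w. x w \<noteq> \<zero>\<^bsub>K\<^esub>} \<union> {w. y w \<noteq> \<zero>\<^bsub>K\<^esub>}"
    using assms by auto
  then show ?thesis using assms unfolding carrier_F_iff free_algebra_sel by (blast intro: finite_subset finite_UnI R.add.m_closed)
qed

lemma F_smult: assumes "a \<in> carrier K" "x \<in> carrier F" shows "smult F a x \<in> carrier F"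
proof -
  have "{w. a \<otimes>\<^bsub>K\<^esub> x w \<noteq> \<zero>\<^bsub>K\<^esub>} \<subseteq> {w. x w \<noteq> \<zero>\<^bsub>K\<^esub>}"
    using assms by auto
  then show ?thesis using assms unfolding carrier_F_iff free_algebra_sel by (blast intro: finite_subset R.m_closed)
qed

lemma F_zero: "zero F \<in> carrier F" by (simp add: carrier_F_iff)

lemma F_word [simp]: "w \<in> W \<Longrightarrow> word K w \<in> carrier F"
  by (auto simp: carrier_F_iff word_def)

lemma F_abelian: "abelian_group F"
proof (rule abelian_groupI)
  fix x assume x: "x \<in> carrier F"
  have "add F (smult F (\<ominus>\<^bsub>K\<^esub> \<one>\<^bsub>K\<^esub>) x) x = zero F"
    using x by (auto simp: R.l_minus R.l_neg)
  then show "\<exists>y\<in>carrier F. y \<oplus>\<^bsub>F\<^esub> x = \<zero>\<^bsub>F\<^esub>"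
    using x by (intro bexI[of _ "smult F (\<ominus>\<^bsub>K\<^esub> \<one>\<^bsub>K\<^esub>) x"] F_smult) auto
qed (use F_add F_zero in \<open>auto simp: R.add.m_ac fun_eq_iff\<close>)

lemma F_module: "module K F"
  by (rule moduleI) (use F_abelian F_smult in \<open>auto simp: R.l_distr R.r_distr R.m_assoc intro: R.is_cring\<close>)

text \<open>By induction over a finite set that contains the support, so that the induction
  hypothesis covers every element supported in the smaller set.\<close>

lemma F_induct [consumes 1, case_names zero add word]:
  assumes x: "x \<in> carrier F"
    and Z: "P (zero F)"
    and A: "\<And>x y. x \<in> carrier F \<Longrightarrow> y \<in> carrier F \<Longrightarrow> P x \<Longrightarrow> P y \<Longrightarrow> P (add F x y)"
    and Wd: "\<And>a w. a \<in> carrier K \<Longrightarrow> w \<in> W \<Longrightarrow> P (smult F a (word K w))"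
  shows "P x"
proof -
  have "\<forall>x\<in>carrier F. {w. x w \<noteq> \<zero>\<^bsub>K\<^esub>} \<subseteq> S \<longrightarrow> P x" if "finite S" for S
    using that
  proof (induction S)
    case empty
    have "x = zero F" if "{w. x w \<noteq> \<zero>\<^bsub>K\<^esub>} \<subseteq> {}" for x using that by (auto simp: fun_eq_iff)
    with Z show ?case by blast
  next
    case (insert v S)
    show ?case
    proof (intro ballI impI)
      fix x assume x: "x \<in> carrier F" and s: "{w. x w \<noteq> \<zero>\<^bsub>K\<^esub>} \<subseteq> insert v S"
      show "P x"
      proof (cases "x v = \<zero>\<^bsub>K\<^esub>")
        case True then show ?thesis using s insert.IH x by blast
      next
        case False
        then have v: "v \<in> W" using x by (auto simp: carrier_F_iff)
        \<comment> \<open>Deleting the term at \<open>v\<close> leaves an element supported in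
          \<open>S\<close>; the deleted term is a scaled word, which \<open>Wd\<close>
          covers.\<close>
        let ?y = "\<lambda>w. if w = v then \<zero>\<^bsub>K\<^esub> else x w"
        have y: "?y \<in> carrier F"
          using x by (auto simp: carrier_F_iff intro: finite_subset[of _ "{w. x w \<noteq> \<zero>\<^bsub>K\<^esub>}"])
        have "{w. ?y w \<noteq> \<zero>\<^bsub>K\<^esub>} \<subseteq> S" using s by auto
        then have "P ?y" by (rule insert.IH[rule_format, OF y])
        then have "P (add F (smult F (x v) (word K v)) ?y)"
          by (intro A Wd F_smult y v F_word F_coeff x)
        moreover have "add F (smult F (x v) (word K v)) ?y = x"
          using x by (auto simp: fun_eq_iff word_def)
        ultimately show ?thesis by (rule subst[where P = P, rotated])
      qed
    qed
  qed
  then show ?thesis using x by (auto simp: carrier_F_iff)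
qed

text \<open>The convolution runs over all ways to cut \<open>w\<close>; only the cut after
  \<open>length u\<close> letters can give a nonzero term.\<close>

lemma word_mult: "mult F (word K u) (word K v) = word K (u @ v)"
proof
  fix w
  have eq: "word K u (take i w) \<otimes>\<^bsub>K\<^esub> word K v (drop i w) =
    (if length u = i then (if w = u @ v then \<one>\<^bsub>K\<^esub> else \<zero>\<^bsub>K\<^esub>) else \<zero>\<^bsub>K\<^esub>)" if "i \<le> length w" for i
    using that by (auto simp: word_def)
  show "mult F (word K u) (word K v) w = word K (u @ v) w"
  proof (cases "length u \<le> length w")
    case True
    have "mult F (word K u) (word K v) w =
      (\<Oplus>\<^bsub>K\<^esub>i\<in>{..length w}. if length u = i then (if w = u @ v then \<one>\<^bsub>K\<^esub> else \<zero>\<^bsub>K\<^esub>) else \<zero>\<^bsub>K\<^esub>)"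
      unfolding free_algebra_sel by (rule R.finsum_cong') (auto simp: eq)
    also have "\<dots> = (if w = u @ v then \<one>\<^bsub>K\<^esub> else \<zero>\<^bsub>K\<^esub>)"
      by (rule R.finsum_singleton) (use True in auto)
    finally show ?thesis by (simp add: word_def)
  next
    case False
    have "mult F (word K u) (word K v) w = (\<Oplus>\<^bsub>K\<^esub>i\<in>{..length w}. \<zero>\<^bsub>K\<^esub>)"
      unfolding free_algebra_sel by (rule R.finsum_cong') (use False in \<open>auto simp: eq\<close>)
    also have "\<dots> = \<zero>\<^bsub>K\<^esub>" by simp
    finally show ?thesis using False by (auto simp: word_def)
  qed
qed

text \<open>The content is finiteness of the support: a nonzero coefficient of the product at
  \<open>w\<close> comes from some cut of \<open>w\<close> into one word of each support.\<close>

lemma F_mult: assumes "x \<in> carrier F" "y \<in> carrier F" shows "mult F x y \<in> carrier F"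
proof -
  let ?S = "\<lambda>x. {w. x w \<noteq> \<zero>\<^bsub>K\<^esub>}"
  have "?S (mult F x y) \<subseteq> (\<lambda>(u, v). u @ v) ` (?S x \<times> ?S y)"
  proof
    fix w assume "w \<in> ?S (mult F x y)"
    then have "mult F x y w \<noteq> \<zero>\<^bsub>K\<^esub>" by blast
    then have "\<exists>i. x (take i w) \<otimes>\<^bsub>K\<^esub> y (drop i w) \<noteq> \<zero>\<^bsub>K\<^esub>"
      by (metis (no_types, lifting) free_algebra_sel(1) R.add.finprod_one_eqI)
    then obtain i where "x (take i w) \<noteq> \<zero>\<^bsub>K\<^esub>" "y (drop i w) \<noteq> \<zero>\<^bsub>K\<^esub>"
      using assms by (metis F_coeff R.l_null R.r_null)
    then show "w \<in> (\<lambda>(u, v). u @ v) ` (?S x \<times> ?S y)"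
      by (intro image_eqI[of _ _ "(take i w, drop i w)"]) auto
  qed
  moreover have "(\<lambda>(u, v). u @ v) ` (?S x \<times> ?S y) \<subseteq> W" using assms by (fastforce simp: carrier_F_iff)
  moreover have "finite ((\<lambda>(u, v). u @ v) ` (?S x \<times> ?S y))" using assms by (auto simp: carrier_F_iff)
  moreover have "mult F x y w \<in> carrier K" for w using assms by (auto intro!: R.finsum_closed)
  ultimately show ?thesis unfolding carrier_F_iff by (meson finite_subset order_trans)
qed

lemma F_ldistr: assumes "x \<in> carrier F" "y \<in> carrier F" "z \<in> carrier F"
  shows "mult F (add F x y) z = add F (mult F x z) (mult F y z)"
  using assms by (simp add: R.l_distr R.finsum_addf Pi_def)

lemma F_rdistr: assumes "x \<in> carrier F" "y \<in> carrier F" "z \<in> carrier F"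
  shows "mult F z (add F x y) = add F (mult F z x) (mult F z y)"
  using assms by (simp add: R.r_distr R.finsum_addf Pi_def)

lemma F_smult_l: assumes "x \<in> carrier F" "y \<in> carrier F" "a \<in> carrier K"
  shows "mult F (smult F a x) y = smult F a (mult F x y)"
  using assms by (simp add: R.finsum_rdistr Pi_def R.m_assoc)

lemma F_smult_r: assumes "x \<in> carrier F" "y \<in> carrier F" "a \<in> carrier K"
  shows "mult F x (smult F a y) = smult F a (mult F x y)"
  using assms by (simp add: R.finsum_rdistr Pi_def R.m_lcomm)

text \<open>Associativity is never computed for convolution sums. On words it is associativity of
  append, and three inductions free one argument at a time, starting with the last.\<close>

lemma F_ring: "ring F"
proof -
  interpret FM: module K F by (rule F_module)
  have zl: "mult F (zero F) x = zero F" if "x \<in> carrier F" for x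
    using that by simp
  have zr: "mult F x (zero F) = zero F" if "x \<in> carrier F" for x
    using that by simp
  note [simp del] = free_algebra_sel
  note [simp] = F_mult F_add F_smult F_zero F_ldistr F_rdistr F_smult_l F_smult_r zl zr F_word word_mult
  have 1: "mult F (mult F (word K u) (word K v)) z = mult F (word K u) (mult F (word K v) z)"
    if "u \<in> W" "v \<in> W" "z \<in> carrier F" for u v z
    using that(3) by (induction rule: F_induct) (use that in auto)
  have 2: "mult F (mult F (word K u) y) z = mult F (word K u) (mult F y z)"
    if "u \<in> W" "y \<in> carrier F" "z \<in> carrier F" for u y z
    using that(2) by (induction rule: F_induct) (use that 1 in auto)
  have 3: "mult F (mult F x y) z = mult F x (mult F y z)"
    if "x \<in> carrier F" "y \<in> carrier F" "z \<in> carrier F" for x y z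
    using that(1) by (induction rule: F_induct) (use that 2 in auto)
  have 4: "mult F (one F) x = x" "mult F x (one F) = x" if "x \<in> carrier F" for x
    using that by (induction rule: F_induct) (auto simp: free_algebra_sel(2))
  have "one F \<in> carrier F" by (simp add: free_algebra_sel(2))
  then show ?thesis
    by (intro ringI F_abelian monoidI) (simp_all add: 3 4)
qed

end

section \<open>Basic facts on linear maps\<close>

lemma linear_mapD:
  assumes "linear_map K V W f"
  shows "x \<in> carrier V \<Longrightarrow> f x \<in> carrier W"
    and "x \<in> carrier V \<Longrightarrow> y \<in> carrier V \<Longrightarrow> f (x \<oplus>\<^bsub>V\<^esub> y) = f x \<oplus>\<^bsub>W\<^esub> f y"
    and "a \<in> carrier K \<Longrightarrow> x \<in> carrier V \<Longrightarrow> f (a \<odot>\<^bsub>V\<^esub> x) = a \<odot>\<^bsub>W\<^esub> f x"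
  using assms unfolding linear_map_def by auto

lemma linear_mapI:
  assumes "\<And>x. x \<in> carrier V \<Longrightarrow> f x \<in> carrier W"
    and "\<And>x y. x \<in> carrier V \<Longrightarrow> y \<in> carrier V \<Longrightarrow> f (x \<oplus>\<^bsub>V\<^esub> y) = f x \<oplus>\<^bsub>W\<^esub> f y"
    and "\<And>a x. a \<in> carrier K \<Longrightarrow> x \<in> carrier V \<Longrightarrow> f (a \<odot>\<^bsub>V\<^esub> x) = a \<odot>\<^bsub>W\<^esub> f x"
  shows "linear_map K V W f"
  using assms unfolding linear_map_def by auto

lemma linear_map_zero:
  assumes "module K V" "module K W" "linear_map K V W f" shows "f \<zero>\<^bsub>V\<^esub> = \<zero>\<^bsub>W\<^esub>"
proof -
  interpret V: module K V by fact
  interpret W: module K W by fact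
  have "f (\<zero>\<^bsub>K\<^esub> \<odot>\<^bsub>V\<^esub> \<zero>\<^bsub>V\<^esub>) = \<zero>\<^bsub>K\<^esub> \<odot>\<^bsub>W\<^esub> f \<zero>\<^bsub>V\<^esub>"
    by (rule linear_mapD[OF assms(3)]) auto
  then show ?thesis using linear_mapD(1)[OF assms(3)] by simp
qed

lemma (in module) uminus_smult: assumes "x \<in> carrier M" shows "\<ominus>\<^bsub>M\<^esub> x = (\<ominus> \<one>) \<odot>\<^bsub>M\<^esub> x"
  using assms by (metis R.add.inv_closed R.l_minus R.l_one R.one_closed smult_l_minus smult_one)

lemma linear_map_minus:
  assumes "module K V" "module K W" "linear_map K V W f" "x \<in> carrier V" "y \<in> carrier V"
  shows "f (x \<ominus>\<^bsub>V\<^esub> y) = f x \<ominus>\<^bsub>W\<^esub> f y"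
proof -
  interpret V: module K V by fact
  interpret W: module K W by fact
  show ?thesis using assms(4,5) linear_mapD[OF assms(3)]
    by (simp add: a_minus_def V.uminus_smult W.uminus_smult)
qed

section \<open>Multilinear maps and the universal property of the tensor algebra\<close>

context linear_space
begin

text \<open>The linear extension of \<open>\<phi>\<close> from words to the free algebra, with
  values in any module. It is not yet a map on the tensor algebra.\<close>

definition linsum :: "('k, 'w, 'n) module_scheme \<Rightarrow> ('v list \<Rightarrow> 'w) \<Rightarrow> ('v list \<Rightarrow> 'k) \<Rightarrow> 'w" where
  "linsum M \<phi> x = (\<Oplus>\<^bsub>M\<^esub>w\<in>{w. x w \<noteq> \<zero>\<^bsub>K\<^esub>}. x w \<odot>\<^bsub>M\<^esub> \<phi> w)"

text \<open>Multilinearity in words of every length at once, as a map on the whole tensor algebra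
  requires. The version for a single degree is \<open>multilin\<close>.\<close>

definition multilinear :: "('k, 'w, 'n) module_scheme \<Rightarrow> ('v list \<Rightarrow> 'w) \<Rightarrow> bool" where
  "multilinear M \<phi> \<longleftrightarrow> \<phi> \<in> W \<rightarrow> carrier M \<and>
     (\<forall>u\<in>W. \<forall>v\<in>W. \<forall>a\<in>carrier V.
       (\<forall>b\<in>carrier V. \<phi> (u @ (a \<oplus>\<^bsub>V\<^esub> b) # v) = \<phi> (u @ a # v) \<oplus>\<^bsub>M\<^esub> \<phi> (u @ b # v)) \<and>
       (\<forall>k\<in>carrier K. \<phi> (u @ (k \<odot>\<^bsub>V\<^esub> a) # v) = k \<odot>\<^bsub>M\<^esub> \<phi> (u @ a # v)))"

text \<open>Two linear extensions can be added termwise only after both sums run over a common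
  finite set of words.\<close>

lemma linsum_superset:
  assumes "module K M" "\<phi> \<in> W \<rightarrow> carrier M" "x \<in> carrier F" "finite S" "{w. x w \<noteq> \<zero>\<^bsub>K\<^esub>} \<subseteq> S" "S \<subseteq> W"
  shows "linsum M \<phi> x = (\<Oplus>\<^bsub>M\<^esub>w\<in>S. x w \<odot>\<^bsub>M\<^esub> \<phi> w)"
proof -
  interpret M: module K M by fact
  show ?thesis unfolding linsum_def
    by (rule M.add.finprod_mono_neutral_cong_left) (use assms in \<open>auto simp: Pi_iff subset_iff\<close>)
qed

lemma linsum_linear:
  assumes M: "module K M" and p: "\<phi> \<in> W \<rightarrow> carrier M"
  shows "linear_map K F M (linsum M \<phi>)"
proof -
  interpret M: module K M by fact
  let ?S = "\<lambda>x. {w. x w \<noteq> \<zero>\<^bsub>K\<^esub>}"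
  show ?thesis
  proof (rule linear_mapI)
    fix x assume x: "x \<in> carrier F"
    then show "linsum M \<phi> x \<in> carrier M" unfolding linsum_def
      by (intro M.finsum_closed) (use p in \<open>auto simp: carrier_F_iff Pi_iff subset_iff\<close>)
    fix a assume a: "a \<in> carrier K"
    have "?S (smult F a x) \<subseteq> ?S x" using x a by auto
    then have "linsum M \<phi> (smult F a x) = (\<Oplus>\<^bsub>M\<^esub>w\<in>?S x. smult F a x w \<odot>\<^bsub>M\<^esub> \<phi> w)"
      by (intro linsum_superset M p F_smult) (use x a in \<open>auto simp: carrier_F_iff\<close>)
    also have "\<dots> = (\<Oplus>\<^bsub>M\<^esub>w\<in>?S x. a \<odot>\<^bsub>M\<^esub> (x w \<odot>\<^bsub>M\<^esub> \<phi> w))"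
      by (rule M.finsum_cong') (use x a p in \<open>auto simp: carrier_F_iff subset_iff Pi_iff M.smult_assoc1\<close>)
    also have "\<dots> = a \<odot>\<^bsub>M\<^esub> linsum M \<phi> x" unfolding linsum_def
      by (rule M.finsum_smult_ldistr[symmetric]) (use x a p in \<open>auto simp: carrier_F_iff subset_iff Pi_iff\<close>)
    finally show "linsum M \<phi> (smult F a x) = a \<odot>\<^bsub>M\<^esub> linsum M \<phi> x" .
  next
    fix x y assume x: "x \<in> carrier F" and y: "y \<in> carrier F"
    let ?U = "?S x \<union> ?S y"
    have U: "finite ?U" "?U \<subseteq> W" using x y by (auto simp: carrier_F_iff)
    have "?S (add F x y) \<subseteq> ?U" using x y by auto
    then have "linsum M \<phi> (add F x y) = (\<Oplus>\<^bsub>M\<^esub>w\<in>?U. add F x y w \<odot>\<^bsub>M\<^esub> \<phi> w)"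
      by (intro linsum_superset M p F_add x y U)
    also have "\<dots> = (\<Oplus>\<^bsub>M\<^esub>w\<in>?U. x w \<odot>\<^bsub>M\<^esub> \<phi> w \<oplus>\<^bsub>M\<^esub> y w \<odot>\<^bsub>M\<^esub> \<phi> w)"
      by (rule M.finsum_cong') (use x y U p in \<open>auto simp: subset_iff Pi_iff M.smult_l_distr\<close>)
    also have "\<dots> = (\<Oplus>\<^bsub>M\<^esub>w\<in>?U. x w \<odot>\<^bsub>M\<^esub> \<phi> w) \<oplus>\<^bsub>M\<^esub> (\<Oplus>\<^bsub>M\<^esub>w\<in>?U. y w \<odot>\<^bsub>M\<^esub> \<phi> w)"
      by (rule M.finsum_addf) (use x y U p in \<open>auto simp: subset_iff Pi_iff\<close>)
    also have "\<dots> = linsum M \<phi> x \<oplus>\<^bsub>M\<^esub> linsum M \<phi> y"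
      using linsum_superset[OF M p x U(1)] linsum_superset[OF M p y U(1)] U by simp
    finally show "linsum M \<phi> (add F x y) = linsum M \<phi> x \<oplus>\<^bsub>M\<^esub> linsum M \<phi> y" .
  qed
qed

lemma linsum_word:
  assumes M: "module K M" and p: "\<phi> \<in> W \<rightarrow> carrier M" and w: "w \<in> W"
  shows "linsum M \<phi> (word K w) = \<phi> w"
proof -
  interpret M: module K M by fact
  have pw: "\<phi> w \<in> carrier M" using p w by (meson PiE)
  have "linsum M \<phi> (word K w) = (\<Oplus>\<^bsub>M\<^esub>v\<in>{w}. word K w v \<odot>\<^bsub>M\<^esub> \<phi> v)"
    by (rule linsum_superset[OF M p F_word[OF w]]) (use w in \<open>auto simp: word_def\<close>)
  then show ?thesis using pw by (simp add: word_def)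
qed

lemma relations_F: "linearity_relations K V \<subseteq> carrier F"
proof -
  interpret F: ring F by (rule F_ring)
  show ?thesis unfolding linearity_relations_def Let_def
    by (auto intro!: F.minus_closed F_add F_smult simp del: free_algebra_sel)
qed

lemma J_ideal: "ideal J F"
  unfolding tensor_ideal_def by (rule ring.genideal_ideal[OF F_ring relations_F])

text \<open>Nothing explicit is known about the members of \<open>J\<close>. As it is the least
  two-sided ideal containing the relations, it suffices to exhibit some two-sided ideal that
  contains the relations and on which the linear extension is zero.\<close>

lemma linsum_J:
  assumes M: "module K M" and p: "multilinear M \<phi>" and x: "x \<in> J"
  shows "linsum M \<phi> x = \<zero>\<^bsub>M\<^esub>"
proof -
  interpret F: ring F by (rule F_ring)
  interpret FM: module K F by (rule F_module)
  interpret M: module K M by fact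
  note [simp del] = free_algebra_sel
  have p0: "\<phi> \<in> W \<rightarrow> carrier M" using p by (simp add: multilinear_def)
  let ?L = "linsum M \<phi>"
  note lin = linear_mapD[OF linsum_linear[OF M p0]]
  note [simp] = lin(2,3) F_smult_l F_smult_r F_smult
  have L0 [simp]: "?L \<zero>\<^bsub>F\<^esub> = \<zero>\<^bsub>M\<^esub>" by (rule linear_map_zero[OF F_module M linsum_linear[OF M p0]])
  \<comment> \<open>Multilinearity gives equality only when \<open>q\<close> and \<open>q'\<close>
    stand between two words; two inductions replace the words by arbitrary elements.\<close>
  have two: "?L (mult F (mult F y q) z) = ?L (mult F (mult F y q') z)"
    if q: "q \<in> carrier F" "q' \<in> carrier F"
    and h: "\<And>u v. u \<in> W \<Longrightarrow> v \<in> W \<Longrightarrow> ?L (mult F (mult F (word K u) q) (word K v)) = ?L (mult F (mult F (word K u) q') (word K v))"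
    and yz: "y \<in> carrier F" "z \<in> carrier F" for q q' y z
  proof -
    have 1: "?L (mult F (mult F (word K u) q) z) = ?L (mult F (mult F (word K u) q') z)" if u: "u \<in> W" for u
      using yz(2) by (induction rule: F_induct) (use q u h in \<open>auto simp: F.r_distr\<close>)
    show ?thesis using yz(1) by (induction rule: F_induct) (use q yz(2) 1 in \<open>auto simp: F.l_distr\<close>)
  qed
  \<comment> \<open>the largest two-sided ideal in the kernel of \<open>?L\<close>\<close>
  define I where "I = {x \<in> carrier F. \<forall>y\<in>carrier F. \<forall>z\<in>carrier F. ?L (mult F (mult F y x) z) = \<zero>\<^bsub>M\<^esub>}"
  have memI: "q \<ominus>\<^bsub>F\<^esub> q' \<in> I" if q: "q \<in> carrier F" "q' \<in> carrier F"
    and h: "\<And>u v. u \<in> W \<Longrightarrow> v \<in> W \<Longrightarrow> ?L (mult F (mult F (word K u) q) (word K v)) = ?L (mult F (mult F (word K u) q') (word K v))" for q q'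
  proof -
    have "?L (mult F (mult F y (q \<ominus>\<^bsub>F\<^esub> q')) z) = \<zero>\<^bsub>M\<^esub>" if yz: "y \<in> carrier F" "z \<in> carrier F" for y z
    proof -
      have "mult F (mult F y (q \<ominus>\<^bsub>F\<^esub> q')) z = mult F (mult F y q) z \<ominus>\<^bsub>F\<^esub> mult F (mult F y q') z"
        using q yz by (simp add: a_minus_def F.l_distr F.r_distr F.l_minus F.r_minus)
      then have "?L (mult F (mult F y (q \<ominus>\<^bsub>F\<^esub> q')) z) = ?L (mult F (mult F y q) z) \<ominus>\<^bsub>M\<^esub> ?L (mult F (mult F y q') z)"
        using q yz by (simp add: linear_map_minus[OF F_module M linsum_linear[OF M p0]])
      then show ?thesis using two[OF q h yz] lin(1) q yz by (simp add: M.r_neg a_minus_def)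
    qed
    then show ?thesis using q by (simp add: I_def)
  qed
  have ideal: "ideal I F"
  proof (rule idealI)
    show "ring F" by (rule F_ring)
    show "subgroup I (add_monoid F)"
    proof (rule F.add.subgroupI)
      show "I \<subseteq> carrier F" by (auto simp: I_def)
      show "I \<noteq> {}" by (auto simp: I_def intro!: exI[of _ "\<zero>\<^bsub>F\<^esub>"])
      fix a b assume a: "a \<in> I" and b: "b \<in> I"
      show "\<ominus>\<^bsub>F\<^esub> a \<in> I" using a
        by (auto simp: I_def FM.uminus_smult)
      show "a \<oplus>\<^bsub>F\<^esub> b \<in> I" using a b by (auto simp: I_def F.l_distr F.r_distr)
    qed
    fix a x assume a: "a \<in> I" and x: "x \<in> carrier F"
    have "mult F (mult F y (mult F x a)) z = mult F (mult F (mult F y x) a) z"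
      "mult F (mult F y (mult F a x)) z = mult F (mult F y a) (mult F x z)"
      if "y \<in> carrier F" "z \<in> carrier F" for y z
      using a x that by (auto simp: I_def F.m_assoc)
    then show "mult F x a \<in> I" "mult F a x \<in> I" using a x by (auto simp: I_def)
  qed
  have "linearity_relations K V \<subseteq> I"
  proof -
    have "word K [u \<oplus>\<^bsub>V\<^esub> v] \<ominus>\<^bsub>F\<^esub> (word K [u] \<oplus>\<^bsub>F\<^esub> word K [v]) \<in> I" if "u \<in> carrier V" "v \<in> carrier V" for u v
      by (rule memI) (use that p in \<open>auto simp: F.l_distr F.r_distr word_mult linsum_word[OF M p0] multilinear_def\<close>)
    moreover have "word K [a \<odot>\<^bsub>V\<^esub> v] \<ominus>\<^bsub>F\<^esub> (a \<odot>\<^bsub>F\<^esub> word K [v]) \<in> I" if "a \<in> carrier K" "v \<in> carrier V" for a v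
      by (rule memI) (use that p in \<open>auto simp: word_mult linsum_word[OF M p0] multilinear_def\<close>)
    ultimately show ?thesis unfolding linearity_relations_def Let_def by blast
  qed
  then have "J \<subseteq> I" unfolding tensor_ideal_def by (rule F.genideal_minimal[OF ideal])
  then have "x \<in> I" using x by blast
  \<comment> \<open>Membership in \<open>I\<close> speaks of products around \<open>x\<close>; with
    the unit as both outer factors it speaks of \<open>x\<close> itself.\<close>
  then have "x \<in> carrier F" "?L (mult F (mult F (one F) x) (one F)) = \<zero>\<^bsub>M\<^esub>"
    using F.one_closed unfolding I_def by blast+
  then show ?thesis by simp
qed

text \<open>The operations of the quotient are set operations on cosets; here they are reduced to
  representatives. The scalar action takes the most work, being a union over all members of a
  coset.\<close>

lemma tensor_algebra_sel:
  "carrier T = cl ` carrier F"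
  "zero T = J"
  "one T = pt []"
  "\<lbrakk>x \<in> carrier F; y \<in> carrier F\<rbrakk> \<Longrightarrow> add T (cl x) (cl y) = cl (add F x y)"
  "\<lbrakk>x \<in> carrier F; y \<in> carrier F\<rbrakk> \<Longrightarrow> mult T (cl x) (cl y) = cl (mult F x y)"
  "\<lbrakk>x \<in> carrier F; a \<in> carrier K\<rbrakk> \<Longrightarrow> smult T a (cl x) = cl (smult F a x)"
proof -
  interpret I: ideal J F by (rule J_ideal)
  interpret FM: module K F by (rule F_module)
  have T: "T = \<lparr>carrier = a_rcosets\<^bsub>F\<^esub> J, mult = rcoset_mult F J,
      one = cl (one F), zero = J, add = set_add F, smult = (\<lambda>a X. \<Union>x\<in>X. cl (a \<odot>\<^bsub>F\<^esub> x))\<rparr>"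
    unfolding tensor_algebra_def Let_def FactRing_def ring.extend_def module.fields_def by simp
  show "carrier T = cl ` carrier F" unfolding T by (auto simp: A_RCOSETS_def')
  show "zero T = J" "one T = pt []" unfolding T pure_tensor_def by simp_all
  assume x: "x \<in> carrier F"
  show "mult T (cl x) (cl y) = cl (mult F x y)" if "y \<in> carrier F"
    using x that unfolding T by (simp add: I.rcoset_mult_add)
  show "add T (cl x) (cl y) = cl (add F x y)" if "y \<in> carrier F"
    using x that unfolding T by (simp add: I.a_rcos_sum)
  assume a: "a \<in> carrier K"
  have "cl (a \<odot>\<^bsub>F\<^esub> y) = cl (a \<odot>\<^bsub>F\<^esub> x)" if y: "y \<in> cl x" for y
  proof -
    obtain j where j: "j \<in> J" "y = j \<oplus>\<^bsub>F\<^esub> x" using y unfolding a_r_coset_def' by auto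
    have jF: "j \<in> carrier F" using j(1) I.a_subset by blast
    \<comment> \<open>A two-sided ideal is closed under scalars, because scaling by \<open>a\<close>
      is multiplication by \<open>a\<close> times the unit.\<close>
    have "smult F a j = mult F (smult F a (one F)) j" using jF a
      using F_smult_l[of "one F" j a] by (simp del: free_algebra_sel)
    then have aj: "smult F a j \<in> J" using I.I_l_closed j(1) FM.smult_closed[OF a I.one_closed] by simp
    have "smult F a y = smult F a j \<oplus>\<^bsub>F\<^esub> smult F a x"
      unfolding j(2) by (rule FM.smult_r_distr[OF a jF x])
    then have "smult F a y \<in> cl (smult F a x)" using aj unfolding a_r_coset_def' by auto
    then show ?thesis using I.a_repr_independence' F_smult[OF a x] by metis
  qed
  moreover have "x \<in> cl x" using I.a_rcos_self x by simp
  ultimately have "(\<Union>y\<in>cl x. cl (a \<odot>\<^bsub>F\<^esub> y)) = cl (a \<odot>\<^bsub>F\<^esub> x)" by (intro SUP_eq_const) (blast, metis)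
  then show "smult T a (cl x) = cl (smult F a x)" unfolding T by (simp del: free_algebra_sel)
qed

lemma T_ring: "ring T"
proof -
  interpret I: ideal J F by (rule J_ideal)
  interpret Q: ring "F Quot J" by (rule I.quotient_is_ring)
  have eq: "carrier T = carrier (F Quot J)" "mult T = mult (F Quot J)" "add T = add (F Quot J)"
    "one T = one (F Quot J)" "zero T = zero (F Quot J)"
    unfolding tensor_algebra_def Let_def ring.extend_def module.fields_def by simp_all
  show ?thesis
    apply (rule ringI)
    subgoal by (rule abelian_groupI) (simp_all add: eq Q.add.m_ac Q.add.l_inv_ex)
    subgoal by (rule monoidI) (simp_all add: eq Q.m_assoc)
    by (simp_all add: eq Q.l_distr Q.r_distr)
qed

lemma T_cases [consumes 1]: assumes "X \<in> carrier T" obtains x where "x \<in> carrier F" "X = cl x"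
  using assms by (auto simp: tensor_algebra_sel)

lemma T_module: "module K T"
proof (rule moduleI)
  interpret FM: module K F by (rule F_module)
  interpret T: ring T by (rule T_ring)
  note [simp del] = free_algebra_sel
  show "cring K" by (rule R.is_cring)
  show "abelian_group T" by (rule T.is_abelian_group)
  fix X assume "X \<in> carrier T"
  then obtain x where x: "x \<in> carrier F" "X = cl x" by (rule T_cases)
  show "\<one>\<^bsub>K\<^esub> \<odot>\<^bsub>T\<^esub> X = X" using x by (simp add: tensor_algebra_sel)
  fix a assume a: "a \<in> carrier K"
  show "a \<odot>\<^bsub>T\<^esub> X \<in> carrier T" using a x by (auto simp: tensor_algebra_sel)
  show "a \<odot>\<^bsub>T\<^esub> (X \<oplus>\<^bsub>T\<^esub> Y) = a \<odot>\<^bsub>T\<^esub> X \<oplus>\<^bsub>T\<^esub> a \<odot>\<^bsub>T\<^esub> Y" if "Y \<in> carrier T" for Y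
    by (rule T_cases[OF that]) (simp add: a x tensor_algebra_sel FM.smult_r_distr F_add)
  fix b assume b: "b \<in> carrier K"
  show "(a \<oplus>\<^bsub>K\<^esub> b) \<odot>\<^bsub>T\<^esub> X = a \<odot>\<^bsub>T\<^esub> X \<oplus>\<^bsub>T\<^esub> b \<odot>\<^bsub>T\<^esub> X"
    "a \<otimes>\<^bsub>K\<^esub> b \<odot>\<^bsub>T\<^esub> X = a \<odot>\<^bsub>T\<^esub> (b \<odot>\<^bsub>T\<^esub> X)"
    using a b x by (simp_all add: tensor_algebra_sel FM.smult_l_distr FM.smult_assoc1)
qed

lemma T_smult_mult:
  assumes "a \<in> carrier K" "x \<in> carrier T" "y \<in> carrier T"
  shows "(a \<odot>\<^bsub>T\<^esub> x) \<otimes>\<^bsub>T\<^esub> y = a \<odot>\<^bsub>T\<^esub> (x \<otimes>\<^bsub>T\<^esub> y)" "x \<otimes>\<^bsub>T\<^esub> (a \<odot>\<^bsub>T\<^esub> y) = a \<odot>\<^bsub>T\<^esub> (x \<otimes>\<^bsub>T\<^esub> y)"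
proof -
  obtain u where u: "u \<in> carrier F" "x = cl u" by (rule T_cases[OF assms(2)])
  obtain v where v: "v \<in> carrier F" "y = cl v" by (rule T_cases[OF assms(3)])
  show "(a \<odot>\<^bsub>T\<^esub> x) \<otimes>\<^bsub>T\<^esub> y = a \<odot>\<^bsub>T\<^esub> (x \<otimes>\<^bsub>T\<^esub> y)" "x \<otimes>\<^bsub>T\<^esub> (a \<odot>\<^bsub>T\<^esub> y) = a \<odot>\<^bsub>T\<^esub> (x \<otimes>\<^bsub>T\<^esub> y)"
    using u v assms(1) by (simp_all only: tensor_algebra_sel F_smult_l F_smult_r F_smult F_mult)
qed

lemma pt_T: "w \<in> W \<Longrightarrow> pt w \<in> carrier T"
  by (simp add: pure_tensor_def tensor_algebra_sel)

lemma pt_mult: "u \<in> W \<Longrightarrow> v \<in> W \<Longrightarrow> pt u \<otimes>\<^bsub>T\<^esub> pt v = pt (u @ v)"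
  by (simp add: pure_tensor_def tensor_algebra_sel word_mult del: free_algebra_sel)

text \<open>The relations speak of one-letter words only. In a longer word the varying letter is
  isolated as the middle factor of a product in the tensor algebra, where distributivity finishes
  the argument.\<close>

lemma multilinear_pt: "multilinear T pt"
proof -
  interpret I: ideal J F by (rule J_ideal)
  interpret T: ring T by (rule T_ring)
  interpret TM: module K T by (rule T_module)
  note [simp del] = free_algebra_sel
  have clI: "cl x = cl y" if "x \<ominus>\<^bsub>F\<^esub> y \<in> J" "x \<in> carrier F" "y \<in> carrier F" for x y
    using that I.a_repr_independence' I.a_rcos_module_rev[of y x] by (simp add: a_minus_def I.quotient_eq_iff_same_a_r_cos)
  have rel: "x \<in> J" if "x \<in> linearity_relations K V" for x
    using that ring.genideal_self[OF F_ring relations_F] unfolding tensor_ideal_def by blast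
  have a: "pt [a \<oplus>\<^bsub>V\<^esub> b] = pt [a] \<oplus>\<^bsub>T\<^esub> pt [b]" if "a \<in> carrier V" "b \<in> carrier V" for a b
    unfolding pure_tensor_def using that
    by (subst tensor_algebra_sel) (simp, simp, rule clI, rule rel, unfold linearity_relations_def Let_def, blast, auto simp: F_add)
  have s: "pt [k \<odot>\<^bsub>V\<^esub> a] = k \<odot>\<^bsub>T\<^esub> pt [a]" if "a \<in> carrier V" "k \<in> carrier K" for a k
    unfolding pure_tensor_def using that
    by (subst tensor_algebra_sel) (simp, simp, rule clI, rule rel, unfold linearity_relations_def Let_def, blast, auto simp: F_smult)
  have spl: "pt (u @ a # v) = pt u \<otimes>\<^bsub>T\<^esub> pt [a] \<otimes>\<^bsub>T\<^esub> pt v" if "u \<in> W" "v \<in> W" "a \<in> carrier V" for u v a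
    using that by (simp add: pt_mult)
  show ?thesis unfolding multilinear_def
  proof (intro conjI ballI)
    show "pt \<in> W \<rightarrow> carrier T" using pt_T by blast
    fix u v e assume uv: "u \<in> W" "v \<in> W" and e: "e \<in> carrier V"
    have e1: "[e] \<in> W" using e by simp
    show "pt (u @ (e \<oplus>\<^bsub>V\<^esub> b) # v) = pt (u @ e # v) \<oplus>\<^bsub>T\<^esub> pt (u @ b # v)" if b: "b \<in> carrier V" for b
    proof -
      have b1: "[b] \<in> W" using b by simp
      show ?thesis unfolding spl[OF uv e] spl[OF uv b] spl[OF uv M.add.m_closed[OF e b]] a[OF e b]
        by (simp only: pt_T uv e1 b1 T.l_distr T.r_distr T.m_closed)
    qed
    show "pt (u @ (k \<odot>\<^bsub>V\<^esub> e) # v) = k \<odot>\<^bsub>T\<^esub> pt (u @ e # v)" if k: "k \<in> carrier K" for k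
      unfolding spl[OF uv e] spl[OF uv smult_closed[OF k e]] s[OF e k]
      by (simp only: pt_T uv e1 k T_smult_mult T.m_closed)
  qed
qed

text \<open>The same choice of representative as in \<open>lin_ext\<close>, but with values in any
  module and without cutting to one degree. That the choice is harmless is
  \<open>lift_cl\<close>.\<close>

definition lift :: "('k, 'w, 'n) module_scheme \<Rightarrow> ('v list \<Rightarrow> 'w) \<Rightarrow> ('k, 'v) tensor \<Rightarrow> 'w" where
  "lift M \<phi> X = linsum M \<phi> (SOME x. x \<in> X)"

text \<open>The chosen representative differs from \<open>x\<close> by a member of \<open>J\<close>,
  on which \<open>linsum\<close> vanishes.\<close>

lemma lift_cl:
  assumes M: "module K M" and p: "multilinear M \<phi>" and x: "x \<in> carrier F"
  shows "lift M \<phi> (cl x) = linsum M \<phi> x"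
proof -
  interpret I: ideal J F by (rule J_ideal)
  interpret M: module K M by fact
  have p0: "\<phi> \<in> W \<rightarrow> carrier M" using p by (simp add: multilinear_def)
  have "(SOME y. y \<in> cl x) \<in> cl x" by (rule someI[of _ x]) (simp add: I.a_rcos_self x)
  then obtain j where j: "j \<in> J" "(SOME y. y \<in> cl x) = j \<oplus>\<^bsub>F\<^esub> x" unfolding a_r_coset_def' by auto
  have jF: "j \<in> carrier F" using j(1) I.a_subset by blast
  note lin = linear_mapD[OF linsum_linear[OF M p0]]
  show ?thesis unfolding lift_def j(2) lin(2)[OF jF x] linsum_J[OF M p j(1)]
    by (rule M.l_zero[OF lin(1)[OF x]])
qed

lemma lift_linear:
  assumes M: "module K M" and p: "multilinear M \<phi>"
  shows "linear_map K T M (lift M \<phi>)"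
proof -
  have p0: "\<phi> \<in> W \<rightarrow> carrier M" using p by (simp add: multilinear_def)
  note lin = linear_mapD[OF linsum_linear[OF M p0]]
  show ?thesis
  proof (rule linear_mapI)
    fix X assume "X \<in> carrier T"
    then obtain x where x: "x \<in> carrier F" "X = cl x" by (rule T_cases)
    show "lift M \<phi> X \<in> carrier M" using lin(1)[OF x(1)] x by (simp only: lift_cl[OF M p])
    show "lift M \<phi> (a \<odot>\<^bsub>T\<^esub> X) = a \<odot>\<^bsub>M\<^esub> lift M \<phi> X" if "a \<in> carrier K" for a
      using x that by (simp only: tensor_algebra_sel lift_cl[OF M p] lin F_smult)
    fix Y assume "Y \<in> carrier T"
    then obtain y where y: "y \<in> carrier F" "Y = cl y" by (rule T_cases)
    show "lift M \<phi> (X \<oplus>\<^bsub>T\<^esub> Y) = lift M \<phi> X \<oplus>\<^bsub>M\<^esub> lift M \<phi> Y"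
      using x y by (simp only: tensor_algebra_sel lift_cl[OF M p] lin F_add)
  qed
qed

lemma lift_pt:
  assumes M: "module K M" and p: "multilinear M \<phi>" and w: "w \<in> W"
  shows "lift M \<phi> (pt w) = \<phi> w"
proof -
  have p0: "\<phi> \<in> W \<rightarrow> carrier M" using p by (simp add: multilinear_def)
  show ?thesis unfolding pure_tensor_def lift_cl[OF M p F_word[OF w]] by (rule linsum_word[OF M p0 w])
qed

end

lemma linear_map_comp:
  "linear_map K U V f \<Longrightarrow> linear_map K V W g \<Longrightarrow> linear_map K U W (\<lambda>x. g (f x))"
  by (auto simp: linear_map_def Pi_iff)

lemma linear_map_id: "linear_map K V V id"
  by (auto simp: linear_map_def)

section \<open>Tensor powers\<close>

context linear_space
begin

lemma tp_sel [simp]: "add (tp n) = add T" "zero (tp n) = zero T" "smult (tp n) = smult T"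
  by (simp_all add: tensor_power_def)

lemma carrier_tp_iff: "X \<in> carrier (tp n) \<longleftrightarrow>
    (\<exists>x\<in>carrier F. (\<forall>w. x w \<noteq> \<zero>\<^bsub>K\<^esub> \<longrightarrow> length w = n) \<and> X = cl x)"
  by (auto simp: tensor_power_def)

lemma tp_T: "X \<in> carrier (tp n) \<Longrightarrow> X \<in> carrier T"
  by (auto simp: carrier_tp_iff tensor_algebra_sel(1))

lemma pt_tp: assumes "w \<in> W" "length w = n" shows "pt w \<in> carrier (tp n)"
proof -
  have "\<forall>w'. word K w w' \<noteq> \<zero>\<^bsub>K\<^esub> \<longrightarrow> length w' = n" using assms(2) by (auto simp: word_def)
  then show ?thesis unfolding carrier_tp_iff pure_tensor_def using F_word[OF assms(1)] by blast
qed

lemma tp_add: assumes "X \<in> carrier (tp n)" "Y \<in> carrier (tp n)" shows "X \<oplus>\<^bsub>T\<^esub> Y \<in> carrier (tp n)"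
proof -
  obtain x where x: "x \<in> carrier F" "\<And>w. x w \<noteq> \<zero>\<^bsub>K\<^esub> \<Longrightarrow> length w = n" "X = cl x"
    using assms(1) by (auto simp: carrier_tp_iff)
  obtain y where y: "y \<in> carrier F" "\<And>w. y w \<noteq> \<zero>\<^bsub>K\<^esub> \<Longrightarrow> length w = n" "Y = cl y"
    using assms(2) by (auto simp: carrier_tp_iff)
  have "length w = n" if "add F x y w \<noteq> \<zero>\<^bsub>K\<^esub>" for w
  proof -
    have "x w \<noteq> \<zero>\<^bsub>K\<^esub> \<or> y w \<noteq> \<zero>\<^bsub>K\<^esub>" using that by auto
    then show ?thesis using x(2) y(2) by blast
  qed
  then show ?thesis unfolding carrier_tp_iff x(3) y(3)
    by (intro bexI[of _ "add F x y"]) (use x y tensor_algebra_sel(4) F_add in blast)+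
qed

lemma tp_smult: assumes "X \<in> carrier (tp n)" "a \<in> carrier K" shows "a \<odot>\<^bsub>T\<^esub> X \<in> carrier (tp n)"
proof -
  obtain x where x: "x \<in> carrier F" "\<And>w. x w \<noteq> \<zero>\<^bsub>K\<^esub> \<Longrightarrow> length w = n" "X = cl x"
    using assms(1) by (auto simp: carrier_tp_iff)
  have "length w = n" if "smult F a x w \<noteq> \<zero>\<^bsub>K\<^esub>" for w
  proof -
    have "x w \<noteq> \<zero>\<^bsub>K\<^esub>" using that assms(2) by auto
    then show ?thesis using x(2) by blast
  qed
  then show ?thesis unfolding carrier_tp_iff x(3)
    by (intro bexI[of _ "smult F a x"]) (use x assms(2) tensor_algebra_sel(6) F_smult in blast)+
qed

lemma tensor_ideal_eq_zero_class: "J = cl (zero F)"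
proof -
  interpret I: ideal J F by (rule J_ideal)
  show ?thesis using I.a_coset_add_zero[OF I.a_subset] by simp
qed

lemma tp_zero: "\<zero>\<^bsub>T\<^esub> \<in> carrier (tp n)"
  unfolding carrier_tp_iff tensor_algebra_sel(2) by (rule bexI[of _ "zero F"], intro conjI, simp, rule tensor_ideal_eq_zero_class, rule F_zero)

lemma tp_module: "module K (tp n)"
proof -
  interpret TM: module K T by (rule T_module)
  show ?thesis
  proof (rule moduleI)
    show "cring K" by (rule R.is_cring)
    show "abelian_group (tp n)"
    proof (rule abelian_groupI)
      fix x assume x: "x \<in> carrier (tp n)"
      have "\<ominus>\<^bsub>T\<^esub> x \<in> carrier (tp n)" using tp_smult[OF x] tp_T[OF x] by (simp add: TM.uminus_smult)
      then show "\<exists>y\<in>carrier (tp n). y \<oplus>\<^bsub>tp n\<^esub> x = \<zero>\<^bsub>tp n\<^esub>" using tp_T[OF x]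
        by (intro bexI[of _ "\<ominus>\<^bsub>T\<^esub> x"]) (simp_all add: TM.l_neg)
    qed (simp_all add: tp_add tp_zero tp_T TM.add.m_ac)
  qed (simp_all add: tp_smult tp_T TM.smult_l_distr TM.smult_r_distr TM.smult_assoc1)
qed

text \<open>Induction over the free algebra leaves degree \<open>n\<close>. It is therefore run for
  all \<open>x\<close>, but about the degree-\<open>n\<close> truncation \<open>r x\<close>; a
  homogeneous representative is its own truncation.\<close>

lemma tp_induct [consumes 1, case_names zero add pt]:
  assumes X: "X \<in> carrier (tp n)"
    and Z: "P \<zero>\<^bsub>T\<^esub>"
    and A: "\<And>X Y. X \<in> carrier (tp n) \<Longrightarrow> Y \<in> carrier (tp n) \<Longrightarrow> P X \<Longrightarrow> P Y \<Longrightarrow> P (X \<oplus>\<^bsub>T\<^esub> Y)"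
    and Wd: "\<And>a w. a \<in> carrier K \<Longrightarrow> w \<in> W \<Longrightarrow> length w = n \<Longrightarrow> P (a \<odot>\<^bsub>T\<^esub> pt w)"
  shows "P X"
proof -
  define r where "r x = (\<lambda>w::'v list. if length w = n then x w else \<zero>\<^bsub>K\<^esub>)" for x
  have rF: "r x \<in> carrier F" if "x \<in> carrier F" for x
    using that by (auto simp: r_def carrier_F_iff intro: finite_subset[of _ "{w. x w \<noteq> \<zero>\<^bsub>K\<^esub>}"])
  have rtp: "cl (r x) \<in> carrier (tp n)" if "x \<in> carrier F" for x
    unfolding carrier_tp_iff by (rule bexI[of _ "r x"]) (simp add: r_def, rule rF[OF that])
  have "P (cl (r x))" if "x \<in> carrier F" for x
    using that
  proof (induction rule: F_induct)
    case zero
    have "r (zero F) = zero F" by (simp add: r_def fun_eq_iff)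
    with Z show ?case by (simp only: tensor_ideal_eq_zero_class[symmetric] tensor_algebra_sel)
  next
    case (add x y)
    have "r (add F x y) = add F (r x) (r y)" by (simp add: r_def fun_eq_iff)
    then show ?case using A[OF rtp rtp] add by (simp only: tensor_algebra_sel(4) rF)
  next
    case (word a w)
    show ?case
    proof (cases "length w = n")
      case True
      have "r (smult F a (word K w)) = smult F a (word K w)"
        using True word by (auto simp: r_def fun_eq_iff word_def)
      then show ?thesis using Wd[OF word True] word by (simp only: pure_tensor_def tensor_algebra_sel(6) F_word)
    next
      case False
      have "r (smult F a (word K w)) = zero F"
        using False word by (auto simp: r_def fun_eq_iff word_def)
      with Z show ?thesis by (simp only: tensor_ideal_eq_zero_class[symmetric] tensor_algebra_sel)
    qed
  qed
  moreover obtain x where x: "x \<in> carrier F" "\<forall>w. x w \<noteq> \<zero>\<^bsub>K\<^esub> \<longrightarrow> length w = n" "X = cl x"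
    using X by (auto simp: carrier_tp_iff)
  moreover have "r x = x" using x(2) unfolding r_def by (intro ext) metis
  ultimately show ?thesis by metis
qed

lemma tp_linear_eqI:
  assumes M: "module K M" and f: "linear_map K (tp n) M f" and g: "linear_map K (tp n) M g"
    and eq: "\<And>w. w \<in> W \<Longrightarrow> length w = n \<Longrightarrow> f (pt w) = g (pt w)"
    and X: "X \<in> carrier (tp n)"
  shows "f X = g X"
  using X
proof (induction rule: tp_induct)
  case zero
  show ?case using linear_map_zero[OF tp_module M f] linear_map_zero[OF tp_module M g] by simp
next
  case (add X Y)
  then show ?case using linear_mapD(2)[OF f] linear_mapD(2)[OF g] by simp
next
  case (pt a w)
  then show ?case using linear_mapD(3)[OF f, of a "pt w"] linear_mapD(3)[OF g, of a "pt w"]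
    by (simp add: eq pt_tp)
qed

lemma tp_mult:
  assumes s: "s \<in> carrier (tp j)" and t: "t \<in> carrier (tp k)"
  shows "s \<otimes>\<^bsub>T\<^esub> t \<in> carrier (tp (j + k))"
proof -
  interpret T: ring T by (rule T_ring)
  have 1: "pt u \<otimes>\<^bsub>T\<^esub> t \<in> carrier (tp (j + k))" if u: "u \<in> W" "length u = j" for u
    using t by (induction rule: tp_induct)
      (use u in \<open>auto simp: pt_T T.r_distr tp_T T_smult_mult pt_mult tp_zero intro!: tp_add tp_smult pt_tp\<close>)
  show ?thesis
    using s by (induction rule: tp_induct)
      (use t 1 in \<open>auto simp: pt_T T.l_distr tp_T T_smult_mult pt_mult tp_zero intro!: tp_add tp_smult\<close>)
qed

lemma mult_right_linear:
  assumes t: "t \<in> carrier (tp k)" shows "linear_map K (tp j) (tp (j + k)) (\<lambda>s. s \<otimes>\<^bsub>T\<^esub> t)"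
proof -
  interpret T: ring T by (rule T_ring)
  show ?thesis using t by (auto intro!: linear_mapI tp_mult simp: tp_T T.l_distr T_smult_mult)
qed

lemma mult_left_linear:
  assumes s: "s \<in> carrier (tp j)" shows "linear_map K (tp k) (tp (j + k)) (\<lambda>t. s \<otimes>\<^bsub>T\<^esub> t)"
proof -
  interpret T: ring T by (rule T_ring)
  show ?thesis using s by (auto intro!: linear_mapI tp_mult simp: tp_T T.r_distr T_smult_mult)
qed

text \<open>Constrains \<open>\<phi>\<close> on words of length \<open>n\<close> only, because the
  lambda terms given to \<open>lin_ext\<close> take arbitrary values at other lengths.\<close>

definition multilin :: "('k, 'w, 'n) module_scheme \<Rightarrow> nat \<Rightarrow> ('v list \<Rightarrow> 'w) \<Rightarrow> bool" where
  "multilin M n \<phi> \<longleftrightarrow> (\<forall>w\<in>W. length w = n \<longrightarrow> \<phi> w \<in> carrier M) \<and>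
     (\<forall>u\<in>W. \<forall>v\<in>W. Suc (length u + length v) = n \<longrightarrow> (\<forall>a\<in>carrier V.
       (\<forall>b\<in>carrier V. \<phi> (u @ (a \<oplus>\<^bsub>V\<^esub> b) # v) = \<phi> (u @ a # v) \<oplus>\<^bsub>M\<^esub> \<phi> (u @ b # v)) \<and>
       (\<forall>k\<in>carrier K. \<phi> (u @ (k \<odot>\<^bsub>V\<^esub> a) # v) = k \<odot>\<^bsub>M\<^esub> \<phi> (u @ a # v))))"

lemma multilinI:
  assumes "\<And>w. w \<in> W \<Longrightarrow> length w = n \<Longrightarrow> \<phi> w \<in> carrier M"
    and "\<And>u v a b. u \<in> W \<Longrightarrow> v \<in> W \<Longrightarrow> Suc (length u + length v) = n \<Longrightarrow> a \<in> carrier V \<Longrightarrow> b \<in> carrier V \<Longrightarrow>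
       \<phi> (u @ (a \<oplus>\<^bsub>V\<^esub> b) # v) = \<phi> (u @ a # v) \<oplus>\<^bsub>M\<^esub> \<phi> (u @ b # v)"
    and "\<And>u v a k. u \<in> W \<Longrightarrow> v \<in> W \<Longrightarrow> Suc (length u + length v) = n \<Longrightarrow> a \<in> carrier V \<Longrightarrow> k \<in> carrier K \<Longrightarrow>
       \<phi> (u @ (k \<odot>\<^bsub>V\<^esub> a) # v) = k \<odot>\<^bsub>M\<^esub> \<phi> (u @ a # v)"
  shows "multilin M n \<phi>"
  using assms unfolding multilin_def by blast

lemma multilinD:
  assumes "multilin M n \<phi>"
  shows "w \<in> W \<Longrightarrow> length w = n \<Longrightarrow> \<phi> w \<in> carrier M"
    and "u \<in> W \<Longrightarrow> v \<in> W \<Longrightarrow> Suc (length u + length v) = n \<Longrightarrow> a \<in> carrier V \<Longrightarrow> b \<in> carrier V \<Longrightarrow>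
       \<phi> (u @ (a \<oplus>\<^bsub>V\<^esub> b) # v) = \<phi> (u @ a # v) \<oplus>\<^bsub>M\<^esub> \<phi> (u @ b # v)"
    and "u \<in> W \<Longrightarrow> v \<in> W \<Longrightarrow> Suc (length u + length v) = n \<Longrightarrow> a \<in> carrier V \<Longrightarrow> k \<in> carrier K \<Longrightarrow>
       \<phi> (u @ (k \<odot>\<^bsub>V\<^esub> a) # v) = k \<odot>\<^bsub>M\<^esub> \<phi> (u @ a # v)"
  using assms unfolding multilin_def by blast+

text \<open>The two words in each multilinearity equation have the same length, so extension by zero
  to the other degrees stays multilinear. This lets \<open>lift\<close> treat maps that live in a
  single degree.\<close>

lemma multilin_multilinear:
  assumes M: "module K M" and p: "multilin M n \<phi>"
  shows "multilinear M (\<lambda>w. if length w = n then \<phi> w else \<zero>\<^bsub>M\<^esub>)"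
proof -
  interpret M: module K M by fact
  show ?thesis unfolding multilinear_def
    by (auto simp del: in_lists_conv_set simp: multilinD[OF p])
qed

lemma multilin_pt: "multilin (tp n) n pt"
  by (rule multilinI) (use multilinear_pt in \<open>simp_all add: pt_tp multilinear_def\<close>)

lemma multilin_comp:
  assumes p: "multilin M n \<phi>" and f: "linear_map K M N f"
  shows "multilin N n (\<lambda>w. f (\<phi> w))"
  by (rule multilinI) (use linear_mapD[OF f] in \<open>simp_all add: multilinD[OF p] del: in_lists_conv_set\<close>)

end

section \<open>Linear maps between tensor powers of two spaces\<close>

locale linear_space_pair = V: linear_space K V + W: linear_space K W
  for K :: "'k ring" and V :: "('k, 'v, 'm) module_scheme" and W :: "('k, 'w, 'n) module_scheme"
begin

text \<open>A letter of a word of length \<open>j + k\<close> lies either among the first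
  \<open>j\<close> letters or after them; accordingly linearity comes from \<open>\<phi>\<close> or
  from \<open>\<psi>\<close>.\<close>

lemma multilin_mult:
  assumes p: "V.multilin (W.tp j') j \<phi>" and q: "V.multilin (W.tp k') k \<psi>"
  shows "V.multilin (W.tp (j' + k')) (j + k) (\<lambda>w. \<phi> (take j w) \<otimes>\<^bsub>W.T\<^esub> \<psi> (drop j w))"
proof -
  interpret T: ring W.T by (rule W.T_ring)
  have tk: "take m w \<in> V.W" "drop m w \<in> V.W" if "w \<in> V.W" for m w
    using that by (auto dest: in_set_takeD in_set_dropD)
  have pc: "\<phi> w \<in> carrier (W.tp j')" "\<phi> w \<in> carrier W.T" if "w \<in> V.W" "length w = j" for w
    using V.multilinD(1)[OF p that] W.tp_T by auto
  have qc: "\<psi> w \<in> carrier (W.tp k')" "\<psi> w \<in> carrier W.T" if "w \<in> V.W" "length w = k" for w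
    using V.multilinD(1)[OF q that] W.tp_T by auto
  note pD = V.multilinD(2,3)[OF p, simplified] and qD = V.multilinD(2,3)[OF q, simplified]
  have split: "(length u < j \<and> (\<forall>e. take j (u @ e # v) = u @ e # take (j - length u - 1) v \<and>
       drop j (u @ e # v) = drop (j - length u - 1) v)) \<or>
     (\<not> length u < j \<and> (\<forall>e. take j (u @ e # v) = take j u \<and> drop j (u @ e # v) = drop j u @ e # v))"
    for u v :: "'v list"
    by (cases "length u < j") (auto simp: take_Cons' drop_Cons')
  show ?thesis
  proof (rule V.multilinI)
    fix w assume "w \<in> V.W" "length w = j + k"
    then show "\<phi> (take j w) \<otimes>\<^bsub>W.T\<^esub> \<psi> (drop j w) \<in> carrier (W.tp (j' + k'))"
      by (intro W.tp_mult pc qc tk) auto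
  next
    fix u v a assume uv: "u \<in> V.W" "v \<in> V.W" "Suc (length u + length v) = j + k" and a: "a \<in> carrier V"
    let ?f = "\<lambda>w. \<phi> (take j w) \<otimes>\<^bsub>W.T\<^esub> \<psi> (drop j w)"
    have ea: "u @ e # v \<in> V.W" if "e \<in> carrier V" for e using that uv by simp
    have pe: "\<phi> (take j (u @ e # v)) \<in> carrier W.T" "\<psi> (drop j (u @ e # v)) \<in> carrier W.T" if "e \<in> carrier V" for e
      by (rule pc(2)[OF tk(1)[OF ea[OF that]]], use uv(3) in simp)
         (rule qc(2)[OF tk(2)[OF ea[OF that]]], use uv(3) in simp)
    consider "length u < j" | "\<not> length u < j" by blast
    then show "?f (u @ (a \<oplus>\<^bsub>V\<^esub> b) # v) = ?f (u @ a # v) \<oplus>\<^bsub>W.tp (j' + k')\<^esub> ?f (u @ b # v)"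
      if b: "b \<in> carrier V" for b
    proof cases
      case 1
      then have s: "take j (u @ e # v) = u @ e # take (j - length u - 1) v"
        "drop j (u @ e # v) = drop (j - length u - 1) v" for e using split[of u v] by auto
      show ?thesis using pe[OF a] pe[OF b] unfolding s
        by (subst pD(1)) (use 1 uv a b in \<open>auto simp: T.l_distr dest: in_set_takeD\<close>)
    next
      case 2
      then have s: "take j (u @ e # v) = take j u" "drop j (u @ e # v) = drop j u @ e # v" for e
        using split[of u v] by auto
      show ?thesis using pe[OF a] pe[OF b] unfolding s
        by (subst qD(1)) (use 2 uv a b in \<open>auto simp: T.r_distr dest: in_set_dropD\<close>)
    qed
    consider "length u < j" | "\<not> length u < j" by blast
    then show "?f (u @ (c \<odot>\<^bsub>V\<^esub> a) # v) = c \<odot>\<^bsub>W.tp (j' + k')\<^esub> ?f (u @ a # v)"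
      if c: "c \<in> carrier K" for c
    proof cases
      case 1
      then have s: "take j (u @ e # v) = u @ e # take (j - length u - 1) v"
        "drop j (u @ e # v) = drop (j - length u - 1) v" for e using split[of u v] by auto
      show ?thesis using pe[OF a] unfolding s
        by (subst pD(2)) (use 1 uv a c in \<open>auto simp: W.T_smult_mult dest: in_set_takeD\<close>)
    next
      case 2
      then have s: "take j (u @ e # v) = take j u" "drop j (u @ e # v) = drop j u @ e # v" for e
        using split[of u v] by auto
      show ?thesis using pe[OF a] unfolding s
        by (subst qD(2)) (use 2 uv a c in \<open>auto simp: W.T_smult_mult dest: in_set_dropD\<close>)
    qed
  qed
qed

lemma multilin_tp_T:
  assumes "V.multilin (W.tp m) n \<phi>" shows "V.multilin W.T n \<phi>"
  using V.multilin_comp[OF assms, of W.T "\<lambda>x. x"] by (simp add: linear_map_def W.tp_T Pi_iff)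

text \<open>The terms of other degrees that \<open>lin_ext\<close> drops are those to which the
  extension by zero gives the value zero. Independence of the representative is thereby inherited
  from \<open>lift\<close>.\<close>

lemma lin_ext_lift:
  assumes p: "V.multilin W.T n \<phi>" and X: "X \<in> carrier V.T"
  shows "lin_ext K V W n \<phi> X = V.lift W.T (\<lambda>w. if length w = n then \<phi> w else \<zero>\<^bsub>W.T\<^esub>) X"
proof -
  interpret T: module K W.T by (rule W.T_module)
  interpret I: ideal V.J V.F by (rule V.J_ideal)
  obtain x where x: "x \<in> carrier V.F" "X = V.cl x" using X by (rule V.T_cases)
  have "(SOME y. y \<in> X) \<in> X" unfolding x(2) by (rule someI[of _ x]) (simp add: I.a_rcos_self x)
  then have y: "(SOME y. y \<in> X) \<in> carrier V.F" unfolding x(2)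
    using I.a_r_coset_subset_G[OF I.a_subset x(1)] by blast
  define y where "y = (SOME y. y \<in> X)"
  have yF: "y \<in> carrier V.F" using y by (simp add: y_def)
  have fin: "finite {w. y w \<noteq> \<zero>\<^bsub>K\<^esub>}" and sub: "{w. y w \<noteq> \<zero>\<^bsub>K\<^esub>} \<subseteq> V.W" using yF by (auto simp: V.carrier_F_iff)
  have cl: "\<phi> w \<in> carrier W.T" if "y w \<noteq> \<zero>\<^bsub>K\<^esub>" "length w = n" for w
    using V.multilinD(1)[OF p] that sub by blast
  show ?thesis
    unfolding lin_ext_def V.lift_def V.linsum_def Let_def y_def[symmetric]
    by (rule T.add.finprod_mono_neutral_cong_left)
       (use fin cl yF in \<open>auto simp del: V.free_algebra_sel\<close>)
qed

text \<open>Pure tensors of length \<open>n\<close> span the source, so the degree of the values has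
  to be checked on them only.\<close>

lemma codomain_restrict:
  assumes f: "linear_map K (V.tp n) W.T f"
    and v: "\<And>w. w \<in> V.W \<Longrightarrow> length w = n \<Longrightarrow> f (V.pt w) \<in> carrier (W.tp m)"
  shows "linear_map K (V.tp n) (W.tp m) f"
proof -
  have "f X \<in> carrier (W.tp m)" if "X \<in> carrier (V.tp n)" for X
    using that
  proof (induction rule: V.tp_induct)
    case zero
    show ?case using linear_map_zero[OF V.tp_module W.T_module f] by (simp add: W.tp_zero)
  next
    case (add X Y)
    then show ?case using linear_mapD(2)[OF f, of X Y] by (simp add: W.tp_add)
  next
    case (pt a w)
    then show ?case using linear_mapD(3)[OF f, of a "V.pt w"] by (simp add: W.tp_smult v V.pt_tp)
  qed
  then show ?thesis using f unfolding linear_map_def by simp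
qed

lemma lin_ext_pt:
  assumes p: "V.multilin W.T n \<phi>" and w: "w \<in> V.W" "length w = n"
  shows "lin_ext K V W n \<phi> (V.pt w) = \<phi> w"
  using V.lift_pt[OF W.T_module V.multilin_multilinear[OF W.T_module p] w(1)] w(2)
  by (simp add: lin_ext_lift[OF p V.pt_T[OF w(1)]])

lemma linear_lin_ext:
  assumes p: "V.multilin (W.tp m) n \<phi>"
  shows "linear_map K (V.tp n) (W.tp m) (lin_ext K V W n \<phi>)"
proof (rule codomain_restrict)
  note q = multilin_tp_T[OF p]
  note lin = linear_mapD[OF V.lift_linear[OF W.T_module V.multilin_multilinear[OF W.T_module q]]]
  interpret T: module K V.T by (rule V.T_module)
  show "linear_map K (V.tp n) W.T (lin_ext K V W n \<phi>)"
    by (rule linear_mapI) (simp_all add: lin_ext_lift[OF q] V.tp_T lin)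
  show "lin_ext K V W n \<phi> (V.pt w) \<in> carrier (W.tp m)" if "w \<in> V.W" "length w = n" for w
    using V.multilinD(1)[OF p] that by (simp add: lin_ext_pt[OF q])
qed

lemma tens_multilin:
  assumes f: "linear_map K (V.tp j) (W.tp j') f" and g: "linear_map K (V.tp k) (W.tp k') g"
  shows "V.multilin (W.tp (j' + k')) (j + k) (\<lambda>w. f (V.pt (take j w)) \<otimes>\<^bsub>W.T\<^esub> g (V.pt (drop j w)))"
  by (rule multilin_mult[OF V.multilin_comp[OF V.multilin_pt f] V.multilin_comp[OF V.multilin_pt g]])

lemma linear_tens:
  assumes f: "linear_map K (V.tp j) (W.tp j') f" and g: "linear_map K (V.tp k) (W.tp k') g"
  shows "linear_map K (V.tp (j + k)) (W.tp (j' + k')) (tens K V W j k f g)"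
  unfolding tens_def by (rule linear_lin_ext[OF tens_multilin[OF f g]])

lemma tens_pt:
  assumes f: "linear_map K (V.tp j) (W.tp j') f" and g: "linear_map K (V.tp k) (W.tp k') g"
    and "u \<in> V.W" "length u = j" "v \<in> V.W" "length v = k"
  shows "tens K V W j k f g (V.pt (u @ v)) = f (V.pt u) \<otimes>\<^bsub>W.T\<^esub> g (V.pt v)"
  unfolding tens_def using assms(3-)
  by (subst lin_ext_pt[OF multilin_tp_T[OF tens_multilin[OF f g]]]) auto

text \<open>For \<open>s\<close> pure, linearity in \<open>t\<close> passes from pure to arbitrary
  \<open>t\<close>; linearity in \<open>s\<close> then gives the rest.\<close>

lemma tens_mult:
  assumes f: "linear_map K (V.tp j) (W.tp j') f" and g: "linear_map K (V.tp k) (W.tp k') g"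
    and s: "s \<in> carrier (V.tp j)" and t: "t \<in> carrier (V.tp k)"
  shows "tens K V W j k f g (s \<otimes>\<^bsub>V.T\<^esub> t) = f s \<otimes>\<^bsub>W.T\<^esub> g t"
proof -
  have 1: "tens K V W j k f g (V.pt u \<otimes>\<^bsub>V.T\<^esub> t) = f (V.pt u) \<otimes>\<^bsub>W.T\<^esub> g t"
    if u: "u \<in> V.W" "length u = j" for u
    by (rule V.tp_linear_eqI[OF W.tp_module _ _ _ t,
          OF linear_map_comp[OF V.mult_left_linear[OF V.pt_tp[OF u]] linear_tens[OF f g]]
             linear_map_comp[OF g W.mult_left_linear[OF linear_mapD(1)[OF f V.pt_tp[OF u]]]]])
       (simp only: V.pt_mult u tens_pt[OF f g])
  show ?thesis
    by (rule V.tp_linear_eqI[OF W.tp_module _ _ _ s,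
          OF linear_map_comp[OF V.mult_right_linear[OF t] linear_tens[OF f g]]
             linear_map_comp[OF f W.mult_right_linear[OF linear_mapD(1)[OF g t]]]])
       (rule 1)
qed

lemma tens_map_multilin:
  assumes f: "linear_map K V W f"
  shows "V.multilin (W.tp n) n (\<lambda>w. W.pt (map f w))"
proof (rule V.multilinI)
  note D = linear_mapD[OF f]
  have m: "map f w \<in> W.W" if "w \<in> V.W" for w using that D(1) by auto
  note pD = W.multilinD[OF W.multilin_pt, simplified W.tp_sel]
  show "W.pt (map f w) \<in> carrier (W.tp n)" if "w \<in> V.W" "length w = n" for w
    using that by (intro pD(1) m) auto
  fix u v a assume uv: "u \<in> V.W" "v \<in> V.W" "Suc (length u + length v) = n" and a: "a \<in> carrier V"
  then have l: "Suc (length (map f u) + length (map f v)) = n" by simp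
  show "W.pt (map f (u @ (a \<oplus>\<^bsub>V\<^esub> b) # v)) = W.pt (map f (u @ a # v)) \<oplus>\<^bsub>W.tp n\<^esub> W.pt (map f (u @ b # v))"
    if b: "b \<in> carrier V" for b
    using pD(2)[OF m m l D(1)[OF a] D(1)[OF b]] uv by (simp only: map_append list.map D(2)[OF a b] W.tp_sel)
  show "W.pt (map f (u @ (k \<odot>\<^bsub>V\<^esub> a) # v)) = k \<odot>\<^bsub>W.tp n\<^esub> W.pt (map f (u @ a # v))"
    if k: "k \<in> carrier K" for k
    using pD(3)[OF m m l D(1)[OF a] k] uv by (simp only: map_append list.map D(3)[OF k a] W.tp_sel)
qed

lemma linear_tens_map:
  assumes f: "linear_map K V W f"
  shows "linear_map K (V.tp n) (W.tp n) (tens_map K V W n f)"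
  unfolding tens_map_def by (rule linear_lin_ext[OF tens_map_multilin[OF f]])

lemma tens_map_pt:
  assumes f: "linear_map K V W f" and "w \<in> V.W" "length w = n"
  shows "tens_map K V W n f (V.pt w) = W.pt (map f w)"
  unfolding tens_map_def by (rule lin_ext_pt[OF multilin_tp_T[OF tens_map_multilin[OF f]] assms(2,3)])

lemma tens_map_mult:
  assumes f: "linear_map K V W f"
    and s: "s \<in> carrier (V.tp j)" and t: "t \<in> carrier (V.tp k)"
  shows "tens_map K V W (j + k) f (s \<otimes>\<^bsub>V.T\<^esub> t) = tens_map K V W j f s \<otimes>\<^bsub>W.T\<^esub> tens_map K V W k f t"
proof -
  note L = linear_tens_map[OF f]
  have mW: "map f u \<in> W.W" if "u \<in> V.W" for u using that linear_mapD(1)[OF f] by auto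
  have 1: "tens_map K V W (j + k) f (V.pt u \<otimes>\<^bsub>V.T\<^esub> t) = tens_map K V W j f (V.pt u) \<otimes>\<^bsub>W.T\<^esub> tens_map K V W k f t"
    if u: "u \<in> V.W" "length u = j" for u
    by (rule V.tp_linear_eqI[OF W.tp_module _ _ _ t,
          OF linear_map_comp[OF V.mult_left_linear[OF V.pt_tp[OF u]] L]
             linear_map_comp[OF L W.mult_left_linear[OF linear_mapD(1)[OF L V.pt_tp[OF u]]]]])
       (simp add: V.pt_mult u tens_map_pt[OF f] W.pt_mult[OF mW mW] del: in_lists_conv_set)
  show ?thesis
    by (rule V.tp_linear_eqI[OF W.tp_module _ _ _ s,
          OF linear_map_comp[OF V.mult_right_linear[OF t] L]
             linear_map_comp[OF L W.mult_right_linear[OF linear_mapD(1)[OF L t]]]])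
       (rule 1)
qed

end

text \<open>The means of carrying tensor powers of \<open>G\<close> through composites of structure
  maps: once two maps commute with \<open>G\<close>, so does their tensor product, and larger
  composites follow by iteration.\<close>

lemma tens_natural:
  assumes "linear_space_pair K V W" and G: "linear_map K V W G"
    and a: "linear_map K (tensor_power K V j) (tensor_power K V j') a"
    and b: "linear_map K (tensor_power K V k) (tensor_power K V k') b"
    and a': "linear_map K (tensor_power K W j) (tensor_power K W j') a'"
    and b': "linear_map K (tensor_power K W k) (tensor_power K W k') b'"
    and A: "\<And>s. s \<in> carrier (tensor_power K V j) \<Longrightarrow>
      tens_map K V W j' G (a s) = a' (tens_map K V W j G s)"
    and B: "\<And>s. s \<in> carrier (tensor_power K V k) \<Longrightarrow>
      tens_map K V W k' G (b s) = b' (tens_map K V W k G s)"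
    and t: "t \<in> carrier (tensor_power K V (j + k))"
  shows "tens_map K V W (j' + k') G (tens K V V j k a b t) =
    tens K W W j k a' b' (tens_map K V W (j + k) G t)"
proof -
  interpret linear_space_pair K V W by fact
  interpret VV: linear_space_pair K V V ..
  interpret WW: linear_space_pair K W W ..
  note L = linear_tens_map[OF G]
  show ?thesis
  proof (rule V.tp_linear_eqI[OF W.tp_module _ _ _ t,
          OF linear_map_comp[OF VV.linear_tens[OF a b] L]
             linear_map_comp[OF L WW.linear_tens[OF a' b']]])
    fix w assume w: "w \<in> V.W" "length w = j + k"
    define u v where "u = take j w" and "v = drop j w"
    have uv: "u \<in> V.W" "v \<in> V.W" "length u = j" "length v = k" and e: "w = u @ v"
      using w by (auto simp: u_def v_def dest: in_set_takeD in_set_dropD)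
    note up = V.pt_tp[OF uv(1,3)] and vp = V.pt_tp[OF uv(2,4)]
    have m: "V.pt w = V.pt u \<otimes>\<^bsub>V.T\<^esub> V.pt v" by (simp add: e V.pt_mult uv del: in_lists_conv_set)
    show "tens_map K V W (j' + k') G (tens K V V j k a b (V.pt w)) =
      tens K W W j k a' b' (tens_map K V W (j + k) G (V.pt w))"
      unfolding m VV.tens_mult[OF a b up vp] tens_map_mult[OF G up vp]
        tens_map_mult[OF G linear_mapD(1)[OF a up] linear_mapD(1)[OF b vp]]
        WW.tens_mult[OF a' b' linear_mapD(1)[OF L up] linear_mapD(1)[OF L vp]] A[OF up] B[OF vp] ..
  qed
qed

section \<open>Complements and generalised inverses over a field\<close>

definition subspace :: "'k ring \<Rightarrow> ('k, 'v, 'm) module_scheme \<Rightarrow> 'v set \<Rightarrow> bool" where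
  "subspace K V S \<longleftrightarrow> S \<subseteq> carrier V \<and> \<zero>\<^bsub>V\<^esub> \<in> S \<and> (\<forall>x\<in>S. \<forall>y\<in>S. x \<oplus>\<^bsub>V\<^esub> y \<in> S) \<and>
     (\<forall>a\<in>carrier K. \<forall>x\<in>S. a \<odot>\<^bsub>V\<^esub> x \<in> S)"

context linear_space
begin

lemma subspace_minus:
  assumes "subspace K V S" "x \<in> S" "y \<in> S" shows "x \<ominus>\<^bsub>V\<^esub> y \<in> S"
proof -
  have "y \<in> carrier V" using assms by (auto simp: subspace_def)
  then show ?thesis using assms unfolding subspace_def a_minus_def
    by (simp add: uminus_smult)
qed

text \<open>Zorn's lemma for the subspaces that meet \<open>N\<close> in zero only. A maximal one is
  a complement, since otherwise it could be enlarged by one more vector.\<close>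

lemma ex_complement:
  assumes K: "field K" and N: "subspace K V N"
  obtains C where "subspace K V C" "C \<inter> N = {\<zero>\<^bsub>V\<^esub>}" "\<And>x. x \<in> carrier V \<Longrightarrow> \<exists>n\<in>N. \<exists>c\<in>C. x = n \<oplus>\<^bsub>V\<^esub> c"
proof -
  interpret K: field K by fact
  define A where "A = {C. subspace K V C \<and> C \<inter> N = {\<zero>\<^bsub>V\<^esub>}}"
  have NV: "N \<subseteq> carrier V" and N0: "\<zero>\<^bsub>V\<^esub> \<in> N" using N by (auto simp: subspace_def)
  have "{\<zero>\<^bsub>V\<^esub>} \<in> A" using N0 by (auto simp: A_def subspace_def)
  then have "A \<noteq> {}" by blast
  moreover have "\<Union>Ch \<in> A" if ne: "Ch \<noteq> {}" and ch: "subset.chain A Ch" for Ch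
  proof -
    have sub: "C \<in> A" if "C \<in> Ch" for C using ch that by (auto simp: subset_chain_def)
    have add: "x \<oplus>\<^bsub>V\<^esub> y \<in> \<Union>Ch" if x: "x \<in> \<Union>Ch" and y: "y \<in> \<Union>Ch" for x y
    proof -
      obtain C D where "C \<in> Ch" "x \<in> C" "D \<in> Ch" "y \<in> D" using x y by blast
      moreover then have "C \<subseteq> D \<or> D \<subseteq> C" using ch by (auto simp: subset_chain_def)
      ultimately obtain E where "E \<in> Ch" "x \<in> E" "y \<in> E" by blast
      then show ?thesis using sub[of E] by (auto simp: A_def subspace_def)
    qed
    obtain C0 where "C0 \<in> Ch" using ne by blast
    then have "\<zero>\<^bsub>V\<^esub> \<in> \<Union>Ch" using sub[of C0] by (auto simp: A_def subspace_def)
    then have "subspace K V (\<Union>Ch)"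
      using add sub unfolding subspace_def A_def by blast
    moreover have "\<Union>Ch \<inter> N = {\<zero>\<^bsub>V\<^esub>}" using sub \<open>\<zero>\<^bsub>V\<^esub> \<in> \<Union>Ch\<close> N0 by (auto simp: A_def)
    ultimately show ?thesis by (simp add: A_def)
  qed
  ultimately obtain C where "C \<in> A" and max: "\<And>X. X \<in> A \<Longrightarrow> C \<subseteq> X \<Longrightarrow> X = C"
    using subset_Zorn_nonempty[of A] by blast
  then have C: "subspace K V C" and CN: "C \<inter> N = {\<zero>\<^bsub>V\<^esub>}" by (auto simp: A_def)
  have CV: "C \<subseteq> carrier V" and C0: "\<zero>\<^bsub>V\<^esub> \<in> C" using C by (auto simp: subspace_def)
  have "\<exists>n\<in>N. \<exists>c\<in>C. x = n \<oplus>\<^bsub>V\<^esub> c" if x: "x \<in> carrier V" for x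
  proof (rule ccontr)
    assume no: "\<not> ?thesis"
    \<comment> \<open>\<open>D\<close> is the span of \<open>C\<close> and \<open>x\<close>. If
      \<open>x\<close> is not a sum of the required form, \<open>D\<close> still meets
      \<open>N\<close> trivially and contradicts maximality.\<close>
    define D where "D = {c \<oplus>\<^bsub>V\<^esub> a \<odot>\<^bsub>V\<^esub> x | c a. c \<in> C \<and> a \<in> carrier K}"
    have DI: "c \<oplus>\<^bsub>V\<^esub> a \<odot>\<^bsub>V\<^esub> x \<in> D" if "c \<in> C" "a \<in> carrier K" for c a using that by (auto simp: D_def)
    have CD: "C \<subseteq> D"
    proof
      fix c assume c: "c \<in> C"
      then have "c = c \<oplus>\<^bsub>V\<^esub> \<zero>\<^bsub>K\<^esub> \<odot>\<^bsub>V\<^esub> x" using x CV by (simp add: subset_iff)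
      then show "c \<in> D" using DI[OF c R.zero_closed] by simp
    qed
    have "subspace K V D" unfolding subspace_def
    proof (intro conjI ballI)
      show "D \<subseteq> carrier V" using CV x by (auto simp: D_def)
      show "\<zero>\<^bsub>V\<^esub> \<in> D" using CD C0 by blast
      fix y assume "y \<in> D"
      then obtain c a where y: "c \<in> C" "a \<in> carrier K" "y = c \<oplus>\<^bsub>V\<^esub> a \<odot>\<^bsub>V\<^esub> x" by (auto simp: D_def)
      show "k \<odot>\<^bsub>V\<^esub> y \<in> D" if k: "k \<in> carrier K" for k
      proof -
        have "k \<odot>\<^bsub>V\<^esub> y = k \<odot>\<^bsub>V\<^esub> c \<oplus>\<^bsub>V\<^esub> (k \<otimes>\<^bsub>K\<^esub> a) \<odot>\<^bsub>V\<^esub> x"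
          using y x k CV by (simp add: subset_iff smult_r_distr smult_assoc1)
        then show ?thesis using y k C by (auto simp: subspace_def intro!: DI)
      qed
      fix z assume "z \<in> D"
      then obtain d b where z: "d \<in> C" "b \<in> carrier K" "z = d \<oplus>\<^bsub>V\<^esub> b \<odot>\<^bsub>V\<^esub> x" by (auto simp: D_def)
      have "y \<oplus>\<^bsub>V\<^esub> z = (c \<oplus>\<^bsub>V\<^esub> d) \<oplus>\<^bsub>V\<^esub> (a \<oplus>\<^bsub>K\<^esub> b) \<odot>\<^bsub>V\<^esub> x"
        using y z x CV by (simp add: subset_iff smult_l_distr M.add.m_ac)
      then show "y \<oplus>\<^bsub>V\<^esub> z \<in> D" using y z C by (auto simp: subspace_def intro!: DI)
    qed
    moreover have "y = \<zero>\<^bsub>V\<^esub>" if y: "y \<in> D" "y \<in> N" for y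
    proof -
      obtain c a where ca: "c \<in> C" "a \<in> carrier K" "y = c \<oplus>\<^bsub>V\<^esub> a \<odot>\<^bsub>V\<^esub> x" using y by (auto simp: D_def)
      \<comment> \<open>Dividing by a nonzero \<open>a\<close> would write \<open>x\<close> as a sum
        from \<open>N\<close> and \<open>C\<close>. This is where the field property enters.\<close>
      have a0: "a = \<zero>\<^bsub>K\<^esub>"
      proof (rule ccontr)
        assume "a \<noteq> \<zero>\<^bsub>K\<^esub>"
        then have u: "inv\<^bsub>K\<^esub> a \<in> carrier K" "inv\<^bsub>K\<^esub> a \<otimes>\<^bsub>K\<^esub> a = \<one>\<^bsub>K\<^esub>"
          using ca(2) K.field_Units by auto
        have cV: "c \<in> carrier V" using ca CV by blast
        have "x = inv\<^bsub>K\<^esub> a \<odot>\<^bsub>V\<^esub> (a \<odot>\<^bsub>V\<^esub> x)" using u ca(2) x by (simp add: smult_assoc1[symmetric])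
        also have "a \<odot>\<^bsub>V\<^esub> x = y \<oplus>\<^bsub>V\<^esub> (\<ominus>\<^bsub>K\<^esub> \<one>\<^bsub>K\<^esub>) \<odot>\<^bsub>V\<^esub> c"
          unfolding ca(3) using ca(2) x cV
          by (simp add: uminus_smult[symmetric] M.add.m_comm[of c] M.add.m_assoc M.r_neg)
        finally have "x = inv\<^bsub>K\<^esub> a \<odot>\<^bsub>V\<^esub> y \<oplus>\<^bsub>V\<^esub> inv\<^bsub>K\<^esub> a \<odot>\<^bsub>V\<^esub> ((\<ominus>\<^bsub>K\<^esub> \<one>\<^bsub>K\<^esub>) \<odot>\<^bsub>V\<^esub> c)"
          using u y NV cV by (simp add: subset_iff smult_r_distr)
        moreover have "inv\<^bsub>K\<^esub> a \<odot>\<^bsub>V\<^esub> y \<in> N" "inv\<^bsub>K\<^esub> a \<odot>\<^bsub>V\<^esub> ((\<ominus>\<^bsub>K\<^esub> \<one>\<^bsub>K\<^esub>) \<odot>\<^bsub>V\<^esub> c) \<in> C"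
          using u y ca N C by (auto simp: subspace_def)
        ultimately show False using no by blast
      qed
      then have "y = c" using ca x CV by (auto simp: subset_iff)
      then show ?thesis using ca y CN by blast
    qed
    ultimately have "D \<in> A" using N0 C0 CD by (auto simp: A_def)
    then have "D = C" using max CD by blast
    moreover have "\<zero>\<^bsub>V\<^esub> \<oplus>\<^bsub>V\<^esub> \<one>\<^bsub>K\<^esub> \<odot>\<^bsub>V\<^esub> x \<in> D" by (rule DI) (use C0 in auto)
    ultimately have "x \<in> C" using x by simp
    then have "x = \<zero>\<^bsub>V\<^esub> \<oplus>\<^bsub>V\<^esub> x" using x by simp
    then show False using no N0 \<open>x \<in> C\<close> by blast
  qed
  then show thesis using that C CN by blast
qed

text \<open>The component in \<open>N\<close> along a complement. It is determined, and hence
  linear, because two decompositions of a vector differ by an element common to both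
  subspaces.\<close>

lemma ex_projection:
  assumes K: "field K" and N: "subspace K V N"
  obtains q where "linear_map K V V q" "\<And>x. x \<in> carrier V \<Longrightarrow> q x \<in> N" "\<And>x. x \<in> N \<Longrightarrow> q x = x"
proof -
  obtain C where C: "subspace K V C" and CN: "C \<inter> N = {\<zero>\<^bsub>V\<^esub>}"
    and ex: "\<And>x. x \<in> carrier V \<Longrightarrow> \<exists>n\<in>N. \<exists>c\<in>C. x = n \<oplus>\<^bsub>V\<^esub> c"
    using ex_complement[OF K N] by blast
  have NV: "N \<subseteq> carrier V" and CV: "C \<subseteq> carrier V" using N C by (auto simp: subspace_def)
  define q where "q x = (SOME n. n \<in> N \<and> (\<exists>c\<in>C. x = n \<oplus>\<^bsub>V\<^esub> c))" for x
  have qN: "q x \<in> N" "\<exists>c\<in>C. x = q x \<oplus>\<^bsub>V\<^esub> c" if "x \<in> carrier V" for x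
    using someI_ex[of "\<lambda>n. n \<in> N \<and> (\<exists>c\<in>C. x = n \<oplus>\<^bsub>V\<^esub> c)"] ex[OF that] unfolding q_def by blast+
  have qeq: "q (n \<oplus>\<^bsub>V\<^esub> c) = n" if n: "n \<in> N" and c: "c \<in> C" for n c
  proof -
    have nc: "n \<in> carrier V" "c \<in> carrier V" using n c NV CV by auto
    obtain d where d: "d \<in> C" "n \<oplus>\<^bsub>V\<^esub> c = q (n \<oplus>\<^bsub>V\<^esub> c) \<oplus>\<^bsub>V\<^esub> d" using qN(2)[of "n \<oplus>\<^bsub>V\<^esub> c"] nc by auto
    let ?m = "q (n \<oplus>\<^bsub>V\<^esub> c)"
    have m: "?m \<in> N" using qN(1) nc by simp
    have md: "?m \<in> carrier V" "d \<in> carrier V" using m d NV CV by auto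
    have "n \<ominus>\<^bsub>V\<^esub> ?m = (n \<oplus>\<^bsub>V\<^esub> c) \<ominus>\<^bsub>V\<^esub> c \<ominus>\<^bsub>V\<^esub> ?m"
      using nc md by (simp add: a_minus_def M.add.m_assoc M.r_neg)
    also have "\<dots> = (?m \<oplus>\<^bsub>V\<^esub> d) \<ominus>\<^bsub>V\<^esub> c \<ominus>\<^bsub>V\<^esub> ?m" using d(2) by simp
    also have "\<dots> = d \<ominus>\<^bsub>V\<^esub> c"
      using nc md by (simp add: a_minus_def M.add.m_ac M.r_neg2 M.r_neg)
    finally have "n \<ominus>\<^bsub>V\<^esub> ?m \<in> C \<inter> N"
      using subspace_minus[OF C d(1) c] subspace_minus[OF N n m] by auto
    then have "n \<ominus>\<^bsub>V\<^esub> ?m = \<zero>\<^bsub>V\<^esub>" using CN by blast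
    moreover have "n = (n \<ominus>\<^bsub>V\<^esub> ?m) \<oplus>\<^bsub>V\<^esub> ?m" using nc md by (simp add: a_minus_def M.add.m_assoc M.l_neg)
    ultimately show ?thesis using md by simp
  qed
  show thesis
  proof
    show "q x \<in> N" if "x \<in> carrier V" for x by (rule qN[OF that])
    show "q x = x" if "x \<in> N" for x
      using qeq[OF that, of "\<zero>\<^bsub>V\<^esub>"] that NV C by (auto simp: subspace_def subset_iff)
    show "linear_map K V V q"
    proof (rule linear_mapI)
      fix x assume x: "x \<in> carrier V"
      then show "q x \<in> carrier V" using qN(1) NV by blast
      obtain c where c: "c \<in> C" "x = q x \<oplus>\<^bsub>V\<^esub> c" using qN(2)[OF x] by blast
      have cV: "c \<in> carrier V" "q x \<in> carrier V" using c qN(1)[OF x] CV NV by auto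
      show "q (a \<odot>\<^bsub>V\<^esub> x) = a \<odot>\<^bsub>V\<^esub> q x" if a: "a \<in> carrier K" for a
      proof -
        have "a \<odot>\<^bsub>V\<^esub> x = a \<odot>\<^bsub>V\<^esub> q x \<oplus>\<^bsub>V\<^esub> a \<odot>\<^bsub>V\<^esub> c"
          using smult_r_distr[OF a cV(2,1)] c(2) by simp
        then show ?thesis using qeq[of "a \<odot>\<^bsub>V\<^esub> q x" "a \<odot>\<^bsub>V\<^esub> c"] N C a c(1) qN(1)[OF x] by (simp add: subspace_def)
      qed
      fix y assume y: "y \<in> carrier V"
      obtain d where d: "d \<in> C" "y = q y \<oplus>\<^bsub>V\<^esub> d" using qN(2)[OF y] by blast
      have dV: "d \<in> carrier V" "q y \<in> carrier V" using d qN(1)[OF y] CV NV by auto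
      have "x \<oplus>\<^bsub>V\<^esub> y = (q x \<oplus>\<^bsub>V\<^esub> c) \<oplus>\<^bsub>V\<^esub> (q y \<oplus>\<^bsub>V\<^esub> d)" using c(2) d(2) by simp
      also have "\<dots> = (q x \<oplus>\<^bsub>V\<^esub> q y) \<oplus>\<^bsub>V\<^esub> (c \<oplus>\<^bsub>V\<^esub> d)" using cV dV by (simp add: M.add.m_ac)
      finally show "q (x \<oplus>\<^bsub>V\<^esub> y) = q x \<oplus>\<^bsub>V\<^esub> q y"
        using qeq[of "q x \<oplus>\<^bsub>V\<^esub> q y" "c \<oplus>\<^bsub>V\<^esub> d"] N C c(1) d(1) qN(1)[OF x] qN(1)[OF y] by (simp add: subspace_def)
    qed
  qed
qed

end

text \<open>A vector is projected to the image of \<open>d\<close>, pulled back to any preimage, and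
  the kernel component of that preimage is removed. The last operation makes the arbitrary choice
  harmless and so \<open>s\<close> linear.\<close>

lemma ex_generalized_inverse:
  assumes K: "field K" and "linear_space_pair K V W" and d: "linear_map K V W d"
  obtains s where "linear_map K W V s" "\<And>x. x \<in> carrier V \<Longrightarrow> d (s (d x)) = d x"
proof -
  interpret linear_space_pair K V W by fact
  have Vm: "module K V" and Wm: "module K W" by unfold_locales
  note D = linear_mapD[OF d] and D0 = linear_map_zero[OF Vm Wm d]
  have "subspace K V {x \<in> carrier V. d x = \<zero>\<^bsub>W\<^esub>}"
    by (auto simp: subspace_def D D0)
  from V.ex_projection[OF K this] obtain p where p0: "linear_map K V V p"
    "\<And>x. x \<in> carrier V \<Longrightarrow> p x \<in> {x \<in> carrier V. d x = \<zero>\<^bsub>W\<^esub>}"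
    "\<And>x. x \<in> {x \<in> carrier V. d x = \<zero>\<^bsub>W\<^esub>} \<Longrightarrow> p x = x" by blast
  then have p: "linear_map K V V p"
    "\<And>x. x \<in> carrier V \<Longrightarrow> d (p x) = \<zero>\<^bsub>W\<^esub>"
    "\<And>x. x \<in> carrier V \<Longrightarrow> d x = \<zero>\<^bsub>W\<^esub> \<Longrightarrow> p x = x" by simp_all
  have "subspace K W (d ` carrier V)"
    unfolding subspace_def
  proof (intro conjI ballI)
    show "d ` carrier V \<subseteq> carrier W" using D(1) by blast
    show "\<zero>\<^bsub>W\<^esub> \<in> d ` carrier V" using D0 V.M.zero_closed by (metis image_eqI)
    show "x \<oplus>\<^bsub>W\<^esub> y \<in> d ` carrier V" if "x \<in> d ` carrier V" "y \<in> d ` carrier V" for x y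
      using that D(2) V.M.add.m_closed by (metis (no_types, lifting) image_iff)
    show "a \<odot>\<^bsub>W\<^esub> x \<in> d ` carrier V" if "a \<in> carrier K" "x \<in> d ` carrier V" for a x
      using that D(3) V.smult_closed by (metis (no_types, lifting) image_iff)
  qed
  from W.ex_projection[OF K this] obtain q where q0: "linear_map K W W q"
    "\<And>x. x \<in> carrier W \<Longrightarrow> q x \<in> d ` carrier V"
    "\<And>x. x \<in> d ` carrier V \<Longrightarrow> q x = x" by blast
  have q: "linear_map K W W q"
    "\<And>x. x \<in> carrier W \<Longrightarrow> \<exists>v\<in>carrier V. d v = q x"
    "\<And>x. x \<in> carrier V \<Longrightarrow> q (d x) = d x" using q0(1) q0(2) q0(3) by (blast, metis imageE, blast)
  note P = linear_mapD[OF p(1)] and Q = linear_mapD[OF q(1)]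
  define g where "g w = (SOME v. v \<in> carrier V \<and> d v = q w)" for w
  have g: "g w \<in> carrier V" "d (g w) = q w" if "w \<in> carrier W" for w
    using someI_ex[of "\<lambda>v. v \<in> carrier V \<and> d v = q w"] q(2)[OF that] unfolding g_def by blast+
  define s where "s w = g w \<ominus>\<^bsub>V\<^esub> p (g w)" for w
  \<comment> \<open>Two preimages of the same vector differ by an element of the kernel, which
    \<open>id - p\<close> sends to zero; hence \<open>s w\<close> can be computed from any preimage
    \<open>v\<close>.\<close>
  have s: "s w = v \<ominus>\<^bsub>V\<^esub> p v" if w: "w \<in> carrier W" and v: "v \<in> carrier V" "d v = q w" for w v
  proof -
    have cancel: "x \<oplus>\<^bsub>V\<^esub> (y \<oplus>\<^bsub>V\<^esub> \<ominus>\<^bsub>V\<^esub> x) = y" if "x \<in> carrier V" "y \<in> carrier V" for x y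
      using that by (simp add: V.M.add.m_comm[of y] V.M.r_neg2)
    let ?u = "g w"
    have u: "?u \<in> carrier V" "d ?u = q w" using g w by auto
    have "d (?u \<ominus>\<^bsub>V\<^esub> v) = \<zero>\<^bsub>W\<^esub>"
      using linear_map_minus[OF Vm Wm d u(1) v(1)] u v Q(1)[OF w] by (simp add: a_minus_def W.M.r_neg)
    then have "p (?u \<ominus>\<^bsub>V\<^esub> v) = ?u \<ominus>\<^bsub>V\<^esub> v" using p(3) u v by simp
    then have e: "p ?u \<ominus>\<^bsub>V\<^esub> p v = ?u \<ominus>\<^bsub>V\<^esub> v" using linear_map_minus[OF Vm Vm p(1) u(1) v(1)] by simp
    have "?u = (?u \<ominus>\<^bsub>V\<^esub> v) \<oplus>\<^bsub>V\<^esub> v" using u v by (simp add: a_minus_def V.M.add.m_assoc V.M.l_neg)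
    also have "\<dots> = p ?u \<ominus>\<^bsub>V\<^esub> p v \<oplus>\<^bsub>V\<^esub> v" using e by simp
    finally have "?u \<ominus>\<^bsub>V\<^esub> p ?u = p ?u \<ominus>\<^bsub>V\<^esub> p v \<oplus>\<^bsub>V\<^esub> v \<ominus>\<^bsub>V\<^esub> p ?u" by simp
    also have "\<dots> = v \<ominus>\<^bsub>V\<^esub> p v"
      using cancel P(1)[OF u(1)] P(1)[OF v(1)] v(1) by (simp add: a_minus_def V.M.add.m_ac V.M.r_neg2 V.M.r_neg1)
    finally show ?thesis by (simp add: s_def)
  qed
  show thesis
  proof
    show "linear_map K W V s"
    proof (rule linear_mapI)
      fix w assume w: "w \<in> carrier W"
      show "s w \<in> carrier V" unfolding s_def using g[OF w] P(1) by simp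
      show "s (a \<odot>\<^bsub>W\<^esub> w) = a \<odot>\<^bsub>V\<^esub> s w" if a: "a \<in> carrier K" for a
      proof -
        have "s (a \<odot>\<^bsub>W\<^esub> w) = a \<odot>\<^bsub>V\<^esub> g w \<ominus>\<^bsub>V\<^esub> p (a \<odot>\<^bsub>V\<^esub> g w)"
          by (rule s) (use a w g[OF w] D Q in auto)
        also have "\<dots> = a \<odot>\<^bsub>V\<^esub> s w" unfolding s_def
          using a g[OF w] P by (simp add: a_minus_def V.smult_r_distr V.smult_r_minus)
        finally show ?thesis .
      qed
      fix w' assume w': "w' \<in> carrier W"
      have "s (w \<oplus>\<^bsub>W\<^esub> w') = g w \<oplus>\<^bsub>V\<^esub> g w' \<ominus>\<^bsub>V\<^esub> p (g w \<oplus>\<^bsub>V\<^esub> g w')"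
        by (rule s) (use w w' g D Q in auto)
      also have "\<dots> = s w \<oplus>\<^bsub>V\<^esub> s w'" unfolding s_def
        using g[OF w] g[OF w'] P by (simp add: a_minus_def V.M.minus_add V.M.add.m_ac)
      finally show "s (w \<oplus>\<^bsub>W\<^esub> w') = s w \<oplus>\<^bsub>V\<^esub> s w'" .
    qed
    show "d (s (d x)) = d x" if x: "x \<in> carrier V" for x
    proof -
      have "s (d x) = x \<ominus>\<^bsub>V\<^esub> p x" by (rule s) (use x D q(3) in auto)
      then show ?thesis using linear_map_minus[OF Vm Wm d x P(1)[OF x]] p(2)[OF x] D(1)[OF x]
        by (simp add: a_minus_def)
    qed
  qed
qed

section \<open>Braided bialgebras and their primitive elements\<close>

text \<open>The degree \<open>1\<close> of tensor powers should not be rewritten to \<open>Suc 0\<close>.\<close>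

declare One_nat_def [simp del]

text \<open>Degrees of tensor products of maps come out as sums, while the axioms are stated with
  numerals. Unfolding these equations in instantiated lemmas makes the tensor powers match
  syntactically.\<close>

lemma nat_plus: "1 + 1 = (2::nat)" "1 + 2 = (3::nat)" "2 + 1 = (3::nat)" "2 + 2 = (4::nat)" "1 + 3 = (4::nat)"
  "0 + 1 = (1::nat)" "1 + 0 = (1::nat)"
  by simp_all

lemma length_1: "length w = 1 \<longleftrightarrow> (\<exists>x. w = [x])"
  by (simp add: length_Suc_conv One_nat_def)

lemma length_2: "length w = 2 \<longleftrightarrow> (\<exists>x y. w = [x, y])"
  by (auto simp: length_Suc_conv numeral_2_eq_2)

sublocale linear_space \<subseteq> S: linear_space_pair K V V ..

section \<open>Low degrees and tensor products of endomorphisms\<close>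

context linear_space
begin

lemma tp2_linear_eqI:
  assumes "module K M" "linear_map K (tp 2) M f" "linear_map K (tp 2) M g"
    and "\<And>x y. x \<in> carrier V \<Longrightarrow> y \<in> carrier V \<Longrightarrow> f (pt [x, y]) = g (pt [x, y])" and "X \<in> carrier (tp 2)"
  shows "f X = g X"
  by (rule tp_linear_eqI[OF assms(1-3) _ assms(5)]) (auto simp: length_2 assms(4))

lemma pt1: "x \<in> carrier V \<Longrightarrow> pt [x] \<in> carrier (tp 1)"
  by (rule pt_tp) auto

lemma pt2: "x \<in> carrier V \<Longrightarrow> y \<in> carrier V \<Longrightarrow> pt [x, y] \<in> carrier (tp 2)"
  by (rule pt_tp) auto

lemma pt3: "x \<in> carrier V \<Longrightarrow> y \<in> carrier V \<Longrightarrow> z \<in> carrier V \<Longrightarrow> pt [x, y, z] \<in> carrier (tp 3)"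
  by (rule pt_tp) auto

lemma pt_Cons: "x \<in> carrier V \<Longrightarrow> w \<in> W \<Longrightarrow> pt (x # w) = pt [x] \<otimes>\<^bsub>T\<^esub> pt w"
  by (simp add: pt_mult del: in_lists_conv_set)

lemma pt_mults:
  "x \<in> carrier V \<Longrightarrow> y \<in> carrier V \<Longrightarrow> pt [x] \<otimes>\<^bsub>T\<^esub> pt [y] = pt [x, y]"
  "x \<in> carrier V \<Longrightarrow> y \<in> carrier V \<Longrightarrow> z \<in> carrier V \<Longrightarrow> pt [x] \<otimes>\<^bsub>T\<^esub> pt [y, z] = pt [x, y, z]"
  "x \<in> carrier V \<Longrightarrow> y \<in> carrier V \<Longrightarrow> z \<in> carrier V \<Longrightarrow> pt [x, y] \<otimes>\<^bsub>T\<^esub> pt [z] = pt [x, y, z]"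
  by (simp_all add: pt_mult)

lemma pt_bilinear:
  "x \<in> carrier V \<Longrightarrow> y \<in> carrier V \<Longrightarrow> pt [x \<oplus>\<^bsub>V\<^esub> y] = pt [x] \<oplus>\<^bsub>T\<^esub> pt [y]"
  "x \<in> carrier V \<Longrightarrow> a \<in> carrier K \<Longrightarrow> pt [a \<odot>\<^bsub>V\<^esub> x] = a \<odot>\<^bsub>T\<^esub> pt [x]"
  "x \<in> carrier V \<Longrightarrow> y \<in> carrier V \<Longrightarrow> z \<in> carrier V \<Longrightarrow> pt [x \<oplus>\<^bsub>V\<^esub> y, z] = pt [x, z] \<oplus>\<^bsub>T\<^esub> pt [y, z]"
  "x \<in> carrier V \<Longrightarrow> z \<in> carrier V \<Longrightarrow> a \<in> carrier K \<Longrightarrow> pt [a \<odot>\<^bsub>V\<^esub> x, z] = a \<odot>\<^bsub>T\<^esub> pt [x, z]"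
  "x \<in> carrier V \<Longrightarrow> y \<in> carrier V \<Longrightarrow> z \<in> carrier V \<Longrightarrow> pt [z, x \<oplus>\<^bsub>V\<^esub> y] = pt [z, x] \<oplus>\<^bsub>T\<^esub> pt [z, y]"
  "x \<in> carrier V \<Longrightarrow> z \<in> carrier V \<Longrightarrow> a \<in> carrier K \<Longrightarrow> pt [z, a \<odot>\<^bsub>V\<^esub> x] = a \<odot>\<^bsub>T\<^esub> pt [z, x]"
proof -
  note A = multilinear_pt[unfolded multilinear_def, THEN conjunct2, rule_format]
  assume x: "x \<in> carrier V"
  show "pt [x \<oplus>\<^bsub>V\<^esub> y] = pt [x] \<oplus>\<^bsub>T\<^esub> pt [y]" if "y \<in> carrier V"
    using A[of "[]" "[]" x] x that by simp
  show "pt [a \<odot>\<^bsub>V\<^esub> x] = a \<odot>\<^bsub>T\<^esub> pt [x]" if "a \<in> carrier K"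
    using A[of "[]" "[]" x] x that by simp
  assume z: "z \<in> carrier V"
  show "pt [a \<odot>\<^bsub>V\<^esub> x, z] = a \<odot>\<^bsub>T\<^esub> pt [x, z]" "pt [z, a \<odot>\<^bsub>V\<^esub> x] = a \<odot>\<^bsub>T\<^esub> pt [z, x]" if "a \<in> carrier K"
    using A[of "[]" "[z]" x] A[of "[z]" "[]" x] x z that by simp_all
  assume y: "y \<in> carrier V"
  show "pt [x \<oplus>\<^bsub>V\<^esub> y, z] = pt [x, z] \<oplus>\<^bsub>T\<^esub> pt [y, z]" "pt [z, x \<oplus>\<^bsub>V\<^esub> y] = pt [z, x] \<oplus>\<^bsub>T\<^esub> pt [z, y]"
    using A[of "[]" "[z]" x] A[of "[z]" "[]" x] x y z by simp_all
qed

text \<open>Additivity in one tensor slot. It turns the splittings of \<Delta> and of the identity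
  on degree one into splittings of (id \<otimes> \<Delta>)(\<tau>) and of \<tau>.\<close>

lemma tens_add_right:
  assumes f: "linear_map K (tp j) (tp j') f" and g: "linear_map K (tp k) (tp k') g"
    and h: "linear_map K (tp k) (tp k') h" and e: "linear_map K (tp k) (tp k') e"
    and eq: "\<And>w. w \<in> W \<Longrightarrow> length w = k \<Longrightarrow> e (pt w) = g (pt w) \<oplus>\<^bsub>T\<^esub> h (pt w)"
    and t: "t \<in> carrier (tp (j + k))"
  shows "tens K V V j k f e t = tens K V V j k f g t \<oplus>\<^bsub>T\<^esub> tens K V V j k f h t"
proof (rule tp_linear_eqI[OF tp_module S.linear_tens[OF f e] _ _ t])
  note L = S.linear_tens[OF f g] S.linear_tens[OF f h]
  interpret M: module K "tp (j' + k')" by (rule tp_module)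
  interpret T: ring T by (rule T_ring)
  have "linear_map K (tp (j + k)) (tp (j' + k'))
     (\<lambda>t. tens K V V j k f g t \<oplus>\<^bsub>tp (j' + k')\<^esub> tens K V V j k f h t)"
    by (rule linear_mapI)
       (simp_all only: linear_mapD(1)[OF L(1)] linear_mapD(1)[OF L(2)] linear_mapD(2,3)[OF L(1)] linear_mapD(2,3)[OF L(2)]
        M.M.add.m_closed M.smult_r_distr M.M.add.m_ac)
  then show "linear_map K (tp (j + k)) (tp (j' + k'))
     (\<lambda>t. tens K V V j k f g t \<oplus>\<^bsub>T\<^esub> tens K V V j k f h t)" by simp
  fix w assume w: "w \<in> W" "length w = j + k"
  define u v where "u = take j w" and "v = drop j w"
  have uv: "u \<in> W" "v \<in> W" "length u = j" "length v = k" and e': "w = u @ v"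
    using w by (auto simp: u_def v_def dest: in_set_takeD in_set_dropD)
  show "tens K V V j k f e (pt w) = tens K V V j k f g (pt w) \<oplus>\<^bsub>T\<^esub> tens K V V j k f h (pt w)"
    unfolding e' S.tens_pt[OF f e uv(1,3,2,4)] S.tens_pt[OF f g uv(1,3,2,4)] S.tens_pt[OF f h uv(1,3,2,4)] eq[OF uv(2,4)]
    by (rule T.r_distr) (use linear_mapD(1)[OF f] linear_mapD(1)[OF g] linear_mapD(1)[OF h] uv pt_tp tp_T in blast)+
qed

lemma tens_add_left:
  assumes f: "linear_map K (tp j) (tp j') f" and g: "linear_map K (tp k) (tp k') g"
    and h: "linear_map K (tp k) (tp k') h" and e: "linear_map K (tp k) (tp k') e"
    and eq: "\<And>w. w \<in> W \<Longrightarrow> length w = k \<Longrightarrow> e (pt w) = g (pt w) \<oplus>\<^bsub>T\<^esub> h (pt w)"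
    and t: "t \<in> carrier (tp (k + j))"
  shows "tens K V V k j e f t = tens K V V k j g f t \<oplus>\<^bsub>T\<^esub> tens K V V k j h f t"
proof (rule tp_linear_eqI[OF tp_module S.linear_tens[OF e f] _ _ t])
  note L = S.linear_tens[OF g f] S.linear_tens[OF h f]
  interpret M: module K "tp (k' + j')" by (rule tp_module)
  interpret T: ring T by (rule T_ring)
  have "linear_map K (tp (k + j)) (tp (k' + j'))
     (\<lambda>t. tens K V V k j g f t \<oplus>\<^bsub>tp (k' + j')\<^esub> tens K V V k j h f t)"
    by (rule linear_mapI)
       (simp_all only: linear_mapD(1)[OF L(1)] linear_mapD(1)[OF L(2)] linear_mapD(2,3)[OF L(1)] linear_mapD(2,3)[OF L(2)]
        M.M.add.m_closed M.smult_r_distr M.M.add.m_ac)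
  then show "linear_map K (tp (k + j)) (tp (k' + j'))
     (\<lambda>t. tens K V V k j g f t \<oplus>\<^bsub>T\<^esub> tens K V V k j h f t)" by simp
  fix w assume w: "w \<in> W" "length w = k + j"
  define u v where "u = take k w" and "v = drop k w"
  have uv: "u \<in> W" "v \<in> W" "length u = k" "length v = j" and e': "w = u @ v"
    using w by (auto simp: u_def v_def dest: in_set_takeD in_set_dropD)
  show "tens K V V k j e f (pt w) = tens K V V k j g f (pt w) \<oplus>\<^bsub>T\<^esub> tens K V V k j h f (pt w)"
    unfolding e' S.tens_pt[OF e f uv(1,3,2,4)] S.tens_pt[OF g f uv(1,3,2,4)] S.tens_pt[OF h f uv(1,3,2,4)] eq[OF uv(1,3)]
    by (rule T.l_distr) (use linear_mapD(1)[OF f] linear_mapD(1)[OF g] linear_mapD(1)[OF h] uv pt_tp tp_T in blast)+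
qed

lemma tens_comp:
  assumes f: "linear_map K (tp j) (tp j') f" and g: "linear_map K (tp k) (tp k') g"
    and f': "linear_map K (tp j') (tp j'') f'" and g': "linear_map K (tp k') (tp k'') g'"
    and t: "t \<in> carrier (tp (j + k))"
  shows "tens K V V j' k' f' g' (tens K V V j k f g t) = tens K V V j k (\<lambda>x. f' (f x)) (\<lambda>x. g' (g x)) t"
proof (rule tp_linear_eqI[OF tp_module linear_map_comp[OF S.linear_tens[OF f g] S.linear_tens[OF f' g']]
    S.linear_tens[OF linear_map_comp[OF f f'] linear_map_comp[OF g g']] _ t])
  fix w assume w: "w \<in> W" "length w = j + k"
  define u v where "u = take j w" and "v = drop j w"
  have uv: "u \<in> W" "v \<in> W" "length u = j" "length v = k" and e': "w = u @ v"
    using w by (auto simp: u_def v_def dest: in_set_takeD in_set_dropD)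
  show "tens K V V j' k' f' g' (tens K V V j k f g (pt w)) = tens K V V j k (\<lambda>x. f' (f x)) (\<lambda>x. g' (g x)) (pt w)"
    unfolding e' S.tens_pt[OF f g uv(1,3,2,4)] S.tens_pt[OF linear_map_comp[OF f f'] linear_map_comp[OF g g'] uv(1,3,2,4)]
    by (rule S.tens_mult[OF f' g']) (use linear_mapD(1)[OF f] linear_mapD(1)[OF g] uv pt_tp in blast)+
qed

lemma tens_id_id:
  assumes t: "t \<in> carrier (tp (j + k))"
  shows "tens K V V j k id id t = t"
proof -
  have I: "linear_map K (tp n) (tp n) id" for n by (rule linear_map_id)
  have I': "linear_map K (tp n) (tp n) (\<lambda>x. x)" for n using I by (simp add: id_def)
  show ?thesis
  proof (rule tp_linear_eqI[OF tp_module S.linear_tens[OF I I] I' _ t])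
    fix w assume w: "w \<in> W" "length w = j + k"
    define u v where "u = take j w" and "v = drop j w"
    have uv: "u \<in> W" "v \<in> W" "length u = j" "length v = k" and e': "w = u @ v"
      using w by (auto simp: u_def v_def dest: in_set_takeD in_set_dropD)
    show "tens K V V j k id id (pt w) = pt w"
      unfolding e' S.tens_pt[OF I I uv(1,3,2,4)] by (simp add: pt_mult uv del: in_lists_conv_set)
  qed
qed

end

section \<open>Structure maps and axioms of a braided bialgebra on pure tensors\<close>

locale bialg = linear_space K B for K :: "'k ring" and B :: "('k, 'b, 'm) braided_bialg_scheme" +
  assumes bialgebra: "braided_bialgebra K B"
begin

abbreviation "c \<equiv> braiding B"
abbreviation "m \<equiv> mult_map K B"
abbreviation "u \<equiv> unit_map K B"
abbreviation "D \<equiv> comult_map K B"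
abbreviation "e \<equiv> counit_map K B"
abbreviation "t \<equiv> tens K B B"

lemma alg: "unital_algebra K B" and bvs: "braided_vector_space K B"
  and coalg: "braided_coalgebra K B" and balg: "braided_algebra K B"
  using bialgebra by (auto simp: braided_bialgebra_def braided_algebra_def Let_def)

sublocale B: ring B using alg by (simp add: unital_algebra_def)

lemma smult_mult:
  assumes "a \<in> carrier K" "x \<in> carrier B" "y \<in> carrier B"
  shows "(a \<odot>\<^bsub>B\<^esub> x) \<otimes>\<^bsub>B\<^esub> y = a \<odot>\<^bsub>B\<^esub> (x \<otimes>\<^bsub>B\<^esub> y)" "x \<otimes>\<^bsub>B\<^esub> (a \<odot>\<^bsub>B\<^esub> y) = a \<odot>\<^bsub>B\<^esub> (x \<otimes>\<^bsub>B\<^esub> y)"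
  using alg assms by (auto simp: unital_algebra_def)

lemma id_lin: "linear_map K (tp n) (tp n) id"
  by (rule linear_map_id)

lemma c_lin: "linear_map K (tp 2) (tp 2) c"
  using bvs by (simp add: braided_vector_space_def Let_def)

lemma comult_lin: "linear_map K B (tp 2) (comult B)" and counit_lin: "linear_map K B (base_algebra K) (counit B)"
  using coalg by (simp_all add: braided_coalgebra_def Let_def)

lemma multilin_1:
  assumes f: "linear_map K B M f" shows "multilin M 1 (\<lambda>w. f (w ! 0))"
  by (rule multilinI) (use linear_mapD[OF f] in \<open>auto simp: length_1\<close>)

lemma multilin_m: "multilin (tp 1) 2 (\<lambda>w. pt [w ! 0 \<otimes>\<^bsub>B\<^esub> w ! 1])"
proof (rule multilinI)
  show "pt [w ! 0 \<otimes>\<^bsub>B\<^esub> w ! 1] \<in> carrier (tp 1)" if "w \<in> W" "length w = 2" for w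
    using that by (auto simp: length_2 intro!: pt1)
  fix u v a assume uv: "u \<in> W" "v \<in> W" "Suc (length u + length v) = 2" and a: "a \<in> carrier B"
  have "length u + length v = 1" using uv(3) by simp
  then have "length u = 0 \<and> length v = 1 \<or> length u = 1 \<and> length v = 0" by linarith
  then consider x where "u = []" "v = [x]" | x where "u = [x]" "v = []" by (auto simp: length_1)
  note cases = this
  let ?f = "\<lambda>w. pt [w ! 0 \<otimes>\<^bsub>B\<^esub> w ! 1]"
  show "?f (u @ (a \<oplus>\<^bsub>B\<^esub> b) # v) = ?f (u @ a # v) \<oplus>\<^bsub>tp 1\<^esub> ?f (u @ b # v)" if b: "b \<in> carrier B" for b
    by (rule cases) (use uv(1,2) a b in \<open>simp_all add: B.l_distr B.r_distr pt_bilinear One_nat_def\<close>)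
  show "?f (u @ (k \<odot>\<^bsub>B\<^esub> a) # v) = k \<odot>\<^bsub>tp 1\<^esub> ?f (u @ a # v)" if k: "k \<in> carrier K" for k
    by (rule cases) (use uv(1,2) a k in \<open>simp_all add: smult_mult pt_bilinear One_nat_def\<close>)
qed

lemma multilin_0: "z \<in> carrier M \<Longrightarrow> multilin M 0 (\<lambda>w. z)"
  by (rule multilinI) auto

lemma m_lin: "linear_map K (tp 2) (tp 1) m"
  and D_lin: "linear_map K (tp 1) (tp 2) D"
  and u_lin: "linear_map K (tp 0) (tp 1) u"
  unfolding mult_map_def comult_map_def unit_map_def
  by (rule S.linear_lin_ext[OF multilin_m] S.linear_lin_ext[OF multilin_1[OF comult_lin]]
      S.linear_lin_ext[OF multilin_0] pt1 B.one_closed)+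

lemma m_pt: "x \<in> carrier B \<Longrightarrow> y \<in> carrier B \<Longrightarrow> m (pt [x, y]) = pt [x \<otimes>\<^bsub>B\<^esub> y]"
  unfolding mult_map_def by (subst S.lin_ext_pt[OF S.multilin_tp_T[OF multilin_m]]) (auto simp: One_nat_def)

lemma D_pt: "x \<in> carrier B \<Longrightarrow> D (pt [x]) = comult B x"
  unfolding comult_map_def by (subst S.lin_ext_pt[OF S.multilin_tp_T[OF multilin_1[OF comult_lin]]]) auto

lemma u_pt: "u (pt []) = pt [\<one>\<^bsub>B\<^esub>]"
  unfolding unit_map_def by (subst S.lin_ext_pt[OF S.multilin_tp_T[OF multilin_0[OF pt1]]]) auto

lemmas tens_lins [unfolded nat_plus] =
  S.linear_tens[OF c_lin id_lin[of 1]] S.linear_tens[OF id_lin[of 1] c_lin]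
  S.linear_tens[OF m_lin id_lin[of 1]] S.linear_tens[OF id_lin[of 1] m_lin]
  S.linear_tens[OF D_lin id_lin[of 1]] S.linear_tens[OF id_lin[of 1] D_lin]
  S.linear_tens[OF m_lin m_lin] S.linear_tens[OF D_lin D_lin]

lemma c_unit:
  assumes x: "x \<in> carrier B"
  shows "c (pt [\<one>\<^bsub>B\<^esub>, x]) = pt [x, \<one>\<^bsub>B\<^esub>]" "c (pt [x, \<one>\<^bsub>B\<^esub>]) = pt [\<one>\<^bsub>B\<^esub>, x]"
proof -
  have 1: "t 0 1 u id (pt [x]) = pt [\<one>\<^bsub>B\<^esub>, x]"
    using S.tens_pt[OF u_lin id_lin[of 1], of "[]" "[x]"] x by (simp add: u_pt pt_mults)
  have 2: "t 1 0 id u (pt [x]) = pt [x, \<one>\<^bsub>B\<^esub>]"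
    using S.tens_pt[OF id_lin[of 1] u_lin, of "[x]" "[]"] x by (simp add: u_pt pt_mults)
  have "c (t 0 1 u id (pt [x])) = t 1 0 id u (pt [x]) \<and> c (t 1 0 id u (pt [x])) = t 0 1 u id (pt [x])"
    using balg pt1[OF x] by (simp add: braided_algebra_def Let_def)
  then show "c (pt [\<one>\<^bsub>B\<^esub>, x]) = pt [x, \<one>\<^bsub>B\<^esub>]" "c (pt [x, \<one>\<^bsub>B\<^esub>]) = pt [\<one>\<^bsub>B\<^esub>, x]"
    unfolding 1 2 by simp_all
qed

text \<open>The order of braiding matters later: in the first equation the inner letter
  \<open>y\<close> passes \<open>z\<close> before \<open>x\<close> does, in the second
  \<open>x\<close> passes \<open>y\<close> before it passes \<open>z\<close>. The inductions over
  products follow this order.\<close>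

lemma c_mult:
  assumes "x \<in> carrier B" "y \<in> carrier B" "z \<in> carrier B"
  shows "c (pt [x \<otimes>\<^bsub>B\<^esub> y, z]) = t 1 2 id m (t 2 1 c id (pt [x] \<otimes>\<^bsub>T\<^esub> c (pt [y, z])))"
    "c (pt [x, y \<otimes>\<^bsub>B\<^esub> z]) = t 2 1 m id (t 1 2 id c (c (pt [x, y]) \<otimes>\<^bsub>T\<^esub> pt [z]))"
proof -
  let ?t = "pt [x, y, z]"
  have "c (t 2 1 m id ?t) = t 1 2 id m (t 2 1 c id (t 1 2 id c ?t))"
    "c (t 1 2 id m ?t) = t 2 1 m id (t 1 2 id c (t 2 1 c id ?t))"
    using balg pt3[OF assms] by (simp_all add: braided_algebra_def Let_def)
  moreover have "t 2 1 m id ?t = pt [x \<otimes>\<^bsub>B\<^esub> y, z]" "t 2 1 c id ?t = c (pt [x, y]) \<otimes>\<^bsub>T\<^esub> pt [z]"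
    using S.tens_pt[OF m_lin id_lin[of 1], of "[x, y]" "[z]"] S.tens_pt[OF c_lin id_lin[of 1], of "[x, y]" "[z]"] assms
    by (simp_all add: m_pt pt_mults)
  moreover have "t 1 2 id m ?t = pt [x, y \<otimes>\<^bsub>B\<^esub> z]" "t 1 2 id c ?t = pt [x] \<otimes>\<^bsub>T\<^esub> c (pt [y, z])"
    using S.tens_pt[OF id_lin[of 1] m_lin, of "[x]" "[y, z]"] S.tens_pt[OF id_lin[of 1] c_lin, of "[x]" "[y, z]"] assms
    by (simp_all add: m_pt pt_mults)
  ultimately show "c (pt [x \<otimes>\<^bsub>B\<^esub> y, z]) = t 1 2 id m (t 2 1 c id (pt [x] \<otimes>\<^bsub>T\<^esub> c (pt [y, z])))"
    "c (pt [x, y \<otimes>\<^bsub>B\<^esub> z]) = t 2 1 m id (t 1 2 id c (c (pt [x, y]) \<otimes>\<^bsub>T\<^esub> pt [z]))" by simp_all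
qed

lemma comult_mult:
  assumes "x \<in> carrier B" "y \<in> carrier B"
  shows "comult B (x \<otimes>\<^bsub>B\<^esub> y) = t 2 2 m m (t 1 3 id (t 2 1 c id) (comult B x \<otimes>\<^bsub>T\<^esub> comult B y))"
proof -
  have "D (m (pt [x, y])) = t 2 2 m m (t 1 3 id (t 2 1 c id) (t 1 1 D D (pt [x, y])))"
    using bialgebra pt2[OF assms] by (simp add: braided_bialgebra_def Let_def)
  then show ?thesis using S.tens_pt[OF D_lin D_lin, of "[x]" "[y]"] assms by (simp add: m_pt D_pt)
qed

lemma comult_one: "comult B \<one>\<^bsub>B\<^esub> = pt [\<one>\<^bsub>B\<^esub>, \<one>\<^bsub>B\<^esub>]"
  and counit_alg: "algebra_map K B (base_algebra K) (counit B)"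
  using bialgebra by (simp_all add: braided_bialgebra_def Let_def)

end

lemma linear_map_plus:
  assumes "module K W" and f: "linear_map K V W f" and g: "linear_map K V W g"
  shows "linear_map K V W (\<lambda>x. f x \<oplus>\<^bsub>W\<^esub> g x)"
proof -
  interpret W: module K W by fact
  show ?thesis
    by (rule linear_mapI)
       (simp_all only: linear_mapD[OF f] linear_mapD[OF g] W.M.add.m_closed W.smult_r_distr W.M.add.m_ac)
qed

lemma linear_map_scale:
  assumes "module K W" and f: "linear_map K V W f" and a: "a \<in> carrier K"
  shows "linear_map K V W (\<lambda>x. a \<odot>\<^bsub>W\<^esub> f x)"
proof -
  interpret W: module K W by fact
  show ?thesis using a
    by (intro linear_mapI)
       (simp_all add: linear_mapD[OF f] W.smult_r_distr W.smult_assoc1[symmetric] W.R.m_comm)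
qed

text \<open>\<open>infinitesimal_part\<close> and \<open>primitive_module\<close> are different
  records with the same vectors. Tensor constructions read only the carrier, addition and scalar
  action, so results transfer from one to the other.\<close>

lemma tensor_cong:
  assumes "carrier V = carrier V'" "add V = add V'" "smult V = smult V'"
  shows "tensor_algebra K V = tensor_algebra K V'" "pure_tensor K V = pure_tensor K V'"
    "tensor_power K V n = tensor_power K V' n"
    "tens_map K V W n f = tens_map K V' W n f" "tens_map K W V n g = tens_map K W V' n g"
proof -
  have 1: "free_algebra K V = free_algebra K V'" using assms by (simp add: free_algebra_def)
  then have 2: "tensor_ideal K V = tensor_ideal K V'"
    using assms by (simp add: tensor_ideal_def linearity_relations_def)
  then show 3: "tensor_algebra K V = tensor_algebra K V'" "pure_tensor K V = pure_tensor K V'"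
    using 1 by (simp_all add: tensor_algebra_def pure_tensor_def fun_eq_iff)
  then show "tensor_power K V n = tensor_power K V' n" using 1 2 by (simp add: tensor_power_def)
  show "tens_map K V W n f = tens_map K V' W n f" "tens_map K W V n g = tens_map K W V' n g"
    using 3 by (simp_all add: tens_map_def lin_ext_def fun_eq_iff)
qed

lemma (in linear_space) subspace_module:
  assumes S: "subspace K V S" and eq: "carrier N = S" "add N = add V" "zero N = zero V" "smult N = smult V"
  shows "module K N"
proof -
  have SV: "x \<in> carrier V" if "x \<in> S" for x using S that by (auto simp: subspace_def)
  show ?thesis
  proof (rule moduleI)
  show "cring K" by (rule R.is_cring)
  show "abelian_group N"
  proof (rule abelian_groupI)
    fix x assume "x \<in> carrier N"
    then have x: "x \<in> S" by (simp add: eq)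
    have "\<ominus>\<^bsub>V\<^esub> x \<in> S" using S x SV[OF x] by (simp add: uminus_smult subspace_def)
    then show "\<exists>y\<in>carrier N. y \<oplus>\<^bsub>N\<^esub> x = \<zero>\<^bsub>N\<^esub>" using M.l_neg[OF SV[OF x]] by (auto simp: eq)
  qed (use S in \<open>simp_all add: eq subspace_def SV M.add.m_ac\<close>)
  qed (use S in \<open>simp_all add: eq subspace_def SV smult_l_distr smult_r_distr smult_assoc1\<close>)
qed

section \<open>Primitive elements and their behaviour under the braiding\<close>

context bialg
begin

abbreviation "prim \<equiv> primitives K B"

lemma primitives_iff: "x \<in> prim \<longleftrightarrow> x \<in> carrier B \<and> comult B x = pt [x, \<one>\<^bsub>B\<^esub>] \<oplus>\<^bsub>T\<^esub> pt [\<one>\<^bsub>B\<^esub>, x]"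
  by (simp add: primitives_def)

lemma prim_B: "x \<in> prim \<Longrightarrow> x \<in> carrier B"
  by (simp add: primitives_iff)

lemma pt_right_one_lin: "linear_map K B (tp 2) (\<lambda>x. pt [x, \<one>\<^bsub>B\<^esub>])"
  and pt_left_one_lin: "linear_map K B (tp 2) (\<lambda>x. pt [\<one>\<^bsub>B\<^esub>, x])"
  and pt_lin: "linear_map K B (tp 1) (\<lambda>x. pt [x])"
  by (rule linear_mapI; simp add: pt1 pt2 pt_bilinear)+

text \<open>Makes the primitive elements the kernel of one linear map, so that projections and
  generalised inverses apply; the last property recovers \<Delta> from that map.\<close>

lemma prim_defect:
  obtains d where "linear_map K B (tp 2) d" "\<And>x. x \<in> carrier B \<Longrightarrow> x \<in> prim \<longleftrightarrow> d x = \<zero>\<^bsub>T\<^esub>"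
    "\<And>x. x \<in> carrier B \<Longrightarrow> comult B x = d x \<oplus>\<^bsub>T\<^esub> (pt [x, \<one>\<^bsub>B\<^esub>] \<oplus>\<^bsub>T\<^esub> pt [\<one>\<^bsub>B\<^esub>, x])"
proof
  interpret M: module K "tp 2" by (rule tp_module)
  define g where "g x = pt [x, \<one>\<^bsub>B\<^esub>] \<oplus>\<^bsub>tp 2\<^esub> pt [\<one>\<^bsub>B\<^esub>, x]" for x
  have g: "linear_map K B (tp 2) g"
    unfolding g_def by (rule linear_map_plus[OF tp_module pt_right_one_lin pt_left_one_lin])
  note mone = R.add.inv_closed[OF R.one_closed]
  \<comment> \<open>The difference is written with the scalar -1, so that linearity of
    \<open>d\<close> is an instance of the closure of linear maps under sums and multiples.\<close>
  define d where "d x = comult B x \<oplus>\<^bsub>tp 2\<^esub> (\<ominus>\<^bsub>K\<^esub> \<one>\<^bsub>K\<^esub>) \<odot>\<^bsub>tp 2\<^esub> g x" for x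
  show "linear_map K B (tp 2) d"
    unfolding d_def by (rule linear_map_plus[OF tp_module comult_lin linear_map_scale[OF tp_module g mone]])
  fix x assume x: "x \<in> carrier B"
  have cx: "comult B x \<in> carrier (tp 2)" "g x \<in> carrier (tp 2)"
    using linear_mapD(1)[OF comult_lin x] linear_mapD(1)[OF g x] .
  have "comult B x = d x \<oplus>\<^bsub>tp 2\<^esub> g x"
    unfolding d_def M.uminus_smult[OF cx(2), symmetric] using cx by (simp only: M.M.add.m_assoc M.M.l_neg M.M.r_zero M.M.add.inv_closed)
  then show eq: "comult B x = d x \<oplus>\<^bsub>T\<^esub> (pt [x, \<one>\<^bsub>B\<^esub>] \<oplus>\<^bsub>T\<^esub> pt [\<one>\<^bsub>B\<^esub>, x])" by (simp add: g_def)
  have "d x = \<zero>\<^bsub>tp 2\<^esub>" if "comult B x = g x"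
    unfolding d_def that M.uminus_smult[OF cx(2), symmetric] by (rule M.M.r_neg[OF cx(2)])
  moreover have "comult B x = g x" if "d x = \<zero>\<^bsub>tp 2\<^esub>"
    using \<open>comult B x = d x \<oplus>\<^bsub>tp 2\<^esub> g x\<close> that cx by (simp only: M.M.l_zero)
  ultimately show "x \<in> prim \<longleftrightarrow> d x = \<zero>\<^bsub>T\<^esub>" using x by (auto simp only: primitives_iff g_def tp_sel)
qed

lemma prim_subspace: "subspace K B prim"
proof -
  obtain d where d: "linear_map K B (tp 2) d" "\<And>x. x \<in> carrier B \<Longrightarrow> x \<in> prim \<longleftrightarrow> d x = \<zero>\<^bsub>T\<^esub>"
    "\<And>x. x \<in> carrier B \<Longrightarrow> comult B x = d x \<oplus>\<^bsub>T\<^esub> (pt [x, \<one>\<^bsub>B\<^esub>] \<oplus>\<^bsub>T\<^esub> pt [\<one>\<^bsub>B\<^esub>, x])"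
    by (rule prim_defect) (rule that)
  interpret T: module K T by (rule T_module)
  note L = linear_mapD[OF d(1)]
  show ?thesis unfolding subspace_def
  proof (intro conjI ballI)
    show "prim \<subseteq> carrier B" using prim_B by blast
    have "d \<zero>\<^bsub>B\<^esub> = \<zero>\<^bsub>T\<^esub>" using linear_map_zero[OF _ tp_module d(1)] by (simp add: module_axioms)
    then show "\<zero>\<^bsub>B\<^esub> \<in> prim" using d(2) by simp
    fix x assume x: "x \<in> prim"
    then have dx: "x \<in> carrier B" "d x = \<zero>\<^bsub>T\<^esub>" using prim_B d(2) by blast+
    show "a \<odot>\<^bsub>B\<^esub> x \<in> prim" if a: "a \<in> carrier K" for a
      using d(2)[of "a \<odot>\<^bsub>B\<^esub> x"] L(3)[OF a dx(1)] a dx by simp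
    fix y assume y: "y \<in> prim"
    then have dy: "y \<in> carrier B" "d y = \<zero>\<^bsub>T\<^esub>" using prim_B d(2) by blast+
    show "x \<oplus>\<^bsub>B\<^esub> y \<in> prim" using d(2)[of "x \<oplus>\<^bsub>B\<^esub> y"] L(2)[OF dx(1) dy(1)] dx dy by simp
  qed
qed

text \<open>Braiding with the unit is the plain flip, so 1 \<otimes> x \<otimes> y becomes x
  \<otimes> 1 \<otimes> y. The right side writes this as a map on the second factor, the form in
  which it is compared with id \<otimes> \<Delta>.\<close>

lemma swap_one_left:
  assumes s: "s \<in> carrier (tp 2)"
  shows "t 2 1 c id (pt [\<one>\<^bsub>B\<^esub>] \<otimes>\<^bsub>T\<^esub> s) = t 1 1 id (\<lambda>y. pt [\<one>\<^bsub>B\<^esub>] \<otimes>\<^bsub>T\<^esub> y) s"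
proof -
  note E = mult_left_linear[OF pt1[OF B.one_closed], where k = 1, unfolded nat_plus]
  note E2 = mult_left_linear[OF pt1[OF B.one_closed], where k = 2, unfolded nat_plus]
  show ?thesis
  proof (rule tp2_linear_eqI[OF tp_module linear_map_comp[OF E2 tens_lins(1)]
      S.linear_tens[OF id_lin[of 1] E, unfolded nat_plus] _ s])
    fix x y assume xy: "x \<in> carrier B" "y \<in> carrier B"
    show "t 2 1 c id (pt [\<one>\<^bsub>B\<^esub>] \<otimes>\<^bsub>T\<^esub> pt [x, y]) = t 1 1 id (\<lambda>y. pt [\<one>\<^bsub>B\<^esub>] \<otimes>\<^bsub>T\<^esub> y) (pt [x, y])"
      using S.tens_pt[OF c_lin id_lin[of 1], of "[\<one>\<^bsub>B\<^esub>, x]" "[y]"]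
        S.tens_pt[OF id_lin[of 1] E, of "[x]" "[y]"] xy
      by (simp add: pt_mults c_unit)
  qed
qed

lemma swap_one_right:
  assumes s: "s \<in> carrier (tp 2)"
  shows "t 1 2 id c (s \<otimes>\<^bsub>T\<^esub> pt [\<one>\<^bsub>B\<^esub>]) = t 1 1 (\<lambda>y. y \<otimes>\<^bsub>T\<^esub> pt [\<one>\<^bsub>B\<^esub>]) id s"
proof -
  note E = mult_right_linear[OF pt1[OF B.one_closed], where j = 1, unfolded nat_plus]
  note E2 = mult_right_linear[OF pt1[OF B.one_closed], where j = 2, unfolded nat_plus]
  show ?thesis
  proof (rule tp2_linear_eqI[OF tp_module linear_map_comp[OF E2 tens_lins(2)]
      S.linear_tens[OF E id_lin[of 1], unfolded nat_plus] _ s])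
    fix x y assume xy: "x \<in> carrier B" "y \<in> carrier B"
    show "t 1 2 id c (pt [x, y] \<otimes>\<^bsub>T\<^esub> pt [\<one>\<^bsub>B\<^esub>]) = t 1 1 (\<lambda>y. y \<otimes>\<^bsub>T\<^esub> pt [\<one>\<^bsub>B\<^esub>]) id (pt [x, y])"
      using S.tens_pt[OF id_lin[of 1] c_lin, of "[x]" "[y, \<one>\<^bsub>B\<^esub>]"]
        S.tens_pt[OF E id_lin[of 1], of "[x]" "[y]"] xy
      by (simp add: pt_mults c_unit)
  qed
qed

text \<open>Placing a unit at an outer end is written as a map on the adjacent tensor factor, so
  that every term of the comparison has the shape f \<otimes> id or id \<otimes> f.\<close>

lemma tens_outer:
  assumes s: "s \<in> carrier (tp 2)"
  shows "s \<otimes>\<^bsub>T\<^esub> pt [\<one>\<^bsub>B\<^esub>] = t 1 1 id (\<lambda>y. y \<otimes>\<^bsub>T\<^esub> pt [\<one>\<^bsub>B\<^esub>]) s"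
    "pt [\<one>\<^bsub>B\<^esub>] \<otimes>\<^bsub>T\<^esub> s = t 1 1 (\<lambda>y. pt [\<one>\<^bsub>B\<^esub>] \<otimes>\<^bsub>T\<^esub> y) id s"
proof -
  note R = mult_right_linear[OF pt1[OF B.one_closed], where j = 1, unfolded nat_plus]
  note R2 = mult_right_linear[OF pt1[OF B.one_closed], where j = 2, unfolded nat_plus]
  note E = mult_left_linear[OF pt1[OF B.one_closed], where k = 1, unfolded nat_plus]
  note E2 = mult_left_linear[OF pt1[OF B.one_closed], where k = 2, unfolded nat_plus]
  show "s \<otimes>\<^bsub>T\<^esub> pt [\<one>\<^bsub>B\<^esub>] = t 1 1 id (\<lambda>y. y \<otimes>\<^bsub>T\<^esub> pt [\<one>\<^bsub>B\<^esub>]) s"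
  proof (rule tp2_linear_eqI[OF tp_module R2 S.linear_tens[OF id_lin[of 1] R, unfolded nat_plus] _ s])
    fix x y assume xy: "x \<in> carrier B" "y \<in> carrier B"
    show "pt [x, y] \<otimes>\<^bsub>T\<^esub> pt [\<one>\<^bsub>B\<^esub>] = t 1 1 id (\<lambda>y. y \<otimes>\<^bsub>T\<^esub> pt [\<one>\<^bsub>B\<^esub>]) (pt [x, y])"
      using S.tens_pt[OF id_lin[of 1] R, of "[x]" "[y]"] xy by (simp add: pt_mults)
  qed
  show "pt [\<one>\<^bsub>B\<^esub>] \<otimes>\<^bsub>T\<^esub> s = t 1 1 (\<lambda>y. pt [\<one>\<^bsub>B\<^esub>] \<otimes>\<^bsub>T\<^esub> y) id s"
  proof (rule tp2_linear_eqI[OF tp_module E2 S.linear_tens[OF E id_lin[of 1], unfolded nat_plus] _ s])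
    fix x y assume xy: "x \<in> carrier B" "y \<in> carrier B"
    show "pt [\<one>\<^bsub>B\<^esub>] \<otimes>\<^bsub>T\<^esub> pt [x, y] = t 1 1 (\<lambda>y. pt [\<one>\<^bsub>B\<^esub>] \<otimes>\<^bsub>T\<^esub> y) id (pt [x, y])"
      using S.tens_pt[OF E id_lin[of 1], of "[x]" "[y]"] xy by (simp add: pt_mults)
  qed
qed

text \<open>The coalgebra axioms move \<Delta> through the braiding back onto x, where it is x
  \<otimes> 1 + 1 \<otimes> x. Flipping the units past the other factor leaves the primitivity
  equation in the tensor factor that receives x.\<close>

lemma comult_c_prim:
  assumes x: "x \<in> prim" and a: "a \<in> carrier B"
  shows "t 1 1 id D (c (pt [x, a])) =
      t 1 1 id (\<lambda>y. y \<otimes>\<^bsub>T\<^esub> pt [\<one>\<^bsub>B\<^esub>]) (c (pt [x, a])) \<oplus>\<^bsub>T\<^esub> t 1 1 id (\<lambda>y. pt [\<one>\<^bsub>B\<^esub>] \<otimes>\<^bsub>T\<^esub> y) (c (pt [x, a]))"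
    "t 1 1 D id (c (pt [a, x])) =
      t 1 1 (\<lambda>y. y \<otimes>\<^bsub>T\<^esub> pt [\<one>\<^bsub>B\<^esub>]) id (c (pt [a, x])) \<oplus>\<^bsub>T\<^esub> t 1 1 (\<lambda>y. pt [\<one>\<^bsub>B\<^esub>] \<otimes>\<^bsub>T\<^esub> y) id (c (pt [a, x]))"
proof -
  interpret T: ring T by (rule T_ring)
  have xB: "x \<in> carrier B" and Dx: "comult B x = pt [x, \<one>\<^bsub>B\<^esub>] \<oplus>\<^bsub>T\<^esub> pt [\<one>\<^bsub>B\<^esub>, x]"
    using x by (auto simp: primitives_iff)
  have cxa: "c (pt [x, a]) \<in> carrier (tp 2)" "c (pt [a, x]) \<in> carrier (tp 2)"
    using linear_mapD(1)[OF c_lin] pt2 xB a by blast+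
  have ax: "t 1 1 id D (c (pt [x, a])) = t 2 1 c id (t 1 2 id c (t 1 1 D id (pt [x, a])))"
    "t 1 1 D id (c (pt [a, x])) = t 1 2 id c (t 2 1 c id (t 1 1 id D (pt [a, x])))"
    using coalg pt2[OF xB a] pt2[OF a xB] by (simp_all add: braided_coalgebra_def Let_def)
  note o = pt1[OF B.one_closed]
  have "t 1 1 D id (pt [x, a]) = pt [x, \<one>\<^bsub>B\<^esub>, a] \<oplus>\<^bsub>T\<^esub> pt [\<one>\<^bsub>B\<^esub>, x, a]"
    using S.tens_pt[OF D_lin id_lin[of 1], of "[x]" "[a]"] xB a by (simp add: D_pt Dx T.l_distr pt_T pt_mults)
  then have "t 1 2 id c (t 1 1 D id (pt [x, a])) = t 1 2 id c (pt [x, \<one>\<^bsub>B\<^esub>, a]) \<oplus>\<^bsub>T\<^esub> t 1 2 id c (pt [\<one>\<^bsub>B\<^esub>, x, a])"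
    using linear_mapD(2)[OF tens_lins(2) pt3 pt3] xB a by simp
  also have "\<dots> = pt [x, a, \<one>\<^bsub>B\<^esub>] \<oplus>\<^bsub>T\<^esub> (pt [\<one>\<^bsub>B\<^esub>] \<otimes>\<^bsub>T\<^esub> c (pt [x, a]))"
    using S.tens_pt[OF id_lin[of 1] c_lin, of "[x]" "[\<one>\<^bsub>B\<^esub>, a]"] S.tens_pt[OF id_lin[of 1] c_lin, of "[\<one>\<^bsub>B\<^esub>]" "[x, a]"] xB a
    by (simp add: c_unit pt_mults)
  finally have "t 2 1 c id (t 1 2 id c (t 1 1 D id (pt [x, a]))) =
      t 2 1 c id (pt [x, a, \<one>\<^bsub>B\<^esub>]) \<oplus>\<^bsub>T\<^esub> t 2 1 c id (pt [\<one>\<^bsub>B\<^esub>] \<otimes>\<^bsub>T\<^esub> c (pt [x, a]))"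
    using linear_mapD(2)[OF tens_lins(1) pt3 tp_mult[OF o cxa(1), unfolded nat_plus]] xB a by simp
  moreover have "t 2 1 c id (pt [x, a, \<one>\<^bsub>B\<^esub>]) = c (pt [x, a]) \<otimes>\<^bsub>T\<^esub> pt [\<one>\<^bsub>B\<^esub>]"
    using S.tens_pt[OF c_lin id_lin[of 1], of "[x, a]" "[\<one>\<^bsub>B\<^esub>]"] xB a by simp
  ultimately show "t 1 1 id D (c (pt [x, a])) =
      t 1 1 id (\<lambda>y. y \<otimes>\<^bsub>T\<^esub> pt [\<one>\<^bsub>B\<^esub>]) (c (pt [x, a])) \<oplus>\<^bsub>T\<^esub> t 1 1 id (\<lambda>y. pt [\<one>\<^bsub>B\<^esub>] \<otimes>\<^bsub>T\<^esub> y) (c (pt [x, a]))"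
    by (simp only: ax swap_one_left[OF cxa(1), symmetric] tens_outer(1)[OF cxa(1), symmetric])
  have "t 1 1 id D (pt [a, x]) = pt [a, x, \<one>\<^bsub>B\<^esub>] \<oplus>\<^bsub>T\<^esub> pt [a, \<one>\<^bsub>B\<^esub>, x]"
    using S.tens_pt[OF id_lin[of 1] D_lin, of "[a]" "[x]"] xB a by (simp add: D_pt Dx T.r_distr pt_T pt_mults)
  then have "t 2 1 c id (t 1 1 id D (pt [a, x])) = t 2 1 c id (pt [a, x, \<one>\<^bsub>B\<^esub>]) \<oplus>\<^bsub>T\<^esub> t 2 1 c id (pt [a, \<one>\<^bsub>B\<^esub>, x])"
    using linear_mapD(2)[OF tens_lins(1) pt3 pt3] xB a by simp
  also have "\<dots> = (c (pt [a, x]) \<otimes>\<^bsub>T\<^esub> pt [\<one>\<^bsub>B\<^esub>]) \<oplus>\<^bsub>T\<^esub> pt [\<one>\<^bsub>B\<^esub>, a, x]"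
    using S.tens_pt[OF c_lin id_lin[of 1], of "[a, x]" "[\<one>\<^bsub>B\<^esub>]"] S.tens_pt[OF c_lin id_lin[of 1], of "[a, \<one>\<^bsub>B\<^esub>]" "[x]"] xB a
    by (simp add: c_unit pt_mults)
  finally have "t 1 2 id c (t 2 1 c id (t 1 1 id D (pt [a, x]))) =
      t 1 2 id c (c (pt [a, x]) \<otimes>\<^bsub>T\<^esub> pt [\<one>\<^bsub>B\<^esub>]) \<oplus>\<^bsub>T\<^esub> t 1 2 id c (pt [\<one>\<^bsub>B\<^esub>, a, x])"
    using linear_mapD(2)[OF tens_lins(2) tp_mult[OF cxa(2) o, unfolded nat_plus] pt3] xB a by simp
  moreover have "t 1 2 id c (pt [\<one>\<^bsub>B\<^esub>, a, x]) = pt [\<one>\<^bsub>B\<^esub>] \<otimes>\<^bsub>T\<^esub> c (pt [a, x])"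
    using S.tens_pt[OF id_lin[of 1] c_lin, of "[\<one>\<^bsub>B\<^esub>]" "[a, x]"] xB a by simp
  ultimately show "t 1 1 D id (c (pt [a, x])) =
      t 1 1 (\<lambda>y. y \<otimes>\<^bsub>T\<^esub> pt [\<one>\<^bsub>B\<^esub>]) id (c (pt [a, x])) \<oplus>\<^bsub>T\<^esub> t 1 1 (\<lambda>y. pt [\<one>\<^bsub>B\<^esub>] \<otimes>\<^bsub>T\<^esub> y) id (c (pt [a, x]))"
    by (simp only: ax swap_one_right[OF cxa(2), symmetric] tens_outer(2)[OF cxa(2), symmetric])
qed

end

lemma linear_space_pairI: "module K V \<Longrightarrow> module K W \<Longrightarrow> linear_space_pair K V W"
  by (simp add: linear_space_pair_def linear_space_def)

context bialg
begin

text \<open>The projection is \<open>r = id - s d\<close> with \<open>d\<close> the primitivity defect and \<open>s\<close> a generalised inverse of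
  \<open>d\<close>. It replaces the exactness of the tensor product in the proof that \<open>c(P \<otimes> B) \<subseteq> B \<otimes> P\<close>.\<close>

lemma c_prim_projection:
  assumes K: "field K"
  obtains r where "linear_map K B B r" "\<And>x. x \<in> carrier B \<Longrightarrow> r x \<in> prim"
    "\<And>x a. x \<in> prim \<Longrightarrow> a \<in> carrier B \<Longrightarrow> t 1 1 id (tens_map K B B 1 r) (c (pt [x, a])) = c (pt [x, a])"
    "\<And>x a. x \<in> prim \<Longrightarrow> a \<in> carrier B \<Longrightarrow> t 1 1 (tens_map K B B 1 r) id (c (pt [a, x])) = c (pt [a, x])"
proof -
  obtain d where d: "linear_map K B (tp 2) d" "\<And>x. x \<in> carrier B \<Longrightarrow> x \<in> prim \<longleftrightarrow> d x = \<zero>\<^bsub>T\<^esub>"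
    "\<And>x. x \<in> carrier B \<Longrightarrow> comult B x = d x \<oplus>\<^bsub>T\<^esub> (pt [x, \<one>\<^bsub>B\<^esub>] \<oplus>\<^bsub>T\<^esub> pt [\<one>\<^bsub>B\<^esub>, x])"
    by (rule prim_defect) (rule that)
  obtain s where s: "linear_map K (tp 2) B s" "\<And>x. x \<in> carrier B \<Longrightarrow> d (s (d x)) = d x"
    using ex_generalized_inverse[OF K linear_space_pairI[OF module_axioms tp_module] d(1)] by blast
  interpret T: module K T by (rule T_module)
  interpret T2: module K "tp 2" by (rule tp_module)
  interpret T3: module K "tp 3" by (rule tp_module)
  note mone = R.add.inv_closed[OF R.one_closed]
  define r where "r x = x \<oplus>\<^bsub>B\<^esub> (\<ominus>\<^bsub>K\<^esub> \<one>\<^bsub>K\<^esub>) \<odot>\<^bsub>B\<^esub> s (d x)" for x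
  note sd = linear_map_comp[OF d(1) s(1)]
  have idB: "linear_map K B B (\<lambda>x. x)" by (simp add: linear_map_def)
  have r: "linear_map K B B r"
    unfolding r_def by (rule linear_map_plus[OF module_axioms idB linear_map_scale[OF module_axioms sd mone]])
  have r_dec: "r x \<oplus>\<^bsub>B\<^esub> s (d x) = x" if x: "x \<in> carrier B" for x
    unfolding r_def uminus_smult[OF linear_mapD(1)[OF sd x], symmetric]
    using linear_mapD(1)[OF sd x] x by (simp add: M.add.m_assoc M.l_neg)
  have r_prim: "r x \<in> prim" if x: "x \<in> carrier B" for x
  proof -
    have dx: "d x \<in> carrier (tp 2)" and sx: "s (d x) \<in> carrier B"
      using linear_mapD(1)[OF d(1) x] linear_mapD(1)[OF sd x] .
    have "d (r x) = d x \<oplus>\<^bsub>T\<^esub> (\<ominus>\<^bsub>K\<^esub> \<one>\<^bsub>K\<^esub>) \<odot>\<^bsub>T\<^esub> d x"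
      unfolding r_def using linear_mapD(2)[OF d(1) x smult_closed[OF mone sx]] linear_mapD(3)[OF d(1) mone sx] s(2)[OF x] by simp
    also have "\<dots> = \<zero>\<^bsub>T\<^esub>" using tp_T[OF dx] by (simp add: T.uminus_smult[symmetric] T.M.r_neg)
    finally show ?thesis using d(2)[OF linear_mapD(1)[OF r x]] by simp
  qed
  define r1 where "r1 = tens_map K B B 1 r"
  have r1: "linear_map K (tp 1) (tp 1) r1" unfolding r1_def by (rule S.linear_tens_map[OF r])
  have r1_pt: "r1 (pt [x]) = pt [r x]" if "x \<in> carrier B" for x
    unfolding r1_def using S.tens_map_pt[OF r, of "[x]" 1] that by simp
  \<comment> \<open>\<open>\<delta>\<close> and the map \<open>S1\<close> below are \<open>d\<close>
    and \<open>s\<close> read as maps between tensor powers, the only maps that \<open>tens\<close>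
    combines.\<close>
  define \<delta> where "\<delta> = lin_ext K B B 1 (\<lambda>w. d (w ! 0))"
  have \<delta>: "linear_map K (tp 1) (tp 2) \<delta>"
    unfolding \<delta>_def by (rule S.linear_lin_ext[OF multilin_1[OF d(1)]])
  have \<delta>_pt: "\<delta> (pt [x]) = d x" if "x \<in> carrier B" for x
    unfolding \<delta>_def using that by (subst S.lin_ext_pt[OF S.multilin_tp_T[OF multilin_1[OF d(1)]]]) auto
  define S1 where "S1 y = pt [s y]" for y
  have S1: "linear_map K (tp 2) (tp 1) S1"
    unfolding S1_def by (rule linear_map_comp[OF s(1) pt_lin])
  \<comment> \<open>\<open>R\<close> and \<open>E\<close> are y \<mapsto> y \<otimes> 1 and y
    \<mapsto> 1 \<otimes> y in degree one, and \<open>RE\<close> is their sum. There \<Delta> splits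
    as \<open>\<delta>\<close> plus \<open>RE\<close>, and the identity as \<open>r1\<close> plus
    \<open>S1\<close> after \<open>\<delta>\<close>.\<close>
  define R where "R y = y \<otimes>\<^bsub>T\<^esub> pt [\<one>\<^bsub>B\<^esub>]" for y
  define E where "E y = pt [\<one>\<^bsub>B\<^esub>] \<otimes>\<^bsub>T\<^esub> y" for y
  define RE where "RE y = R y \<oplus>\<^bsub>tp 2\<^esub> E y" for y
  have R: "linear_map K (tp 1) (tp 2) R" and E: "linear_map K (tp 1) (tp 2) E"
    unfolding R_def E_def
    using mult_right_linear[OF pt1[OF B.one_closed], where j = 1, unfolded nat_plus]
      mult_left_linear[OF pt1[OF B.one_closed], where k = 1, unfolded nat_plus] by simp_all
  have RE: "linear_map K (tp 1) (tp 2) RE"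
    unfolding RE_def by (rule linear_map_plus[OF tp_module R E])
  have eqRE: "RE (pt w) = R (pt w) \<oplus>\<^bsub>T\<^esub> E (pt w)" for w by (simp add: RE_def)
  have eqD: "D (pt w) = \<delta> (pt w) \<oplus>\<^bsub>T\<^esub> RE (pt w)" if "w \<in> W" "length w = 1" for w
    using that by (auto simp: length_1 D_pt \<delta>_pt RE_def R_def E_def pt_mults d(3))
  note S\<delta> = linear_map_comp[OF \<delta> S1]
  have eqI: "id (pt w) = r1 (pt w) \<oplus>\<^bsub>T\<^esub> S1 (\<delta> (pt w))" if w: "w \<in> W" "length w = 1" for w
  proof -
    obtain x where x: "w = [x]" "x \<in> carrier B" using w by (auto simp: length_1)
    have "pt [x] = pt [r x \<oplus>\<^bsub>B\<^esub> s (d x)]" using r_dec[OF x(2)] by simp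
    also have "\<dots> = pt [r x] \<oplus>\<^bsub>T\<^esub> pt [s (d x)]"
      by (rule pt_bilinear(1)[OF linear_mapD(1)[OF r x(2)] linear_mapD(1)[OF sd x(2)]])
    finally show ?thesis unfolding x(1) r1_pt[OF x(2)] S1_def \<delta>_pt[OF x(2)] id_apply .
  qed
  have cancel: "z = \<zero>\<^bsub>tp 3\<^esub>" if "z \<in> carrier (tp 3)" "y \<in> carrier (tp 3)" "y = z \<oplus>\<^bsub>T\<^esub> y" for y z
    using T3.M.add.r_cancel_one[OF that(2,1)] that(3) by simp
  \<comment> \<open>The hypothesis says that id \<otimes> \<Delta> and id \<otimes> RE agree at
    \<tau>, hence id \<otimes> \<delta> vanishes there. Composing with id \<otimes> S1 kills the
    second part of the splitting of the identity, so \<tau> equals its r1 part.\<close>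
  have right: "t 1 1 id r1 \<tau> = \<tau>"
    if \<tau>: "\<tau> \<in> carrier (tp 2)" and h: "t 1 1 id D \<tau> = t 1 1 id R \<tau> \<oplus>\<^bsub>T\<^esub> t 1 1 id E \<tau>" for \<tau>
  proof -
    have \<tau>': "\<tau> \<in> carrier (tp (1 + 1))" using \<tau> by (simp only: nat_plus)
    note L = linear_mapD(1)[OF S.linear_tens[OF id_lin[of 1] \<delta>] \<tau>', unfolded nat_plus]
      linear_mapD(1)[OF S.linear_tens[OF id_lin[of 1] RE] \<tau>', unfolded nat_plus]
    have "t 1 1 id RE \<tau> = t 1 1 id R \<tau> \<oplus>\<^bsub>T\<^esub> t 1 1 id E \<tau>"
      by (rule tens_add_right[OF id_lin R E RE eqRE \<tau>'])
    then have "t 1 1 id RE \<tau> = t 1 1 id \<delta> \<tau> \<oplus>\<^bsub>T\<^esub> t 1 1 id RE \<tau>"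
      using h tens_add_right[OF id_lin \<delta> RE D_lin eqD \<tau>'] by simp
    then have z: "t 1 1 id \<delta> \<tau> = \<zero>\<^bsub>tp 3\<^esub>" by (rule cancel[OF L])
    have "t 1 1 id (\<lambda>x. S1 (\<delta> x)) \<tau> = t 1 2 id S1 (t 1 1 id \<delta> \<tau>)"
      using tens_comp[OF id_lin[of 1] \<delta> id_lin[of 1] S1 \<tau>'] by (simp add: id_def)
    also have "\<dots> = \<zero>\<^bsub>T\<^esub>" unfolding z
      using linear_map_zero[OF tp_module tp_module S.linear_tens[OF id_lin[of 1] S1, unfolded nat_plus]] by simp
    finally have "t 1 1 id (\<lambda>x. S1 (\<delta> x)) \<tau> = \<zero>\<^bsub>T\<^esub>" .
    then show ?thesis
      using tens_add_right[OF id_lin r1 S\<delta> id_lin eqI \<tau>'] tens_id_id[OF \<tau>']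
        tp_T[OF linear_mapD(1)[OF S.linear_tens[OF id_lin[of 1] r1] \<tau>']] by (simp add: id_def)
  qed
  have left: "t 1 1 r1 id \<tau> = \<tau>"
    if \<tau>: "\<tau> \<in> carrier (tp 2)" and h: "t 1 1 D id \<tau> = t 1 1 R id \<tau> \<oplus>\<^bsub>T\<^esub> t 1 1 E id \<tau>" for \<tau>
  proof -
    have \<tau>': "\<tau> \<in> carrier (tp (1 + 1))" using \<tau> by (simp only: nat_plus)
    note L = linear_mapD(1)[OF S.linear_tens[OF \<delta> id_lin[of 1]] \<tau>', unfolded nat_plus]
      linear_mapD(1)[OF S.linear_tens[OF RE id_lin[of 1]] \<tau>', unfolded nat_plus]
    have "t 1 1 RE id \<tau> = t 1 1 R id \<tau> \<oplus>\<^bsub>T\<^esub> t 1 1 E id \<tau>"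
      by (rule tens_add_left[OF id_lin R E RE eqRE \<tau>'])
    then have "t 1 1 RE id \<tau> = t 1 1 \<delta> id \<tau> \<oplus>\<^bsub>T\<^esub> t 1 1 RE id \<tau>"
      using h tens_add_left[OF id_lin \<delta> RE D_lin eqD \<tau>'] by simp
    then have z: "t 1 1 \<delta> id \<tau> = \<zero>\<^bsub>tp 3\<^esub>" by (rule cancel[OF L])
    have "t 1 1 (\<lambda>x. S1 (\<delta> x)) id \<tau> = t 2 1 S1 id (t 1 1 \<delta> id \<tau>)"
      using tens_comp[OF \<delta> id_lin[of 1] S1 id_lin[of 1] \<tau>'] by (simp add: id_def)
    also have "\<dots> = \<zero>\<^bsub>T\<^esub>" unfolding z
      using linear_map_zero[OF tp_module tp_module S.linear_tens[OF S1 id_lin[of 1], unfolded nat_plus]] by simp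
    finally have "t 1 1 (\<lambda>x. S1 (\<delta> x)) id \<tau> = \<zero>\<^bsub>T\<^esub>" .
    then show ?thesis
      using tens_add_left[OF id_lin r1 S\<delta> id_lin eqI \<tau>'] tens_id_id[OF \<tau>']
        tp_T[OF linear_mapD(1)[OF S.linear_tens[OF r1 id_lin[of 1]] \<tau>']] by (simp add: id_def)
  qed
  show thesis
  proof (rule that[OF r r_prim])
    fix x a assume x: "x \<in> prim" and a: "a \<in> carrier B"
    show "t 1 1 id (tens_map K B B 1 r) (c (pt [x, a])) = c (pt [x, a])"
      unfolding r1_def[symmetric]
      by (rule right[OF linear_mapD(1)[OF c_lin pt2[OF prim_B[OF x] a]]])
         (use comult_c_prim(1)[OF x a] in \<open>simp add: R_def[abs_def] E_def[abs_def]\<close>)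
    show "t 1 1 (tens_map K B B 1 r) id (c (pt [a, x])) = c (pt [a, x])"
      unfolding r1_def[symmetric]
      by (rule left[OF linear_mapD(1)[OF c_lin pt2[OF a prim_B[OF x]]]])
         (use comult_c_prim(2)[OF x a] in \<open>simp add: R_def[abs_def] E_def[abs_def]\<close>)
  qed
qed

section \<open>The restricted braiding on the primitive elements\<close>

abbreviation "P \<equiv> primitive_module K B"
abbreviation "j \<equiv> tens_map K (primitive_module K B) B 2 (\<lambda>x. x)"

lemma P_sel [simp]: "carrier P = prim" "add P = add B" "zero P = zero B" "smult P = smult B"
  by (simp_all add: primitive_module_def module.truncate_def)

lemma P_module: "module K P"
  by (rule subspace_module[OF prim_subspace]) simp_all

lemma incl_lin: "linear_map K P B (\<lambda>x. x)"
  by (rule linear_mapI) (simp_all add: prim_B)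

lemma j_lin: "linear_map K (tensor_power K P 2) (tp 2) j"
proof -
  interpret PB: linear_space_pair K P B by (rule linear_space_pairI[OF P_module module_axioms])
  show ?thesis by (rule PB.linear_tens_map[OF incl_lin])
qed

text \<open>For primitive x and y, the projection fixes c(x \<otimes> y) in the right factor because
  x is primitive, and in the left factor because y is. So r \<otimes> r fixes it, and r \<otimes> r
  factors through P \<otimes> P.\<close>

lemma c_prim_image:
  assumes K: "field K" and w: "w \<in> carrier (tensor_power K P 2)"
  shows "c (j w) \<in> j ` carrier (tensor_power K P 2)"
proof -
  interpret PB: linear_space_pair K P B by (rule linear_space_pairI[OF P_module module_axioms])
  interpret BP: linear_space_pair K B P by (rule linear_space_pairI[OF module_axioms P_module])
  obtain r where r: "linear_map K B B r" "\<And>x. x \<in> carrier B \<Longrightarrow> r x \<in> prim"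
    "\<And>x a. x \<in> prim \<Longrightarrow> a \<in> carrier B \<Longrightarrow> t 1 1 id (tens_map K B B 1 r) (c (pt [x, a])) = c (pt [x, a])"
    "\<And>x a. x \<in> prim \<Longrightarrow> a \<in> carrier B \<Longrightarrow> t 1 1 (tens_map K B B 1 r) id (c (pt [a, x])) = c (pt [a, x])"
    by (rule c_prim_projection[OF K]) (rule that)
  let ?r = "tens_map K B B 1 r"
  have rP: "linear_map K B P r"
    by (rule linear_mapI) (simp_all add: linear_mapD[OF r(1)] r(2))
  note r1 = S.linear_tens_map[OF r(1), of 1]
  note jc = linear_map_comp[OF j_lin c_lin]
  \<comment> \<open>Read as a map into \<open>P\<close>, \<open>r\<close> carries tensors of B to
    tensors of P; followed by \<open>j\<close> this is r \<otimes> r on B \<otimes> B.\<close>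
  have jr: "j (tens_map K B P 2 r s) = t 1 1 ?r ?r s" if s: "s \<in> carrier (tp 2)" for s
  proof (rule tp2_linear_eqI[OF tp_module linear_map_comp[OF BP.linear_tens_map[OF rP] j_lin]
        S.linear_tens[OF r1 r1, unfolded nat_plus] _ s])
    fix x y assume xy: "x \<in> carrier B" "y \<in> carrier B"
    show "j (tens_map K B P 2 r (pt [x, y])) = t 1 1 ?r ?r (pt [x, y])"
      using BP.tens_map_pt[OF rP, of "[x, y]" 2] PB.tens_map_pt[OF incl_lin, of "[r x, r y]" 2]
        S.tens_pt[OF r1 r1, of "[x]" "[y]"] S.tens_map_pt[OF r(1), of "[x]" 1] S.tens_map_pt[OF r(1), of "[y]" 1]
        xy r(2)[OF xy(1)] r(2)[OF xy(2)] prim_B[OF r(2)[OF xy(1)]] prim_B[OF r(2)[OF xy(2)]]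
      by (simp add: pt_mults)
  qed
  let ?Q = "tensor_power K P 2"
  interpret Q: module K ?Q by (rule PB.V.tp_module)
  have "\<exists>v\<in>carrier ?Q. j v = c (j w)"
    using w
  proof (induction rule: PB.V.tp_induct)
    case zero
    have "j \<zero>\<^bsub>?Q\<^esub> = c (j \<zero>\<^bsub>?Q\<^esub>)"
      using linear_map_zero[OF PB.V.tp_module tp_module j_lin] linear_map_zero[OF PB.V.tp_module tp_module jc] by simp
    then show ?case using Q.M.zero_closed by auto
  next
    case (add X Y)
    then obtain v v' where v: "v \<in> carrier ?Q" "j v = c (j X)" "v' \<in> carrier ?Q" "j v' = c (j Y)" by blast
    show ?case
      by (rule bexI[of _ "v \<oplus>\<^bsub>?Q\<^esub> v'"])
         (use linear_mapD(2)[OF j_lin v(1,3)] linear_mapD(2)[OF jc add(1,2)] v Q.M.add.m_closed[OF v(1,3)] in simp_all)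
  next
    case (pt a w)
    then obtain x y where xy: "w = [x, y]" "x \<in> prim" "y \<in> prim" by (auto simp: length_2)
    note xB = prim_B[OF xy(2)] and yB = prim_B[OF xy(3)]
    let ?s = "c (pt [x, y])"
    have s: "?s \<in> carrier (tp 2)" by (rule linear_mapD(1)[OF c_lin pt2[OF xB yB]])
    have s': "?s \<in> carrier (tp (1 + 1))" using s by (simp only: nat_plus)
    let ?v = "tens_map K B P 2 r ?s"
    have v: "?v \<in> carrier ?Q" by (rule linear_mapD(1)[OF BP.linear_tens_map[OF rP] s])
    have "j ?v = t 1 1 ?r ?r ?s" by (rule jr[OF s])
    also have "\<dots> = t 1 1 ?r id (t 1 1 id ?r ?s)"
      using tens_comp[OF id_lin[of 1] r1 r1 id_lin[of 1] s'] by (simp add: id_def)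
    also have "\<dots> = ?s" by (simp only: r(3)[OF xy(2) yB] r(4)[OF xy(3) xB])
    finally have jv: "j ?v = c (j (PB.V.pt w))"
      using PB.tens_map_pt[OF incl_lin, of w 2] xy by simp
    have w2: "PB.V.pt w \<in> carrier ?Q" by (rule PB.V.pt_tp[OF pt(2,3)])
    show ?case
      by (rule bexI[of _ "a \<odot>\<^bsub>?Q\<^esub> ?v"])
         (use linear_mapD(3)[OF j_lin pt(1) v] linear_mapD(3)[OF jc pt(1) w2] jv Q.smult_closed[OF pt(1) v] in simp_all)
  qed
  then show ?thesis by (metis image_eqI)
qed

lemma infinitesimal_sel [simp]:
  "carrier (infinitesimal_part K B) = prim" "add (infinitesimal_part K B) = add B"
  "smult (infinitesimal_part K B) = smult B"
  by (simp_all add: infinitesimal_part_def primitive_module_def module.truncate_def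
      module.extend_def braided_space.fields_def Let_def)

text \<open>\<open>inv_into\<close> returns a genuine preimage only on the image of
  \<open>j\<close>; membership there is \<open>c_prim_image\<close>.\<close>

lemma infinitesimal_braiding:
  assumes K: "field K" and w: "w \<in> carrier (tensor_power K P 2)"
  shows "braiding (infinitesimal_part K B) w \<in> carrier (tensor_power K P 2)"
    "j (braiding (infinitesimal_part K B) w) = c (j w)"
proof -
  have eq: "braiding (infinitesimal_part K B) w = inv_into (carrier (tensor_power K P 2)) j (c (j w))"
    by (simp add: infinitesimal_part_def module.extend_def braided_space.fields_def Let_def)
  show "braiding (infinitesimal_part K B) w \<in> carrier (tensor_power K P 2)"
    "j (braiding (infinitesimal_part K B) w) = c (j w)"
    unfolding eq using c_prim_image[OF K w] by (rule inv_into_into, rule f_inv_into_f)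
qed

end

section \<open>Algebra maps that are compatible with the structure on generators\<close>

lemma base_algebra_sel [simp]:
  "carrier (base_algebra K) = carrier K" "add (base_algebra K) = add K" "zero (base_algebra K) = zero K"
  "smult (base_algebra K) = mult K" "mult (base_algebra K) = mult K" "one (base_algebra K) = one K"
  by (simp_all add: base_algebra_def ring.extend_def module.fields_def)

lemma base_algebra_module: assumes "cring K" shows "module K (base_algebra K)"
proof -
  interpret cring K by fact
  show ?thesis
  proof (rule moduleI)
    show "abelian_group (base_algebra K)"
      by (rule abelian_groupI) (auto simp: a_ac intro: add.l_inv_ex)
  qed (simp_all add: is_cring l_distr r_distr m_assoc)
qed

section \<open>Agreement sets and preimages as subspaces\<close>

lemma linear_eq_subspace:
  assumes V: "module K V" and W: "module K W" and f: "linear_map K V W f" and g: "linear_map K V W g"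
  shows "subspace K V {x \<in> carrier V. f x = g x}"
proof -
  interpret V: module K V by fact
  show ?thesis unfolding subspace_def
    using linear_map_zero[OF V W f] linear_map_zero[OF V W g]
    by (auto simp: linear_mapD[OF f] linear_mapD[OF g])
qed

lemma linear_vimage_subspace:
  assumes V: "module K V" and W: "module K W" and f: "linear_map K V W f" and S: "subspace K W S"
  shows "subspace K V {x \<in> carrier V. f x \<in> S}"
proof -
  interpret V: module K V by fact
  show ?thesis using S linear_map_zero[OF V W f] unfolding subspace_def
    by (auto simp: linear_mapD[OF f])
qed

lemma subspace_Ball:
  assumes "module K V" "\<And>i. i \<in> I \<Longrightarrow> subspace K V {x \<in> carrier V. Q i x}"
  shows "subspace K V {x \<in> carrier V. \<forall>i\<in>I. Q i x}"
proof -
  interpret V: module K V by fact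
  show ?thesis using assms(2) unfolding subspace_def by auto
qed

lemma subspace_conj:
  assumes "subspace K V {x \<in> carrier V. Q x}" "subspace K V {x \<in> carrier V. R x}"
  shows "subspace K V {x \<in> carrier V. Q x \<and> R x}"
  using assms unfolding subspace_def by auto

lemma subspaceD:
  assumes "subspace K V S"
  shows "\<zero>\<^bsub>V\<^esub> \<in> S" "x \<in> S \<Longrightarrow> y \<in> S \<Longrightarrow> x \<oplus>\<^bsub>V\<^esub> y \<in> S"
    "a \<in> carrier K \<Longrightarrow> x \<in> S \<Longrightarrow> a \<odot>\<^bsub>V\<^esub> x \<in> S"
  using assms by (simp_all add: subspace_def)

context linear_space
begin

text \<open>For X inside V this is the image of V \<otimes> span X in V \<otimes> V. Encoding it as
  an intersection of subspaces keeps everything in the tensor square of V and makes minimality the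
  induction rule \<open>right_span_least\<close>.\<close>

definition right_span :: "'v set \<Rightarrow> ('k, 'v) tensor set" where
  "right_span X = {s \<in> carrier (tp 2). \<forall>S. subspace K (tp 2) S \<and> (\<forall>z\<in>carrier V. \<forall>x\<in>X. pt [z, x] \<in> S) \<longrightarrow> s \<in> S}"

lemma right_spanI:
  assumes "s \<in> carrier (tp 2)"
    and "\<And>S. subspace K (tp 2) S \<Longrightarrow> (\<And>z x. z \<in> carrier V \<Longrightarrow> x \<in> X \<Longrightarrow> pt [z, x] \<in> S) \<Longrightarrow> s \<in> S"
  shows "s \<in> right_span X"
  unfolding right_span_def using assms by simp

lemma right_spanD:
  assumes "s \<in> right_span X" "subspace K (tp 2) S" "\<And>z x. z \<in> carrier V \<Longrightarrow> x \<in> X \<Longrightarrow> pt [z, x] \<in> S"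
  shows "s \<in> S"
  using assms unfolding right_span_def by simp

lemma right_span_tp: "s \<in> right_span X \<Longrightarrow> s \<in> carrier (tp 2)"
  by (simp add: right_span_def)

lemma right_span_subspace: "subspace K (tp 2) (right_span X)"
proof -
  interpret M: module K "tp 2" by (rule tp_module)
  show ?thesis unfolding subspace_def
  proof (intro conjI ballI)
    show "right_span X \<subseteq> carrier (tp 2)" using right_span_tp by blast
    show "\<zero>\<^bsub>tp 2\<^esub> \<in> right_span X"
      by (rule right_spanI[OF M.M.zero_closed], rule subspaceD(1))
    show "x \<oplus>\<^bsub>tp 2\<^esub> y \<in> right_span X" if "x \<in> right_span X" "y \<in> right_span X" for x y
      by (rule right_spanI[OF M.M.add.m_closed[OF right_span_tp[OF that(1)] right_span_tp[OF that(2)]]],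
          rule subspaceD(2), assumption, rule right_spanD[OF that(1)], assumption+, rule right_spanD[OF that(2)])
    show "a \<odot>\<^bsub>tp 2\<^esub> x \<in> right_span X" if "a \<in> carrier K" "x \<in> right_span X" for a x
      by (rule right_spanI[OF M.smult_closed[OF that(1) right_span_tp[OF that(2)]]],
          rule subspaceD(3)[OF _ that(1)], assumption, rule right_spanD[OF that(2)])
  qed
qed

lemma right_span_gen: "X \<subseteq> carrier V \<Longrightarrow> z \<in> carrier V \<Longrightarrow> x \<in> X \<Longrightarrow> pt [z, x] \<in> right_span X"
  by (rule right_spanI) (auto intro: pt2)

lemma right_span_least:
  assumes "s \<in> right_span X" "subspace K (tp 2) {s \<in> carrier (tp 2). Q s}"
    "\<And>z x. z \<in> carrier V \<Longrightarrow> x \<in> X \<Longrightarrow> Q (pt [z, x])" "X \<subseteq> carrier V"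
  shows "Q s"
proof -
  have "s \<in> {s \<in> carrier (tp 2). Q s}"
    by (rule right_spanD[OF assms(1,2)]) (use assms(3,4) pt2 in blast)
  then show ?thesis by simp
qed

lemma pt_left_lin: "x \<in> carrier V \<Longrightarrow> linear_map K V (tp 2) (\<lambda>y. pt [x, y])"
  and pt_right_lin: "x \<in> carrier V \<Longrightarrow> linear_map K V (tp 2) (\<lambda>y. pt [y, x])"
  by (rule linear_mapI; simp add: pt2 pt_bilinear)+

end

section \<open>Algebra maps between braided bialgebras\<close>

locale bialg_hom = A: bialg K A + B: bialg K B
  for K :: "'k ring" and A :: "('k, 'a, 'm) braided_bialg_scheme" and B :: "('k, 'b, 'n) braided_bialg_scheme" +
  fixes f :: "'a \<Rightarrow> 'b"
  assumes alg_map: "algebra_map K A B f"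
begin

sublocale AB: linear_space_pair K A B ..

abbreviation "f_ten n \<equiv> tens_map K A B n f"

lemma f_lin: "linear_map K A B f" and f_hom: "f \<in> ring_hom A B"
  using alg_map by (simp_all add: algebra_map_def)

lemma f_B: "x \<in> carrier A \<Longrightarrow> f x \<in> carrier B"
  by (rule linear_mapD(1)[OF f_lin])

lemma f_mult: "x \<in> carrier A \<Longrightarrow> y \<in> carrier A \<Longrightarrow> f (x \<otimes>\<^bsub>A\<^esub> y) = f x \<otimes>\<^bsub>B\<^esub> f y"
  and f_one: "f \<one>\<^bsub>A\<^esub> = \<one>\<^bsub>B\<^esub>"
  using f_hom by (simp_all add: ring_hom_mult ring_hom_one)

lemma f_ten_lin: "linear_map K (A.tp n) (B.tp n) (f_ten n)"
  by (rule AB.linear_tens_map[OF f_lin])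

lemma f_ten_pt:
  "x \<in> carrier A \<Longrightarrow> f_ten 1 (A.pt [x]) = B.pt [f x]"
  "x \<in> carrier A \<Longrightarrow> y \<in> carrier A \<Longrightarrow> f_ten 2 (A.pt [x, y]) = B.pt [f x, f y]"
  by (subst AB.tens_map_pt[OF f_lin]; simp)+

lemma f_ten_id: "f_ten n (id s) = id (f_ten n s)"
  by simp

lemma f_ten_m: "s \<in> carrier (A.tp 2) \<Longrightarrow> f_ten 1 (A.m s) = B.m (f_ten 2 s)"
  by (rule A.tp2_linear_eqI[OF B.tp_module linear_map_comp[OF A.m_lin f_ten_lin] linear_map_comp[OF f_ten_lin B.m_lin]])
     (simp_all add: A.m_pt B.m_pt f_ten_pt f_B f_mult)

lemma f_ten_id_m: "s \<in> carrier (A.tp 3) \<Longrightarrow> f_ten 2 (A.t 1 2 id A.m s) = B.t 1 2 id B.m (f_ten 3 s)"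
  using tens_natural[OF AB.linear_space_pair_axioms f_lin A.id_lin[of 1] A.m_lin B.id_lin[of 1] B.m_lin f_ten_id f_ten_m, unfolded nat_plus] .

lemma f_ten_m_id: "s \<in> carrier (A.tp 3) \<Longrightarrow> f_ten 2 (A.t 2 1 A.m id s) = B.t 2 1 B.m id (f_ten 3 s)"
  using tens_natural[OF AB.linear_space_pair_axioms f_lin A.m_lin A.id_lin[of 1] B.m_lin B.id_lin[of 1] f_ten_m f_ten_id, unfolded nat_plus] .

lemma f_ten_m_m: "s \<in> carrier (A.tp 4) \<Longrightarrow> f_ten 2 (A.t 2 2 A.m A.m s) = B.t 2 2 B.m B.m (f_ten 4 s)"
  using tens_natural[OF AB.linear_space_pair_axioms f_lin A.m_lin A.m_lin B.m_lin B.m_lin f_ten_m f_ten_m, unfolded nat_plus] .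

lemma f_ten_split:
  "x \<in> carrier A \<Longrightarrow> s \<in> carrier (A.tp 2) \<Longrightarrow> f_ten 3 (A.pt [x] \<otimes>\<^bsub>A.T\<^esub> s) = B.pt [f x] \<otimes>\<^bsub>B.T\<^esub> f_ten 2 s"
  "x \<in> carrier A \<Longrightarrow> s \<in> carrier (A.tp 2) \<Longrightarrow> f_ten 3 (s \<otimes>\<^bsub>A.T\<^esub> A.pt [x]) = f_ten 2 s \<otimes>\<^bsub>B.T\<^esub> B.pt [f x]"
  using AB.tens_map_mult[OF f_lin A.pt1, where k = 2, unfolded nat_plus]
    AB.tens_map_mult[OF f_lin _ A.pt1, where j = 2, unfolded nat_plus]
  by (simp_all add: f_ten_pt)

definition good :: "('k, 'a) tensor \<Rightarrow> bool" where
  "good s \<longleftrightarrow> B.c (f_ten 2 s) = f_ten 2 (A.c s)"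

lemma good_subspace: "subspace K (A.tp 2) {s \<in> carrier (A.tp 2). good s}"
  unfolding good_def
  by (rule linear_eq_subspace[OF A.tp_module B.tp_module linear_map_comp[OF f_ten_lin B.c_lin] linear_map_comp[OF A.c_lin f_ten_lin]])

lemma good_one: "x \<in> carrier A \<Longrightarrow> good (A.pt [\<one>\<^bsub>A\<^esub>, x])" "x \<in> carrier A \<Longrightarrow> good (A.pt [x, \<one>\<^bsub>A\<^esub>])"
  by (simp_all add: good_def A.c_unit B.c_unit f_ten_pt f_B f_one)

lemma c_id_apply:
  "z \<in> carrier A \<Longrightarrow> s \<in> carrier (A.tp 2) \<Longrightarrow> A.t 2 1 A.c id (s \<otimes>\<^bsub>A.T\<^esub> A.pt [z]) = A.c s \<otimes>\<^bsub>A.T\<^esub> A.pt [z]"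
  "z \<in> carrier A \<Longrightarrow> s \<in> carrier (A.tp 2) \<Longrightarrow> A.t 1 2 id A.c (A.pt [z] \<otimes>\<^bsub>A.T\<^esub> s) = A.pt [z] \<otimes>\<^bsub>A.T\<^esub> A.c s"
  "z' \<in> carrier B \<Longrightarrow> s' \<in> carrier (B.tp 2) \<Longrightarrow> B.t 2 1 B.c id (s' \<otimes>\<^bsub>B.T\<^esub> B.pt [z']) = B.c s' \<otimes>\<^bsub>B.T\<^esub> B.pt [z']"
  "z' \<in> carrier B \<Longrightarrow> s' \<in> carrier (B.tp 2) \<Longrightarrow> B.t 1 2 id B.c (B.pt [z'] \<otimes>\<^bsub>B.T\<^esub> s') = B.pt [z'] \<otimes>\<^bsub>B.T\<^esub> B.c s'"
  using A.S.tens_mult[OF A.c_lin A.id_lin[of 1] _ A.pt1] A.S.tens_mult[OF A.id_lin[of 1] A.c_lin A.pt1]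
    B.S.tens_mult[OF B.c_lin B.id_lin[of 1] _ B.pt1] B.S.tens_mult[OF B.id_lin[of 1] B.c_lin B.pt1]
  by simp_all

text \<open>In c(xx' \<otimes> y) the letter x' passes y first, which \<open>g\<close> controls.
  What then stands next to x is arbitrary, which is why \<open>gx\<close> ranges over all second
  arguments.\<close>

lemma good_mult_left:
  assumes x: "x \<in> carrier A" and gx: "\<And>y. y \<in> carrier A \<Longrightarrow> good (A.pt [x, y])"
    and x': "x' \<in> carrier A" and y: "y \<in> carrier A" and g: "good (A.pt [x', y])"
  shows "good (A.pt [x \<otimes>\<^bsub>A\<^esub> x', y])"
proof -
  let ?s = "A.c (A.pt [x', y])"
  have s: "?s \<in> carrier (A.tp 2)" by (rule linear_mapD(1)[OF A.c_lin A.pt2[OF x' y]])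
  note ml = A.mult_left_linear[OF A.pt1[OF x], where k = 2, unfolded nat_plus]
  have "f_ten 3 (A.t 2 1 A.c id (A.pt [x] \<otimes>\<^bsub>A.T\<^esub> ?s)) = B.t 2 1 B.c id (f_ten 3 (A.pt [x] \<otimes>\<^bsub>A.T\<^esub> ?s))"
  proof (rule A.tp2_linear_eqI[OF B.tp_module linear_map_comp[OF linear_map_comp[OF ml A.tens_lins(1)] f_ten_lin]
       linear_map_comp[OF linear_map_comp[OF ml f_ten_lin] B.tens_lins(1)] _ s])
    fix v w assume v: "v \<in> carrier A" and w: "w \<in> carrier A"
    have e: "A.pt [x] \<otimes>\<^bsub>A.T\<^esub> A.pt [v, w] = A.pt [x, v] \<otimes>\<^bsub>A.T\<^esub> A.pt [w]" using x v w by (simp add: A.pt_mults)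
    note xv = A.pt2[OF x v] and cxv = linear_mapD(1)[OF A.c_lin A.pt2[OF x v]]
    show "f_ten 3 (A.t 2 1 A.c id (A.pt [x] \<otimes>\<^bsub>A.T\<^esub> A.pt [v, w])) = B.t 2 1 B.c id (f_ten 3 (A.pt [x] \<otimes>\<^bsub>A.T\<^esub> A.pt [v, w]))"
      unfolding e c_id_apply(1)[OF w xv] f_ten_split(2)[OF w cxv] f_ten_split(2)[OF w xv]
        c_id_apply(3)[OF f_B[OF w] linear_mapD(1)[OF f_ten_lin xv]]
      using gx[OF v] by (simp only: good_def)
  qed
  also have "f_ten 3 (A.pt [x] \<otimes>\<^bsub>A.T\<^esub> ?s) = B.pt [f x] \<otimes>\<^bsub>B.T\<^esub> B.c (B.pt [f x', f y])"
    using g unfolding f_ten_split(1)[OF x s] by (simp add: good_def f_ten_pt x' y)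
  finally have e: "f_ten 3 (A.t 2 1 A.c id (A.pt [x] \<otimes>\<^bsub>A.T\<^esub> ?s)) =
      B.t 2 1 B.c id (B.pt [f x] \<otimes>\<^bsub>B.T\<^esub> B.c (B.pt [f x', f y]))" .
  have "f_ten 2 (A.c (A.pt [x \<otimes>\<^bsub>A\<^esub> x', y])) = B.c (B.pt [f x \<otimes>\<^bsub>B\<^esub> f x', f y])"
    unfolding A.c_mult(1)[OF x x' y] B.c_mult(1)[OF f_B[OF x] f_B[OF x'] f_B[OF y]]
      f_ten_id_m[OF linear_mapD(1)[OF A.tens_lins(1) linear_mapD(1)[OF ml s]]] e ..
  then show ?thesis using x x' y by (simp add: good_def f_ten_pt f_mult)
qed

text \<open>The braiding moves the letters of a product to the right of \<open>x\<close> one at a time, so the induction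
  must know that \<open>c(x \<otimes> y)\<close> has its right factors in the span of the generators \<open>X\<close> again.\<close>

lemma good_mult_right:
  assumes X: "X \<subseteq> carrier A" and x: "x \<in> carrier A" and y: "y \<in> carrier A" and y': "y' \<in> carrier A"
    and g: "good (A.pt [x, y])" and h: "A.c (A.pt [x, y]) \<in> A.right_span X"
    and g': "\<And>z. z \<in> X \<Longrightarrow> good (A.pt [z, y'])"
    and h': "\<And>z. z \<in> X \<Longrightarrow> A.c (A.pt [z, y']) \<in> A.right_span X"
  shows "good (A.pt [x, y \<otimes>\<^bsub>A\<^esub> y'])" "A.c (A.pt [x, y \<otimes>\<^bsub>A\<^esub> y']) \<in> A.right_span X"
proof -
  let ?s = "A.c (A.pt [x, y])"
  have s: "?s \<in> carrier (A.tp 2)" by (rule linear_mapD(1)[OF A.c_lin A.pt2[OF x y]])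
  note mr = A.mult_right_linear[OF A.pt1[OF y'], where j = 2, unfolded nat_plus]
  have ez: "A.pt [v, z] \<otimes>\<^bsub>A.T\<^esub> A.pt [y'] = A.pt [v] \<otimes>\<^bsub>A.T\<^esub> A.pt [z, y']" if "v \<in> carrier A" "z \<in> X" for v z
    using that X y' by (auto simp: A.pt_mults)
  \<comment> \<open>By \<open>h\<close> the tensor c(x \<otimes> y) may be replaced by v \<otimes> z
    with z in \<open>X\<close>. Then only z \<otimes> y' remains to be braided, and
    \<open>g'\<close> applies.\<close>
  have e1: "f_ten 3 (A.t 1 2 id A.c (?s \<otimes>\<^bsub>A.T\<^esub> A.pt [y'])) = B.t 1 2 id B.c (f_ten 3 (?s \<otimes>\<^bsub>A.T\<^esub> A.pt [y']))"
  proof (rule A.right_span_least[OF h linear_eq_subspace[OF A.tp_module B.tp_module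
        linear_map_comp[OF linear_map_comp[OF mr A.tens_lins(2)] f_ten_lin]
        linear_map_comp[OF linear_map_comp[OF mr f_ten_lin] B.tens_lins(2)]] _ X])
    fix v z assume v: "v \<in> carrier A" and z: "z \<in> X"
    have zA: "z \<in> carrier A" using z X by blast
    note zy = A.pt2[OF zA y'] and czy = linear_mapD(1)[OF A.c_lin A.pt2[OF zA y']]
    show "f_ten 3 (A.t 1 2 id A.c (A.pt [v, z] \<otimes>\<^bsub>A.T\<^esub> A.pt [y'])) = B.t 1 2 id B.c (f_ten 3 (A.pt [v, z] \<otimes>\<^bsub>A.T\<^esub> A.pt [y']))"
      unfolding ez[OF v z] c_id_apply(2)[OF v zy] f_ten_split(1)[OF v czy] f_ten_split(1)[OF v zy]
        c_id_apply(4)[OF f_B[OF v] linear_mapD(1)[OF f_ten_lin zy]]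
      using g'[OF z] by (simp only: good_def)
  qed
  also have "f_ten 3 (?s \<otimes>\<^bsub>A.T\<^esub> A.pt [y']) = B.c (B.pt [f x, f y]) \<otimes>\<^bsub>B.T\<^esub> B.pt [f y']"
    using g unfolding f_ten_split(2)[OF y' s] by (simp add: good_def f_ten_pt x y)
  finally have e: "f_ten 3 (A.t 1 2 id A.c (?s \<otimes>\<^bsub>A.T\<^esub> A.pt [y'])) =
     B.t 1 2 id B.c (B.c (B.pt [f x, f y]) \<otimes>\<^bsub>B.T\<^esub> B.pt [f y'])" .
  have "f_ten 2 (A.c (A.pt [x, y \<otimes>\<^bsub>A\<^esub> y'])) = B.c (B.pt [f x, f y \<otimes>\<^bsub>B\<^esub> f y'])"
    unfolding A.c_mult(2)[OF x y y'] B.c_mult(2)[OF f_B[OF x] f_B[OF y] f_B[OF y']]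
      f_ten_m_id[OF linear_mapD(1)[OF A.tens_lins(2) linear_mapD(1)[OF mr s]]] e ..
  then show "good (A.pt [x, y \<otimes>\<^bsub>A\<^esub> y'])" using x y y' by (simp add: good_def f_ten_pt f_mult)
  \<comment> \<open>The final multiplication joins the two left factors and does not touch the right
    one, so it preserves the span.\<close>
  have step: "A.t 2 1 A.m id (A.pt [v] \<otimes>\<^bsub>A.T\<^esub> r) \<in> A.right_span X" if v: "v \<in> carrier A" and r: "r \<in> A.right_span X" for v r
  proof (rule A.right_span_least[OF r linear_vimage_subspace[OF A.tp_module A.tp_module
        linear_map_comp[OF A.mult_left_linear[OF A.pt1[OF v], where k = 2, unfolded nat_plus] A.tens_lins(3)]
        A.right_span_subspace] _ X])
    fix w z assume w: "w \<in> carrier A" and z: "z \<in> X"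
    have zA: "z \<in> carrier A" using z X by blast
    have "A.t 2 1 A.m id (A.pt [v] \<otimes>\<^bsub>A.T\<^esub> A.pt [w, z]) = A.pt [v \<otimes>\<^bsub>A\<^esub> w, z]"
      using A.S.tens_pt[OF A.m_lin A.id_lin[of 1], of "[v, w]" "[z]"] v w zA by (simp add: A.m_pt A.pt_mults)
    then show "A.t 2 1 A.m id (A.pt [v] \<otimes>\<^bsub>A.T\<^esub> A.pt [w, z]) \<in> A.right_span X"
      using A.right_span_gen[OF X A.B.m_closed[OF v w] z] by simp
  qed
  show "A.c (A.pt [x, y \<otimes>\<^bsub>A\<^esub> y']) \<in> A.right_span X"
    unfolding A.c_mult(2)[OF x y y']
  proof (rule A.right_span_least[OF h linear_vimage_subspace[OF A.tp_module A.tp_module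
        linear_map_comp[OF linear_map_comp[OF mr A.tens_lins(2)] A.tens_lins(3)] A.right_span_subspace] _ X])
    fix v z assume v: "v \<in> carrier A" and z: "z \<in> X"
    have zA: "z \<in> carrier A" using z X by blast
    show "A.t 2 1 A.m id (A.t 1 2 id A.c (A.pt [v, z] \<otimes>\<^bsub>A.T\<^esub> A.pt [y'])) \<in> A.right_span X"
      unfolding ez[OF v z] c_id_apply(2)[OF v A.pt2[OF zA y']] by (rule step[OF v h'[OF z]])
  qed
qed

text \<open>\<open>gen\<close> is induction on words, where left multiplication by a generator adds
  a first letter. Compatibility with the braiding has to precede compatibility with \<Delta>,
  because \<Delta> of a product involves c.\<close>

lemma bialgebra_map_if_generators:
  assumes X: "X \<subseteq> carrier A"
    and gen: "\<And>S. subspace K A S \<Longrightarrow> \<one>\<^bsub>A\<^esub> \<in> S \<Longrightarrow> (\<And>x y. x \<in> X \<Longrightarrow> y \<in> S \<Longrightarrow> x \<otimes>\<^bsub>A\<^esub> y \<in> S) \<Longrightarrow> carrier A \<subseteq> S"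
    and cX: "\<And>x y. x \<in> X \<Longrightarrow> y \<in> X \<Longrightarrow> A.c (A.pt [x, y]) \<in> A.right_span X"
    and fX: "\<And>x y. x \<in> X \<Longrightarrow> y \<in> X \<Longrightarrow> B.c (f_ten 2 (A.pt [x, y])) = f_ten 2 (A.c (A.pt [x, y]))"
    and DX: "\<And>x. x \<in> X \<Longrightarrow> comult B (f x) = f_ten 2 (comult A x)"
    and eX: "\<And>x. x \<in> X \<Longrightarrow> counit B (f x) = counit A x"
  shows "braided_bialgebra_map K A B f"
proof -
  have XA: "x \<in> carrier A" if "x \<in> X" for x using that X by blast
  have Am: "module K A" and Bm: "module K B" by unfold_locales
  \<comment> \<open>The quantifier over generators \<open>x\<close> sits inside the set: braiding
    past the first letter of the right argument yields other generators, and the hypothesis on the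
    remaining letters is needed for those.\<close>
  let ?S1 = "{y \<in> carrier A. \<forall>x\<in>X. good (A.pt [x, y]) \<and> A.c (A.pt [x, y]) \<in> A.right_span X}"
  have S1: "carrier A \<subseteq> ?S1"
  proof (rule gen)
    show "subspace K A ?S1"
    proof (rule subspace_Ball[OF Am subspace_conj])
      fix x assume x: "x \<in> X"
      have "{y \<in> carrier A. good (A.pt [x, y])} = {y \<in> carrier A. A.pt [x, y] \<in> {s \<in> carrier (A.tp 2). good s}}"
        using A.pt2[OF XA[OF x]] by blast
      then show "subspace K A {y \<in> carrier A. good (A.pt [x, y])}"
        using linear_vimage_subspace[OF Am A.tp_module A.pt_left_lin[OF XA[OF x]] good_subspace] by simp
      show "subspace K A {y \<in> carrier A. A.c (A.pt [x, y]) \<in> A.right_span X}"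
        by (rule linear_vimage_subspace[OF Am A.tp_module linear_map_comp[OF A.pt_left_lin[OF XA[OF x]] A.c_lin] A.right_span_subspace])
    qed
    show "\<one>\<^bsub>A\<^esub> \<in> ?S1"
      using good_one(2)[OF XA] A.right_span_gen[OF X A.B.one_closed] A.c_unit(2)[OF XA] by simp
    fix z y assume z: "z \<in> X" and y: "y \<in> ?S1"
    have "good (A.pt [x, z \<otimes>\<^bsub>A\<^esub> y])" "A.c (A.pt [x, z \<otimes>\<^bsub>A\<^esub> y]) \<in> A.right_span X" if x: "x \<in> X" for x
      using good_mult_right[OF X XA[OF x] XA[OF z], of y] fX[OF x z] cX[OF x z] y
      by (simp_all add: good_def)
    then show "z \<otimes>\<^bsub>A\<^esub> y \<in> ?S1" using y XA[OF z] by simp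
  qed
  \<comment> \<open>With every right argument settled for generators on the left, the left argument
    can be built up letter by letter.\<close>
  let ?S2 = "{x \<in> carrier A. \<forall>y\<in>carrier A. good (A.pt [x, y])}"
  have S2: "carrier A \<subseteq> ?S2"
  proof (rule gen)
    show "subspace K A ?S2"
    proof (rule subspace_Ball[OF Am])
      fix y assume y: "y \<in> carrier A"
      have "{x \<in> carrier A. good (A.pt [x, y])} = {x \<in> carrier A. A.pt [x, y] \<in> {s \<in> carrier (A.tp 2). good s}}"
        using A.pt2[OF _ y] by blast
      then show "subspace K A {x \<in> carrier A. good (A.pt [x, y])}"
        using linear_vimage_subspace[OF Am A.tp_module A.pt_right_lin[OF y] good_subspace] by simp
    qed
    show "\<one>\<^bsub>A\<^esub> \<in> ?S2" using good_one(1) by simp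
    fix z y assume z: "z \<in> X" and y: "y \<in> ?S2"
    have "good (A.pt [z, w])" if "w \<in> carrier A" for w using S1 that z by blast
    then show "z \<otimes>\<^bsub>A\<^esub> y \<in> ?S2" using y XA[OF z] good_mult_left[OF XA[OF z], of y] by simp
  qed
  have braid: "B.c (f_ten 2 s) = f_ten 2 (A.c s)" if s: "s \<in> carrier (A.tp 2)" for s
    by (rule A.tp2_linear_eqI[OF B.tp_module linear_map_comp[OF f_ten_lin B.c_lin] linear_map_comp[OF A.c_lin f_ten_lin] _ s])
       (use S2 in \<open>auto simp only: good_def\<close>)
  have nat_c: "f_ten 3 (A.t 2 1 A.c id s) = B.t 2 1 B.c id (f_ten 3 s)" if "s \<in> carrier (A.tp 3)" for s
    by (rule tens_natural[OF AB.linear_space_pair_axioms f_lin A.c_lin A.id_lin[of 1] B.c_lin B.id_lin[of 1] braid[symmetric] f_ten_id, unfolded nat_plus, OF _ that])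
  have nat4: "f_ten 4 (A.t 1 3 id (A.t 2 1 A.c id) s) = B.t 1 3 id (B.t 2 1 B.c id) (f_ten 4 s)"
    if "s \<in> carrier (A.tp 4)" for s
    by (rule tens_natural[OF AB.linear_space_pair_axioms f_lin A.id_lin[of 1] A.tens_lins(1) B.id_lin[of 1] B.tens_lins(1) f_ten_id nat_c, unfolded nat_plus, OF _ that])
  let ?S3 = "{x \<in> carrier A. comult B (f x) = f_ten 2 (comult A x)}"
  have mult4: "A.t 1 3 id (A.t 2 1 A.c id) s \<in> carrier (A.tp 4)" if "s \<in> carrier (A.tp 4)" for s
    using linear_mapD(1)[OF A.S.linear_tens[OF A.id_lin[of 1] A.tens_lins(1), unfolded nat_plus]] that .
  have S3: "carrier A \<subseteq> ?S3"
  proof (rule gen)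
    show "subspace K A ?S3"
      by (rule linear_eq_subspace[OF Am B.tp_module linear_map_comp[OF f_lin B.comult_lin] linear_map_comp[OF A.comult_lin f_ten_lin]])
    show "\<one>\<^bsub>A\<^esub> \<in> ?S3" by (simp add: f_one A.comult_one B.comult_one f_ten_pt)
    fix z y assume z: "z \<in> X" and "y \<in> ?S3"
    then have zA: "z \<in> carrier A" and y: "y \<in> carrier A" "comult B (f y) = f_ten 2 (comult A y)" using XA by auto
    note cz = linear_mapD(1)[OF A.comult_lin zA] and cy = linear_mapD(1)[OF A.comult_lin y(1)]
    note czy = A.tp_mult[OF cz cy, unfolded nat_plus]
    have "f_ten 2 (comult A (z \<otimes>\<^bsub>A\<^esub> y)) = comult B (f z \<otimes>\<^bsub>B\<^esub> f y)"
      unfolding A.comult_mult[OF zA y(1)] B.comult_mult[OF f_B[OF zA] f_B[OF y(1)]] f_ten_m_m[OF mult4[OF czy]] nat4[OF czy]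
        AB.tens_map_mult[OF f_lin cz cy, unfolded nat_plus] DX[OF z] y(2) ..
    then show "z \<otimes>\<^bsub>A\<^esub> y \<in> ?S3" using zA y by (simp add: f_mult)
  qed
  let ?S4 = "{x \<in> carrier A. counit B (f x) = counit A x}"
  have hA: "counit A \<in> ring_hom A (base_algebra K)" and hB: "counit B \<in> ring_hom B (base_algebra K)"
    using A.counit_alg B.counit_alg by (simp_all add: algebra_map_def)
  have S4: "carrier A \<subseteq> ?S4"
  proof (rule gen)
    show "subspace K A ?S4"
      by (rule linear_eq_subspace[OF Am base_algebra_module[OF A.R.is_cring] linear_map_comp[OF f_lin B.counit_lin] A.counit_lin])
    show "\<one>\<^bsub>A\<^esub> \<in> ?S4" using ring_hom_one[OF hA] ring_hom_one[OF hB] by (simp add: f_one)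
    fix z y assume z: "z \<in> X" and "y \<in> ?S4"
    then have zA: "z \<in> carrier A" and y: "y \<in> carrier A" "counit B (f y) = counit A y" using XA by auto
    show "z \<otimes>\<^bsub>A\<^esub> y \<in> ?S4" using zA y eX[OF z] ring_hom_mult[OF hA zA y(1)] ring_hom_mult[OF hB f_B[OF zA] f_B[OF y(1)]]
      by (simp add: f_mult)
  qed
  show ?thesis unfolding braided_bialgebra_map_def braided_morphism_def
    using alg_map f_lin braid S3 S4 by blast
qed

end

section \<open>The map from the tensor algebra of the primitive elements\<close>

lemma (in linear_space) T_induct [consumes 1, case_names zero add pt]:
  assumes X: "X \<in> carrier T"
    and Z: "P \<zero>\<^bsub>T\<^esub>"
    and A: "\<And>X Y. X \<in> carrier T \<Longrightarrow> Y \<in> carrier T \<Longrightarrow> P X \<Longrightarrow> P Y \<Longrightarrow> P (X \<oplus>\<^bsub>T\<^esub> Y)"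
    and Wd: "\<And>a w. a \<in> carrier K \<Longrightarrow> w \<in> W \<Longrightarrow> P (a \<odot>\<^bsub>T\<^esub> pt w)"
  shows "P X"
proof -
  have "P (cl x)" if "x \<in> carrier F" for x
    using that
  proof (induction rule: F_induct)
    case zero
    show ?case using Z by (simp only: tensor_ideal_eq_zero_class[symmetric] tensor_algebra_sel)
  next
    case (add x y)
    have "cl x \<in> carrier T" "cl y \<in> carrier T" using add by (simp_all only: tensor_algebra_sel(1) image_eqI)
    then show ?case using A[of "cl x" "cl y"] add by (simp only: tensor_algebra_sel(4))
  next
    case (word a w)
    then show ?case using Wd[of a w] by (simp only: pure_tensor_def tensor_algebra_sel(6) F_word)
  qed
  then show ?thesis using X by (auto simp: tensor_algebra_sel(1))
qed

text \<open>Applying \<epsilon> \<otimes> id to x \<otimes> 1 + 1 \<otimes> x and comparing with the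
  counit law shows that \<epsilon>(x) times the class of 1 is zero in degree one of the tensor
  algebra. Applying \<epsilon> once more extracts the scalar, since \<epsilon>(1) = 1.\<close>

lemma (in bialg) counit_prim:
  assumes x: "x \<in> prim"
  shows "counit B x = \<zero>\<^bsub>K\<^esub>"
proof -
  interpret T: ring T by (rule T_ring)
  interpret TM: module K T by (rule T_module)
  have xB: "x \<in> carrier B" and Dx: "comult B x = pt [x, \<one>\<^bsub>B\<^esub>] \<oplus>\<^bsub>T\<^esub> pt [\<one>\<^bsub>B\<^esub>, x]"
    using x by (auto simp: primitives_iff)
  have nil: "pt [] \<in> carrier (tp 0)" by (rule pt_tp) auto
  have eK: "counit B y \<in> carrier K" if "y \<in> carrier B" for y
    using linear_mapD(1)[OF counit_lin that] by simp
  have e1: "counit B \<one>\<^bsub>B\<^esub> = \<one>\<^bsub>K\<^esub>"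
    using counit_alg ring_hom_one[of "counit B" B "base_algebra K"] by (simp add: algebra_map_def)
  have el: "linear_map K B (tp 0) (\<lambda>y. counit B y \<odot>\<^bsub>T\<^esub> pt [])"
    using tp_T[OF nil]
    by (intro linear_mapI)
       (simp_all add: tp_smult[OF nil] eK linear_mapD[OF counit_lin] TM.smult_l_distr TM.smult_assoc1)
  have e_lin: "linear_map K (tp 1) (tp 0) e"
    unfolding counit_map_def by (rule S.linear_lin_ext[OF multilin_1[OF el]])
  have e_pt: "e (pt [y]) = counit B y \<odot>\<^bsub>T\<^esub> pt []" if "y \<in> carrier B" for y
    unfolding counit_map_def using that
    by (subst S.lin_ext_pt[OF S.multilin_tp_T[OF multilin_1[OF el]]]) auto
  have tens: "t 1 1 e id (pt [y, z]) = counit B y \<odot>\<^bsub>T\<^esub> pt [z]" if "y \<in> carrier B" "z \<in> carrier B" for y z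
    using S.tens_pt[OF e_lin id_lin[of 1], of "[y]" "[z]"] that eK
    by (simp add: e_pt T_smult_mult pt_T pt_mult)
  have p: "pt [x] \<in> carrier T" "pt [\<one>\<^bsub>B\<^esub>] \<in> carrier T" using xB by (simp_all add: pt_T)
  have "t 1 1 e id (D (pt [x])) = pt [x]"
    using coalg pt1[OF xB] by (simp add: braided_coalgebra_def Let_def)
  moreover have "t 1 1 e id (D (pt [x])) = counit B x \<odot>\<^bsub>T\<^esub> pt [\<one>\<^bsub>B\<^esub>] \<oplus>\<^bsub>T\<^esub> pt [x]"
    using linear_mapD(2)[OF S.linear_tens[OF e_lin id_lin[of 1], unfolded nat_plus] pt2 pt2] xB p
    by (simp add: D_pt Dx tens e1)
  ultimately have "counit B x \<odot>\<^bsub>T\<^esub> pt [\<one>\<^bsub>B\<^esub>] = \<zero>\<^bsub>T\<^esub>"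
     using T.add.r_cancel_one[of "pt [x]" "counit B x \<odot>\<^bsub>T\<^esub> pt [\<one>\<^bsub>B\<^esub>]"] p eK[OF xB]
    by simp
  note z = this
  note bm = base_algebra_module[OF R.is_cring]
  note ml = multilin_multilinear[OF bm multilin_1[OF counit_lin]]
  \<comment> \<open>\<epsilon> on degree one as a functional on the whole tensor algebra, zero in
    the other degrees; \<open>base_algebra K\<close> plays K as a module over itself.\<close>
  let ?L = "lift (base_algebra K) (\<lambda>w. if length w = 1 then counit B (w ! 0) else \<zero>\<^bsub>base_algebra K\<^esub>)"
  have L1: "?L (pt [\<one>\<^bsub>B\<^esub>]) = \<one>\<^bsub>K\<^esub>"
    using lift_pt[OF bm ml, of "[\<one>\<^bsub>B\<^esub>]"] by (simp add: e1)
  have "?L (counit B x \<odot>\<^bsub>T\<^esub> pt [\<one>\<^bsub>B\<^esub>]) = counit B x"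
    using linear_mapD(3)[OF lift_linear[OF bm ml] eK[OF xB] p(2)] L1 eK[OF xB] by simp
  moreover have "?L \<zero>\<^bsub>T\<^esub> = \<zero>\<^bsub>K\<^esub>"
    using linear_map_zero[OF T_module bm lift_linear[OF bm ml]] by simp
  ultimately show ?thesis using z by simp
qed

lemma bialgI: "braided_bialgebra K B \<Longrightarrow> bialg K B"
  by (simp add: bialg_def bialg_axioms_def linear_space_def braided_bialgebra_def braided_algebra_def unital_algebra_def Let_def)

lemma truncate_eqD:
  assumes "module.truncate U = (M :: ('k, 'a) module)"
  shows "carrier U = carrier M" "mult U = mult M" "one U = one M" "zero U = zero M" "add U = add M"
    "smult U = smult M"
  using assms[symmetric] by (simp_all add: module.truncate_def)

text \<open>On generators everything passes through \<iota>: the braidings of P and U correspond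
  along \<iota>, and f after \<iota> is the inclusion of P into A, along which the braiding of P
  corresponds to that of A.\<close>

lemma tensor_bialgebra_map:
  assumes K: "field K" and A: "braided_bialgebra K A" and Tb: "braided_bialgebra K U"
    and bta: "braided_tensor_algebra K (infinitesimal_part K A) U"
    and f: "algebra_map K U A f"
    and fg: "\<And>x. x \<in> primitives K A \<Longrightarrow> f (pure_tensor K (infinitesimal_part K A) [x]) = x"
  shows "braided_bialgebra_map K U A f"
proof -
  interpret A: bialg K A by (rule bialgI[OF A])
  interpret U: bialg K U by (rule bialgI[OF Tb])
  interpret f: bialg_hom K U A f by unfold_locales (rule f)
  let ?Q = "infinitesimal_part K A"
  have Qz: "zero ?Q = zero A"
    by (simp add: infinitesimal_part_def primitive_module_def module.truncate_def
      module.extend_def braided_space.fields_def Let_def)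
  have Qm: "module K ?Q" by (rule A.subspace_module[OF A.prim_subspace]) (simp_all add: Qz)
  interpret QU: linear_space_pair K ?Q U by (rule linear_space_pairI[OF Qm U.module_axioms])
  interpret QA: linear_space_pair K ?Q A by (rule linear_space_pairI[OF Qm A.module_axioms])
  define \<iota> where "\<iota> x = pure_tensor K ?Q [x]" for x
  note tr = truncate_eqD[of U "tensor_algebra K ?Q"]
  have tru: "module.truncate U = tensor_algebra K ?Q" using bta by (simp add: braided_tensor_algebra_def)
  note sel = tr[OF tru]
  have \<iota>_lin: "linear_map K ?Q U \<iota>"
    and \<iota>_br: "\<And>s. s \<in> carrier (QU.V.tp 2) \<Longrightarrow> braiding U (tens_map K ?Q U 2 \<iota> s) = tens_map K ?Q U 2 \<iota> (braiding ?Q s)"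
    using bta by (simp_all add: braided_tensor_algebra_def braided_morphism_def \<iota>_def[abs_def])
  have \<iota>U: "\<iota> x \<in> carrier U" if "x \<in> A.prim" for x using linear_mapD(1)[OF \<iota>_lin] that by simp
  have f\<iota>: "f (\<iota> x) = x" if "x \<in> A.prim" for x using fg[OF that] by (simp add: \<iota>_def)
  let ?X = "\<iota> ` A.prim"
  have X: "?X \<subseteq> carrier U" using \<iota>U by blast
  have incl: "linear_map K ?Q A (\<lambda>x. x)"
    by (rule linear_mapI) (simp_all add: A.prim_B)
  have cong: "tensor_power K ?Q 2 = tensor_power K A.P 2" "tens_map K ?Q A 2 (\<lambda>x. x) = A.j"
    by (rule tensor_cong; simp)+
  \<comment> \<open>The braiding of U on two generators is the image under \<iota> \<otimes> \<iota>
    of an element of P \<otimes> P, so its right factors are generators again. This supplies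
    \<open>cX\<close>.\<close>
  have \<iota>2: "tens_map K ?Q U 2 \<iota> s \<in> U.right_span ?X" if s: "s \<in> carrier (QU.V.tp 2)" for s
    using s
  proof (induction rule: QU.V.tp_induct)
    case zero
    show ?case using linear_map_zero[OF QU.V.tp_module U.tp_module QU.linear_tens_map[OF \<iota>_lin]]
        subspaceD(1)[OF U.right_span_subspace] by simp
  next
    case (add X Y)
    then show ?case using linear_mapD(2)[OF QU.linear_tens_map[OF \<iota>_lin], of X 2 Y]
        subspaceD(2)[OF U.right_span_subspace] by simp
  next
    case (pt a w)
    obtain x y where w: "w = [x, y]" "x \<in> A.prim" "y \<in> A.prim" using pt by (auto simp: length_2)
    have "tens_map K ?Q U 2 \<iota> (QU.V.pt w) \<in> U.right_span ?X"
      using QU.tens_map_pt[OF \<iota>_lin pt(2,3)] w U.right_span_gen[OF X \<iota>U[OF w(2)], of "\<iota> y"] by simp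
    then show ?case using linear_mapD(3)[OF QU.linear_tens_map[OF \<iota>_lin] pt(1) QU.V.pt_tp[OF pt(2,3)]]
        subspaceD(3)[OF U.right_span_subspace pt(1)] by simp
  qed
  have f\<iota>2: "f.f_ten 2 (tens_map K ?Q U 2 \<iota> s) = A.j s" if s: "s \<in> carrier (QU.V.tp 2)" for s
    unfolding cong(2)[symmetric]
  proof (rule QU.V.tp2_linear_eqI[OF A.tp_module linear_map_comp[OF QU.linear_tens_map[OF \<iota>_lin] f.f_ten_lin]
       QA.linear_tens_map[OF incl] _ s])
    fix x y assume "x \<in> carrier ?Q" "y \<in> carrier ?Q"
    then show "f.f_ten 2 (tens_map K ?Q U 2 \<iota> (QU.V.pt [x, y])) = tens_map K ?Q A 2 (\<lambda>x. x) (QU.V.pt [x, y])"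
      using QU.tens_map_pt[OF \<iota>_lin, of "[x, y]" 2] QA.tens_map_pt[OF incl, of "[x, y]" 2]
      by (simp add: f.f_ten_pt \<iota>U f\<iota>)
  qed
  have \<iota>_pt: "U.pt [\<iota> x, \<iota> y] = tens_map K ?Q U 2 \<iota> (QU.V.pt [x, y])" if "x \<in> A.prim" "y \<in> A.prim" for x y
    using QU.tens_map_pt[OF \<iota>_lin, of "[x, y]" 2] that by simp
  have cQ: "braiding ?Q s \<in> carrier (QU.V.tp 2)" "A.j (braiding ?Q s) = A.c (A.j s)" if "s \<in> carrier (QU.V.tp 2)" for s
    using A.infinitesimal_braiding[OF K, of s] that unfolding cong by simp_all
  show ?thesis
  proof (rule f.bialgebra_map_if_generators[OF X])
    fix S assume S: "subspace K U S" and one: "\<one>\<^bsub>U\<^esub> \<in> S" and cl: "\<And>x y. x \<in> ?X \<Longrightarrow> y \<in> S \<Longrightarrow> x \<otimes>\<^bsub>U\<^esub> y \<in> S"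
    \<comment> \<open>A pure tensor is the product of its letters, built up from the empty word,
      which is the unit; this is the generation property of \<open>?X\<close>.\<close>
    have w: "QU.V.pt w \<in> S" if "w \<in> QU.V.W" for w
      using that
    proof (induction w)
      case Nil
      then show ?case using one by (simp add: sel QU.V.tensor_algebra_sel)
    next
      case (Cons x w)
      then have "QU.V.pt (x # w) = \<iota> x \<otimes>\<^bsub>U\<^esub> QU.V.pt w"
        unfolding \<iota>_def sel by (intro QU.V.pt_Cons) auto
      then show ?case using cl[of "\<iota> x" "QU.V.pt w"] Cons by simp
    qed
    show "carrier U \<subseteq> S"
    proof
      fix s assume "s \<in> carrier U"
      then have "s \<in> carrier QU.V.T" by (simp add: sel)
      then show "s \<in> S"
        by (induction rule: QU.V.T_induct) (use subspaceD[OF S] w in \<open>simp_all add: sel\<close>)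
    qed
  next
    fix x y assume "x \<in> ?X" "y \<in> ?X"
    then obtain p q where pq: "p \<in> A.prim" "q \<in> A.prim" "x = \<iota> p" "y = \<iota> q" by blast
    have s: "QU.V.pt [p, q] \<in> carrier (QU.V.tp 2)" by (rule QU.V.pt2) (use pq in simp_all)
    show "U.c (U.pt [x, y]) \<in> U.right_span ?X"
      unfolding pq(3,4) \<iota>_pt[OF pq(1,2)] \<iota>_br[OF s] by (rule \<iota>2[OF cQ(1)[OF s]])
    show "A.c (f.f_ten 2 (U.pt [x, y])) = f.f_ten 2 (U.c (U.pt [x, y]))"
      unfolding pq(3,4) \<iota>_pt[OF pq(1,2)] \<iota>_br[OF s] f\<iota>2[OF s] f\<iota>2[OF cQ(1)[OF s]] cQ(2)[OF s] ..
  next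
    fix x assume "x \<in> ?X"
    then obtain p where p: "p \<in> A.prim" "x = \<iota> p" by blast
    have D: "comult U x = U.pt [x, \<one>\<^bsub>U\<^esub>] \<oplus>\<^bsub>U.T\<^esub> U.pt [\<one>\<^bsub>U\<^esub>, x]" and e: "counit U x = \<zero>\<^bsub>K\<^esub>"
      using bta p by (simp_all add: braided_tensor_algebra_def \<iota>_def)
    have xU: "x \<in> carrier U" using p \<iota>U by simp
    show "comult A (f x) = f.f_ten 2 (comult U x)"
      unfolding D using linear_mapD(2)[OF f.f_ten_lin U.pt2[OF xU U.B.one_closed] U.pt2[OF U.B.one_closed xU]] p xU
      by (simp add: f.f_ten_pt f.f_one f\<iota> A.primitives_iff[THEN iffD1, THEN conjunct2])
    show "counit A (f x) = counit U x" unfolding e using p by (simp add: f\<iota> A.counit_prim)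
  qed
qed

section \<open>Jointly surjective families and direct limits\<close>

lemma bialgebra_mapD:
  assumes "braided_bialgebra_map K A B f"
  shows "algebra_map K A B f" "linear_map K A B f"
    "t \<in> carrier (tensor_power K A 2) \<Longrightarrow> braiding B (tens_map K A B 2 f t) = tens_map K A B 2 f (braiding A t)"
    "x \<in> carrier A \<Longrightarrow> comult B (f x) = tens_map K A B 2 f (comult A x)"
    "x \<in> carrier A \<Longrightarrow> counit B (f x) = counit A x"
  using assms by (simp_all add: braided_bialgebra_map_def braided_morphism_def)

text \<open>\<open>h\<close> is a separate argument that equals the composite on the carrier only,
  because a map induced on a quotient or a limit is known to satisfy its defining equation only
  there.\<close>

lemma tens_map_comp:
  assumes "module K U" "module K V" "module K W" and f: "linear_map K U V f" and g: "linear_map K V W g"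
    and h: "linear_map K U W h" and eq: "\<And>x. x \<in> carrier U \<Longrightarrow> g (f x) = h x"
    and t: "t \<in> carrier (tensor_power K U 2)"
  shows "tens_map K V W 2 g (tens_map K U V 2 f t) = tens_map K U W 2 h t"
proof -
  interpret UV: linear_space_pair K U V by (rule linear_space_pairI) fact+
  interpret VW: linear_space_pair K V W by (rule linear_space_pairI) fact+
  interpret UW: linear_space_pair K U W by (rule linear_space_pairI) fact+
  show ?thesis
  proof (rule UV.V.tp2_linear_eqI[OF VW.W.tp_module linear_map_comp[OF UV.linear_tens_map[OF f] VW.linear_tens_map[OF g]]
      UW.linear_tens_map[OF h] _ t])
    fix x y assume xy: "x \<in> carrier U" "y \<in> carrier U"
    show "tens_map K V W 2 g (tens_map K U V 2 f (UV.V.pt [x, y])) = tens_map K U W 2 h (UV.V.pt [x, y])"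
      using UV.tens_map_pt[OF f, of "[x, y]" 2] VW.tens_map_pt[OF g, of "[f x, f y]" 2] UW.tens_map_pt[OF h, of "[x, y]" 2]
        xy linear_mapD(1)[OF f] by (simp add: eq)
  qed
qed

lemma bialgebra_map_comp:
  assumes A: "braided_bialgebra K A" and B: "braided_bialgebra K B" and C: "braided_bialgebra K C"
    and f: "braided_bialgebra_map K A B f" and g: "braided_bialgebra_map K B C g"
  shows "braided_bialgebra_map K A C (\<lambda>x. g (f x))"
proof -
  interpret A: bialg K A by (rule bialgI[OF A])
  interpret B: bialg K B by (rule bialgI[OF B])
  interpret C: bialg K C by (rule bialgI[OF C])
  interpret AB: linear_space_pair K A B ..
  note F = bialgebra_mapD[OF f] and G = bialgebra_mapD[OF g]
  note lin = linear_map_comp[OF F(2) G(2)]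
  have t2: "tens_map K B C 2 g (tens_map K A B 2 f s) = tens_map K A C 2 (\<lambda>x. g (f x)) s"
    if "s \<in> carrier (A.tp 2)" for s
    by (rule tens_map_comp[OF A.module_axioms B.module_axioms C.module_axioms F(2) G(2) lin refl that])
  have "(\<lambda>x. g (f x)) \<in> ring_hom A C"
    using F(1) G(1) ring_hom_trans[of f A B g C] by (simp add: algebra_map_def comp_def)
  moreover have "braiding C (tens_map K A C 2 (\<lambda>x. g (f x)) s) = tens_map K A C 2 (\<lambda>x. g (f x)) (braiding A s)"
    if s: "s \<in> carrier (A.tp 2)" for s
    using G(3)[OF linear_mapD(1)[OF AB.linear_tens_map[OF F(2)] s]] F(3)[OF s] t2[OF s]
      t2[OF linear_mapD(1)[OF A.c_lin s]] by simp
  moreover have "comult C (g (f x)) = tens_map K A C 2 (\<lambda>x. g (f x)) (comult A x)" if x: "x \<in> carrier A" for x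
    using G(4)[OF linear_mapD(1)[OF F(2) x]] F(4)[OF x] t2[OF linear_mapD(1)[OF A.comult_lin x]] by simp
  moreover have "counit C (g (f x)) = counit A x" if x: "x \<in> carrier A" for x
    using G(5)[OF linear_mapD(1)[OF F(2) x]] F(5)[OF x] by simp
  ultimately show ?thesis using lin
    by (simp add: braided_bialgebra_map_def braided_morphism_def algebra_map_def)
qed

text \<open>Each condition on g involves at most two elements or, by linearity, a pure tensor of
  degree two. If both elements come from one \<open>B i\<close>, the condition can be pulled back
  there, where it holds for \<open>q i\<close>. This serves quotients, with a single index, and
  direct limits.\<close>

lemma bialgebra_map_descend:
  fixes B :: "'i \<Rightarrow> ('k, 'b, 'm) braided_bialg_scheme"
  assumes L: "braided_bialgebra K L" and A: "braided_bialgebra K A"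
    and B: "\<And>i. braided_bialgebra K (B i)"
    and p: "\<And>i. braided_bialgebra_map K (B i) L (p i)"
    and q: "\<And>i. braided_bialgebra_map K (B i) A (q i)"
    and g: "\<And>i x. x \<in> carrier (B i) \<Longrightarrow> g (p i x) = q i x"
    and cover: "\<And>x y. x \<in> carrier L \<Longrightarrow> y \<in> carrier L \<Longrightarrow>
      \<exists>i. x \<in> p i ` carrier (B i) \<and> y \<in> p i ` carrier (B i)"
  shows "braided_bialgebra_map K L A g"
proof -
  interpret L: bialg K L by (rule bialgI[OF L])
  interpret A: bialg K A by (rule bialgI[OF A])
  interpret B: bialg K "B i" for i by (rule bialgI[OF B])
  interpret LA: linear_space_pair K L A ..
  interpret BL: linear_space_pair K "B i" L for i ..
  note Pm = bialgebra_mapD[OF p] and Qm = bialgebra_mapD[OF q]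
  note pl = linear_mapD[OF Pm(2)] and ql = linear_mapD[OF Qm(2)]
  have ph: "p i \<in> ring_hom (B i) L" and qh: "q i \<in> ring_hom (B i) A" for i
    using Pm(1)[of i] Qm(1)[of i] by (simp_all add: algebra_map_def)
  have lift2: "\<exists>i x' y'. x' \<in> carrier (B i) \<and> y' \<in> carrier (B i) \<and> x = p i x' \<and> y = p i y'"
    if "x \<in> carrier L" "y \<in> carrier L" for x y
    using cover[OF that] by blast
  have lift1: "\<exists>i x'. x' \<in> carrier (B i) \<and> x = p i x'" if "x \<in> carrier L" for x
    using cover[OF that that] by blast
  have lin: "linear_map K L A g"
  proof (rule linear_mapI)
    fix x assume x: "x \<in> carrier L"
    obtain i x' where i: "x' \<in> carrier (B i)" "x = p i x'" using lift1[OF x] by blast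
    show "g x \<in> carrier A" using g[OF i(1)] ql(1)[OF i(1)] i(2) by simp
    show "g (a \<odot>\<^bsub>L\<^esub> x) = a \<odot>\<^bsub>A\<^esub> g x" if a: "a \<in> carrier K" for a
      using g[OF B.smult_closed[OF a i(1)]] pl(3)[OF a i(1)] ql(3)[OF a i(1)] g[OF i(1)] i(2) by simp
  next
    fix x y assume "x \<in> carrier L" "y \<in> carrier L"
    then obtain i x' y' where i: "x' \<in> carrier (B i)" "y' \<in> carrier (B i)" "x = p i x'" "y = p i y'"
      using lift2 by blast
    show "g (x \<oplus>\<^bsub>L\<^esub> y) = g x \<oplus>\<^bsub>A\<^esub> g y"
      using g[OF B.M.add.m_closed[OF i(1,2)]] pl(2)[OF i(1,2)] ql(2)[OF i(1,2)] g[OF i(1)] g[OF i(2)] i(3,4) by simp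
  qed
  have hom: "g \<in> ring_hom L A"
  proof (rule ring_hom_memI)
    fix x y assume "x \<in> carrier L" "y \<in> carrier L"
    then obtain i x' y' where i: "x' \<in> carrier (B i)" "y' \<in> carrier (B i)" "x = p i x'" "y = p i y'"
      using lift2 by blast
    show "g (x \<otimes>\<^bsub>L\<^esub> y) = g x \<otimes>\<^bsub>A\<^esub> g y"
      using g[OF B.B.m_closed[OF i(1,2)]] ring_hom_mult[OF ph i(1,2)] ring_hom_mult[OF qh i(1,2)] g[OF i(1)] g[OF i(2)] i(3,4)
      by simp
  next
    \<comment> \<open>Any index will do for the unit; covering some element of L provides
      one.\<close>
    obtain i where "\<zero>\<^bsub>L\<^esub> \<in> p i ` carrier (B i)" using cover L.M.zero_closed by blast
    show "g \<one>\<^bsub>L\<^esub> = \<one>\<^bsub>A\<^esub>"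
      using g[OF B.B.one_closed[of i]] ring_hom_one[OF ph[of i]] ring_hom_one[OF qh[of i]] by simp
  qed (use linear_mapD[OF lin] in auto)
  have t2: "tens_map K L A 2 g (tens_map K (B i) L 2 (p i) s) = tens_map K (B i) A 2 (q i) s"
    if "s \<in> carrier (B.tp i 2)" for s i
    by (rule tens_map_comp[OF B.module_axioms L.module_axioms A.module_axioms Pm(2) lin Qm(2) g that])
  have braid: "A.c (tens_map K L A 2 g s) = tens_map K L A 2 g (L.c s)" if s: "s \<in> carrier (L.tp 2)" for s
  proof (rule L.tp2_linear_eqI[OF A.tp_module linear_map_comp[OF LA.linear_tens_map[OF lin] A.c_lin]
        linear_map_comp[OF L.c_lin LA.linear_tens_map[OF lin]] _ s])
    fix x y assume "x \<in> carrier L" "y \<in> carrier L"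
    then obtain i x' y' where i: "x' \<in> carrier (B i)" "y' \<in> carrier (B i)" "x = p i x'" "y = p i y'"
      using lift2 by blast
    let ?s = "B.pt i [x', y']"
    note s = B.pt2[OF i(1,2)]
    have e: "L.pt [x, y] = tens_map K (B i) L 2 (p i) ?s"
      using BL.tens_map_pt[OF Pm(2), of "[x', y']" i 2] i by simp
    show "A.c (tens_map K L A 2 g (L.pt [x, y])) = tens_map K L A 2 g (L.c (L.pt [x, y]))"
      unfolding e Pm(3)[OF s] t2[OF s] t2[OF linear_mapD(1)[OF B.c_lin s]] by (rule Qm(3)[OF s])
  qed
  have "comult A (g x) = tens_map K L A 2 g (comult L x) \<and> counit A (g x) = counit L x" if x: "x \<in> carrier L" for x
  proof -
    obtain i x' where i: "x' \<in> carrier (B i)" "x = p i x'" using lift1[OF x] by blast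
    show ?thesis unfolding i(2) g[OF i(1)] Pm(4,5)[OF i(1)] Qm(4,5)[OF i(1)] t2[OF linear_mapD(1)[OF B.comult_lin i(1)]]
      by simp
  qed
  then show ?thesis using lin hom braid
    by (simp add: braided_bialgebra_map_def braided_morphism_def algebra_map_def)
qed

lemma quotient_bialgebraD:
  assumes "quotient_bialgebra K B J Q"
  shows "carrier Q = quotient_proj B J ` carrier B" "braided_bialgebra K Q"
    "braided_bialgebra_map K B Q (quotient_proj B J)"
  using assms by (simp_all add: quotient_bialgebra_def)

section \<open>Direct limits of sequences\<close>

lemma transition_Suc: "transition p (Suc n) d (p n x) = transition p n (Suc d) x"
  by (induction d) simp_all

lemma limit_class_self: "x \<in> carrier (X n) \<Longrightarrow> (n, x) \<in> limit_class X p n x"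
  by (auto simp: limit_class_def)

text \<open>Classes are formed by eventual equality, so passing to the image in the next stage
  changes only the number of steps to a common stage.\<close>

lemma limit_class_Suc: "limit_class X p (Suc n) (p n x) = limit_class X p n x"
proof -
  have "(\<exists>d e. Suc n + d = m + e \<and> transition p (Suc n) d (p n x) = transition p m e y) \<longleftrightarrow>
    (\<exists>d e. n + d = m + e \<and> transition p n d x = transition p m e y)" (is "?L \<longleftrightarrow> ?R") for m y
  proof
    assume ?L
    then obtain d e where "Suc n + d = m + e" "transition p (Suc n) d (p n x) = transition p m e y" by blast
    then have "n + Suc d = m + e \<and> transition p n (Suc d) x = transition p m e y"
      by (simp only: transition_Suc) simp
    then show ?R by blast
  next
    assume ?R
    then obtain d e where "n + d = m + e" "transition p n d x = transition p m e y" by blast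
    \<comment> \<open>As \<open>d\<close> may be 0, one more step is taken on both sides, which
      makes the first step out of stage \<open>n\<close> available.\<close>
    then have "Suc n + d = m + Suc e \<and> transition p (Suc n) d (p n x) = transition p m (Suc e) y"
      by (simp add: transition_Suc del: transition.simps) simp
    then show ?L by blast
  qed
  then show ?thesis by (simp add: limit_class_def)
qed

lemma limit_class_transition: "limit_class X p (n + d) (transition p n d x) = limit_class X p n x"
  by (induction d) (simp_all add: limit_class_Suc)

text \<open>Eventually equal elements have the same image in A, because the maps \<open>g n\<close>
  are compatible with the transition maps; so evaluating at a chosen representative of a class is
  well defined.\<close>

lemma direct_limit_map:
  assumes X: "\<And>n. braided_bialgebra K (X n)" and A: "braided_bialgebra K A"
    and p: "\<And>n x. x \<in> carrier (X n) \<Longrightarrow> p n x \<in> carrier (X (Suc n))"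
    and L: "direct_limit K X p L"
    and g: "\<And>n. braided_bialgebra_map K (X n) A (g n)"
    and compat: "\<And>n x. x \<in> carrier (X n) \<Longrightarrow> g (Suc n) (p n x) = g n x"
  obtains gbar where "braided_bialgebra_map K L A gbar"
    "\<And>n x. x \<in> carrier (X n) \<Longrightarrow> gbar (limit_class X p n x) = g n x"
proof -
  have tr: "transition p n d x \<in> carrier (X (n + d)) \<and> g (n + d) (transition p n d x) = g n x"
    if "x \<in> carrier (X n)" for n d x
    by (induction d) (use that p compat in auto)
  define gbar where "gbar C = (case (SOME z. z \<in> C) of (n, x) \<Rightarrow> g n x)" for C
  have gbar: "gbar (limit_class X p n x) = g n x" if x: "x \<in> carrier (X n)" for n x
  proof -
    obtain m y where my: "(SOME z. z \<in> limit_class X p n x) = (m, y)" by fastforce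
    then have "(m, y) \<in> limit_class X p n x"
      using someI[of "\<lambda>z. z \<in> limit_class X p n x", OF limit_class_self[where X = X and n = n, OF x]] by simp
    then obtain d e where "y \<in> carrier (X m)" "n + d = m + e" "transition p n d x = transition p m e y"
      by (auto simp: limit_class_def)
    then have "g m y = g n x" using tr[OF x, of d] tr[of y m e] by metis
    then show ?thesis by (simp add: gbar_def my)
  qed
  have Lc: "carrier L = (\<Union>n. limit_class X p n ` carrier (X n))" and Lb: "braided_bialgebra K L"
    and Lm: "\<And>n. braided_bialgebra_map K (X n) L (limit_class X p n)"
    using L by (simp_all add: direct_limit_def)
  have "braided_bialgebra_map K L A gbar"
  proof (rule bialgebra_map_descend[OF Lb A X Lm g gbar])
    fix a b assume "a \<in> carrier L" "b \<in> carrier L"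
    then obtain n x m y where xy: "x \<in> carrier (X n)" "a = limit_class X p n x"
      "y \<in> carrier (X m)" "b = limit_class X p m y" by (auto simp: Lc)
    \<comment> \<open>Both elements are moved to the common stage \<open>n + m\<close>, as the
      pairwise covering condition demands.\<close>
    have "a = limit_class X p (n + m) (transition p n m x)" "b = limit_class X p (n + m) (transition p m n y)"
      using limit_class_transition[of X p n m x] limit_class_transition[of X p m n y] xy by (simp_all add: add.commute)
    then show "\<exists>k. a \<in> limit_class X p k ` carrier (X k) \<and> b \<in> limit_class X p k ` carrier (X k)"
      using tr[OF xy(1), of m] tr[OF xy(3), of n] by (metis add.commute imageI)
  qed
  then show thesis using gbar that by blast
qed

theorem theorem6p7:
  fixes K :: "'k ring"
    and A :: "('k, 'a) braided_bialg" and bP :: "('k, 'a) bracket"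
    and V :: "('k, 'v) braided_space" and b :: "('k, 'v) bracket"
    and U :: "('k, (nat \<times> ('k, 'v) tensor) set) braided_bialg"
    and h :: "'v \<Rightarrow> 'a"
  assumes "field K"
    and "braided_bialgebra K A"
    and "is_infinitesimal_bracket K A bP"
    and "braided_vector_space K V"
    and "is_bracket K V b"
    and "is_universal_enveloping K b U"
    and "bracket_morphism K V b (infinitesimal_part K A) bP h"
  shows "\<exists>hbar. braided_bialgebra_map K U A hbar \<and>
           (\<forall>v\<in>carrier V. hbar (canonical_map K b v) = h v)"
proof -
  let ?P = "infinitesimal_part K A"
  interpret A: bialg K A by (rule bialgI) fact
  have bP: "is_bracket K ?P bP"
    using assms(3) by (simp add: is_infinitesimal_bracket_def Let_def)
  obtain \<psi> where psi: "algebra_map K (stage bP 0) A (\<psi> 0)"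
      "\<And>x. x \<in> primitives K A \<Longrightarrow> \<psi> 0 (pure_tensor K ?P [x]) = x"
      "\<And>n x. x \<in> carrier (stage bP n) \<Longrightarrow> \<psi> (Suc n) (stage_proj K bP n x) = \<psi> n x"
    using assms(3) by (auto simp: is_infinitesimal_bracket_def Let_def)
  obtain Uh where Uh: "braided_bialgebra_map K (stage b 0) (stage bP 0) (Uh 0)"
      "\<And>v. v \<in> carrier V \<Longrightarrow> Uh 0 (pure_tensor K V [v]) = pure_tensor K ?P [h v]"
      "\<And>n x. x \<in> carrier (stage b n) \<Longrightarrow> Uh (Suc n) (stage_proj K b n x) = stage_proj K bP n (Uh n x)"
    and h: "linear_map K V ?P h"
    using assms(7) by (auto simp: bracket_morphism_def braided_morphism_def)
  \<comment> \<open>Stated for an arbitrary bracket, since it is applied both to \<open>b\<close>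
    and to \<open>bP\<close>.\<close>
  have stage: "braided_bialgebra K (stage c n)" "carrier (stage c (Suc n)) = stage_proj K c n ` carrier (stage c n)"
    "braided_bialgebra_map K (stage c n) (stage c (Suc n)) (stage_proj K c n)"
    if "is_bracket K W c" for n and W :: "('k, 'w) braided_space" and c
    using that quotient_bialgebraD[of K "stage c n" "stage_ideal K c n" "stage c (Suc n)"]
    by (simp_all add: is_bracket_def stage_proj_def)
  note bst = stage[OF assms(5)] and Pst = stage[OF bP]
  \<comment> \<open>Beyond stage 0, \<open>bracket_morphism\<close> provides only functions that
    commute with the projections. That they respect the carriers follows from surjectivity of the
    projections.\<close>
  have UhC: "Uh n x \<in> carrier (stage bP n)" if "x \<in> carrier (stage b n)" for n x
    using that
  proof (induction n arbitrary: x)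
    case 0
    then show ?case using linear_mapD(1)[OF bialgebra_mapD(2)[OF Uh(1)]] by simp
  next
    case (Suc n)
    then obtain y where "y \<in> carrier (stage b n)" "x = stage_proj K b n y" using bst(2) by blast
    then show ?case using Suc.IH Uh(3) Pst(2) by simp
  qed
  define g where "g n x = \<psi> n (Uh n x)" for n x
  have compat: "g (Suc n) (stage_proj K b n x) = g n x" if "x \<in> carrier (stage b n)" for n x
    using that by (simp add: g_def Uh(3) psi(3) UhC)
  \<comment> \<open>Only at stage 0 are \<open>Uh\<close> and \<open>\<psi>\<close> treated as
    bialgebra maps one by one. From then on it is the composite that descends along the surjective
    projections, with the target A staying fixed.\<close>
  have g: "braided_bialgebra_map K (stage b n) A (g n)" for n
  proof (induction n)
    case 0
    have "braided_bialgebra_map K (stage bP 0) A (\<psi> 0)"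
      by (rule tensor_bialgebra_map[OF assms(1,2) Pst(1) _ psi(1,2)]) (use bP in \<open>simp add: is_bracket_def\<close>)
    then show ?case unfolding g_def
      by (rule bialgebra_map_comp[OF bst(1) Pst(1) assms(2) Uh(1)])
  next
    case (Suc n)
    show ?case
      \<comment> \<open>A single projection covers the whole quotient, so the one-element type
        \<open>unit\<close> serves as index type.\<close>
      by (rule bialgebra_map_descend[where B = "\<lambda>_::unit. stage b n", OF bst(1) assms(2) bst(1) bst(3) Suc compat])
         (simp_all add: bst(2))
  qed
  have pC: "stage_proj K b n x \<in> carrier (stage b (Suc n))" if "x \<in> carrier (stage b n)" for n x
    using that bst(2) by blast
  obtain hbar where hbar: "braided_bialgebra_map K U A hbar"
    "\<And>n x. x \<in> carrier (stage b n) \<Longrightarrow> hbar (limit_class (stage b) (stage_proj K b) n x) = g n x"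
    using direct_limit_map[OF bst(1) assms(2) pC assms(6)[unfolded is_universal_enveloping_def] g compat] by blast
  have "hbar (canonical_map K b v) = h v" if v: "v \<in> carrier V" for v
  proof -
    have Vm: "module K V" using assms(4) by (simp add: braided_vector_space_def Let_def)
    interpret V: linear_space K V by (simp add: linear_space_def Vm)
    have i: "incl b 0 v = pure_tensor K V [v]" and bta: "braided_tensor_algebra K V (stage b 0)"
      using assms(5) v by (simp_all add: is_bracket_def)
    have "carrier (stage b 0) = carrier V.T"
      using bta by (intro truncate_eqD) (simp add: braided_tensor_algebra_def)
    then have "V.pt [v] \<in> carrier (stage b 0)" using V.pt_T[of "[v]"] v by simp
    then have "hbar (canonical_map K b v) = \<psi> 0 (pure_tensor K ?P [h v])"
      by (simp add: canonical_map_def i hbar(2) g_def Uh(2) v)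
    also have "\<dots> = h v" by (rule psi(2)) (use linear_mapD(1)[OF h v] in simp)
    finally show ?thesis .
  qed
  with hbar(1) show ?thesis by blast
qed

end
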